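(* Let $n\ge 1$ and let a symplectic hierarchy of length $n$ be given, with groups $G_1,\dots,G_n=G$ and $H_1,\dots,H_n$, homomorphisms $\rho_{i-1}:G_{i-1}\to \mathrm{Aut}(H_i)$ ($2\le i\le n$), symplectic structures $B_i$ on $H_i$, and twists $J_i=J_{B_i}$ for $\mathbb{C}[H_i]$. Then the twist $\bar J=J_n\cdots J_1\in \mathbb{C}[G]\otimes\mathbb{C}[G]$ is minimal, i.e. the triangular Hopf algebra $(\mathbb{C}[G]^{\bar J},\ \bar J_{21}^{-1}\bar J)$ is minimal. Its universal R-matrix $R=\bar J_{21}^{-1}\bar J$ has the form $$R=|G|^{-1}\sum_{x_i,y_i\in H_i,\ 1\le i\le n} e^{\sum_{j=1}^n\langle \rho_{j-1}(x_{j-1}^{1/2}\cdots x_1^{1/2})^{-1}x_j,\ \rho_{j-1}(y_{j-1}^{1/2}\cdots y_1^{1/2})^{-1}y_j^{1/2}\rangle}\; x_n\cdots x_1\otimes y_n\cdots y_1 .$$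
   Context: Twists. Let $\mathcal{A}$ be a Hopf algebra with coproduct $\Delta$, counit $\varepsilon$ and identity map $I$. A twist for $\mathcal A$ is an invertible $J\in\mathcal A\otimes\mathcal A$ with $(\Delta\otimes I)(J)J_{12}=(I\otimes\Delta)(J)J_{23}$ and $(\varepsilon\otimes I)(J)=(I\otimes\varepsilon)(J)=1$. Then $\mathcal A^J$ denotes the Hopf algebra equal to $\mathcal A$ as an algebra, with coproduct $\Delta^J(x)=J^{-1}\Delta(x)J$. If $(\mathcal A,R)$ is triangular, so is $(\mathcal A^J,J_{21}^{-1}RJ)$, where $J_{21}$ is $J$ with its two tensor factors interchanged. For a finite group $G$, $\mathbb{C}[G]$ is triangular with R-matrix $1\otimes1$, so $\mathbb{C}[G]^J$ is triangular with R-matrix $J_{21}^{-1}J$. Minimality. A quasitriangular Hopf algebra $(\mathcal A,R)$, with $R=\sum_i x_i\otimes y_i$ written in the shortest possible way, is called minimal if $\mathcal A$ is generated by its Hopf subalgebras $\mathrm{span}\{x_i\}$ and $\mathrm{span}\{y_i\}$. A twist $J$ for $\mathbb{C}[G]$ is called minimal if $(\mathbb{C}[G]^J,J_{21}^{-1}J)$ is minimal. Symplectic structures. For a finite abelian group $H$ let $H^*=\mathrm{Hom}(H,\mathbb{C}^* )$ and let $(\cdot,\cdot):H\times H^*\to 2\pi i(\mathbb{R}/\mathbb{Z})$ be the standard pairing, so $e^{(x,\chi)}=\chi(x)$. A symplectic structure on $H$ is an isomorphism $B:H\to H^*$ with $B^*=-B$; the associated skew-symmetric bilinear form is $\langle x,y\rangle=(x,By)$.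 Put $$J_B=|H|^{-1}\sum_{x,y\in H}e^{\langle x,y\rangle}\,x\otimes y\in\mathbb{C}[H]\otimes\mathbb{C}[H],$$ which is a twist for $\mathbb{C}[H]$. If $|H|$ is odd, $x^{1/2}$ denotes the unique element of $H$ whose square is $x$. Hierarchies. A hierarchy of length $n$ consists of finite groups $G_1,\dots,G_n=G$, $H_1,\dots,H_n$ and homomorphisms $\rho_{i-1}:G_{i-1}\to\mathrm{Aut}(H_i)$, $i=2,\dots,n$, such that $G_1=H_1$ and $G_i=G_{i-1}\ltimes H_i$ (semidirect product made using $\rho_{i-1}$, so $ghg^{-1}=\rho_{i-1}(g)(h)$ for $g\in G_{i-1}$, $h\in H_i$). All $G_i$ and $H_i$ are canonically subgroups of $G$. A twist hierarchy is a hierarchy together with twists $J_i$ for $\mathbb{C}[H_i]$, $i=1,\dots,n$, such that $J_i$ is invariant under $\rho_{i-1}(G_{i-1})$ (acting diagonally on $\mathbb{C}[H_i]\otimes\mathbb{C}[H_i]$) for $i=2,\dots,n$. A symplectic hierarchy is a twist hierarchy in which every $H_i$ is abelian of odd order and $J_i=J_{B_i}$ for a symplectic structure $B_i$ on $H_i$. In the formula for $R$, $\langle\cdot,\cdot\rangle$ in the $j$-th summand is the form on $H_j$ defined by $B_j$, and the $j=1$ summand is understood as $\langle x_1,y_1^{1/2}\rangle$. Products such as $J_n\cdots J_1$ are taken in $\mathbb{C}[G]\otimes\mathbb{C}[G]$. *)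

theory Defs
  imports
    "HOL-Algebra.Bij"
    "HOL-Algebra.Coset"
    "HOL-Analysis.Complex_Transcendental"
begin

section \<open>Finite-dimensional Hopf algebras in coordinates\<close>

text \<open>
  A finite-dimensional algebra A with a chosen basis indexed by a finite set X is identified with
  the space of functions X \<Rightarrow> complex, extended by 0 outside X. Then A \<otimes> A is the
  space of functions on X \<times> X, and the triple tensor power is A \<otimes> (A \<otimes> A), the
  space of functions on X \<times> (X \<times> X).
\<close>

definition vecs :: "'b set \<Rightarrow> ('b \<Rightarrow> complex) set" where
  "vecs X = {f. \<forall>x. x \<notin> X \<longrightarrow> f x = 0}"

definition bvec :: "'b \<Rightarrow> 'b \<Rightarrow> complex" where
  "bvec x = (\<lambda>z. if z = x then 1 else 0)"

definition tens :: "('a \<Rightarrow> complex) \<Rightarrow> ('b \<Rightarrow> complex) \<Rightarrow> 'a \<times> 'b \<Rightarrow> complex" where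
  "tens s t = (\<lambda>(a, b). s a * t b)"

definition flip :: "('a \<times> 'b \<Rightarrow> complex) \<Rightarrow> 'b \<times> 'a \<Rightarrow> complex" where
  "flip t = (\<lambda>(b, a). t (a, b))"

text \<open>The linear extension of a map of bases:\<close>

definition push :: "('a \<Rightarrow> 'b) \<Rightarrow> 'a set \<Rightarrow> ('a \<Rightarrow> complex) \<Rightarrow> 'b \<Rightarrow> complex" where
  "push f X t = (\<lambda>z. \<Sum>x\<in>X. t x * bvec (f x) z)"

definition linear_on_vecs :: "'a set \<Rightarrow> (('a \<Rightarrow> complex) \<Rightarrow> 'b \<Rightarrow> complex) \<Rightarrow> bool" where
  "linear_on_vecs X \<phi> \<longleftrightarrow>
     (\<forall>s\<in>vecs X. \<forall>t\<in>vecs X. \<phi> (\<lambda>x. s x + t x) = (\<lambda>z. \<phi> s z + \<phi> t z)) \<and>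
     (\<forall>c. \<forall>s\<in>vecs X. \<phi> (\<lambda>x. c * s x) = (\<lambda>z. c * \<phi> s z))"

record 'b alg = "('b \<Rightarrow> complex) monoid" +
  basis :: "'b set"

record 'b bialg = "'b alg" +
  comult :: "('b \<Rightarrow> complex) \<Rightarrow> 'b \<times> 'b \<Rightarrow> complex"
  counit :: "('b \<Rightarrow> complex) \<Rightarrow> complex"

definition fin_algebra :: "('b, 'm) alg_scheme \<Rightarrow> bool" where
  "fin_algebra A \<longleftrightarrow>
     finite (basis A) \<and> carrier A = vecs (basis A) \<and> Group.monoid A \<and>
     (\<forall>s\<in>carrier A. linear_on_vecs (basis A) (\<lambda>t. s \<otimes>\<^bsub>A\<^esub> t)) \<and>
     (\<forall>t\<in>carrier A. linear_on_vecs (basis A) (\<lambda>s. s \<otimes>\<^bsub>A\<^esub> t))"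

text \<open>The product is the bilinear extension of (x \<otimes> y) (x' \<otimes> y') = xx' \<otimes> yy'.\<close>

definition tensor_alg :: "('a, 'm) alg_scheme \<Rightarrow> ('b, 'k) alg_scheme \<Rightarrow> ('a \<times> 'b) alg" where
  "tensor_alg A B =
     \<lparr>carrier = vecs (basis A \<times> basis B),
      monoid.mult = (\<lambda>s t p. \<Sum>(x, y)\<in>basis A \<times> basis B. \<Sum>(x', y')\<in>basis A \<times> basis B.
                s (x, y) * t (x', y') *
                tens (bvec x \<otimes>\<^bsub>A\<^esub> bvec x') (bvec y \<otimes>\<^bsub>B\<^esub> bvec y') p),
      one = tens \<one>\<^bsub>A\<^esub> \<one>\<^bsub>B\<^esub>,
      basis = basis A \<times> basis B\<rparr>"

abbreviation tensor2 :: "('b, 'm) alg_scheme \<Rightarrow> ('b \<times> 'b) alg" where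
  "tensor2 A \<equiv> tensor_alg A A"

abbreviation tensor3 :: "('b, 'm) alg_scheme \<Rightarrow> ('b \<times> 'b \<times> 'b) alg" where
  "tensor3 A \<equiv> tensor_alg A (tensor2 A)"

definition leg12 :: "('b, 'm) alg_scheme \<Rightarrow> ('b \<times> 'b \<Rightarrow> complex) \<Rightarrow> 'b \<times> 'b \<times> 'b \<Rightarrow> complex" where
  "leg12 A t = (\<lambda>(a, b, c). t (a, b) * \<one>\<^bsub>A\<^esub> c)"

definition leg13 :: "('b, 'm) alg_scheme \<Rightarrow> ('b \<times> 'b \<Rightarrow> complex) \<Rightarrow> 'b \<times> 'b \<times> 'b \<Rightarrow> complex" where
  "leg13 A t = (\<lambda>(a, b, c). t (a, c) * \<one>\<^bsub>A\<^esub> b)"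

definition leg23 :: "('b, 'm) alg_scheme \<Rightarrow> ('b \<times> 'b \<Rightarrow> complex) \<Rightarrow> 'b \<times> 'b \<times> 'b \<Rightarrow> complex" where
  "leg23 A t = (\<lambda>(a, b, c). \<one>\<^bsub>A\<^esub> a * t (b, c))"

text \<open>
  A linear map acts on one tensor factor by acting on slices: since
  t = \<Sum>b. t(-, b) \<otimes> b, one has (\<phi> \<otimes> I)(t) = \<Sum>b. \<phi>(t(-, b)) \<otimes> b.
\<close>

definition comult_left ::
    "('b, 'm) bialg_scheme \<Rightarrow> ('b \<times> 'b \<Rightarrow> complex) \<Rightarrow> 'b \<times> 'b \<times> 'b \<Rightarrow> complex" where
  "comult_left A t = (\<lambda>(a, b, c). comult A (\<lambda>x. t (x, c)) (a, b))"

definition comult_right ::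
    "('b, 'm) bialg_scheme \<Rightarrow> ('b \<times> 'b \<Rightarrow> complex) \<Rightarrow> 'b \<times> 'b \<times> 'b \<Rightarrow> complex" where
  "comult_right A t = (\<lambda>(a, b, c). comult A (\<lambda>y. t (a, y)) (b, c))"

definition counit_left ::
    "('b, 'm) bialg_scheme \<Rightarrow> ('b \<times> 'b \<Rightarrow> complex) \<Rightarrow> 'b \<Rightarrow> complex" where
  "counit_left A t = (\<lambda>b. counit A (\<lambda>x. t (x, b)))"

definition counit_right ::
    "('b, 'm) bialg_scheme \<Rightarrow> ('b \<times> 'b \<Rightarrow> complex) \<Rightarrow> 'b \<Rightarrow> complex" where
  "counit_right A t = (\<lambda>a. counit A (\<lambda>y. t (a, y)))"

definition mult_map :: "('b, 'm) alg_scheme \<Rightarrow> ('b \<times> 'b \<Rightarrow> complex) \<Rightarrow> 'b \<Rightarrow> complex" where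
  "mult_map A t = (\<lambda>z. \<Sum>(x, y)\<in>basis A \<times> basis A. t (x, y) * (bvec x \<otimes>\<^bsub>A\<^esub> bvec y) z)"

definition bialgebra :: "('b, 'm) bialg_scheme \<Rightarrow> bool" where
  "bialgebra A \<longleftrightarrow>
     fin_algebra A \<and>
     comult A \<in> carrier A \<rightarrow> carrier (tensor2 A) \<and>
     linear_on_vecs (basis A) (comult A) \<and>
     linear_on_vecs (basis A) (\<lambda>t (_ :: unit). counit A t) \<and>
     (\<forall>s\<in>carrier A. comult_left A (comult A s) = comult_right A (comult A s)) \<and>
     (\<forall>s\<in>carrier A. counit_left A (comult A s) = s \<and> counit_right A (comult A s) = s) \<and>
     (\<forall>s\<in>carrier A. \<forall>t\<in>carrier A.
        comult A (s \<otimes>\<^bsub>A\<^esub> t) = comult A s \<otimes>\<^bsub>tensor2 A\<^esub> comult A t \<and>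
        counit A (s \<otimes>\<^bsub>A\<^esub> t) = counit A s * counit A t) \<and>
     comult A \<one>\<^bsub>A\<^esub> = \<one>\<^bsub>tensor2 A\<^esub> \<and> counit A \<one>\<^bsub>A\<^esub> = 1"

definition is_antipode ::
    "('b, 'm) bialg_scheme \<Rightarrow> (('b \<Rightarrow> complex) \<Rightarrow> 'b \<Rightarrow> complex) \<Rightarrow> bool" where
  "is_antipode A S \<longleftrightarrow>
     S \<in> carrier A \<rightarrow> carrier A \<and> linear_on_vecs (basis A) S \<and>
     (\<forall>s\<in>carrier A.
        mult_map A (\<lambda>(a, b). S (\<lambda>x. comult A s (x, b)) a) = (\<lambda>z. counit A s * \<one>\<^bsub>A\<^esub> z) \<and>
        mult_map A (\<lambda>(a, b). S (\<lambda>y. comult A s (a, y)) b) = (\<lambda>z. counit A s * \<one>\<^bsub>A\<^esub> z))"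

definition hopf_algebra :: "('b, 'm) bialg_scheme \<Rightarrow> bool" where
  "hopf_algebra A \<longleftrightarrow> bialgebra A \<and> (\<exists>S. is_antipode A S)"


section \<open>Quasitriangular structures, minimality and twists\<close>

definition quasitriangular :: "('b, 'm) bialg_scheme \<Rightarrow> ('b \<times> 'b \<Rightarrow> complex) \<Rightarrow> bool" where
  "quasitriangular A R \<longleftrightarrow>
     hopf_algebra A \<and> R \<in> Units (tensor2 A) \<and>
     (\<forall>s\<in>carrier A.
        flip (comult A s) = R \<otimes>\<^bsub>tensor2 A\<^esub> comult A s \<otimes>\<^bsub>tensor2 A\<^esub> inv\<^bsub>tensor2 A\<^esub> R) \<and>
     comult_left A R = leg13 A R \<otimes>\<^bsub>tensor3 A\<^esub> leg23 A R \<and>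
     comult_right A R = leg13 A R \<otimes>\<^bsub>tensor3 A\<^esub> leg12 A R"

definition triangular :: "('b, 'm) bialg_scheme \<Rightarrow> ('b \<times> 'b \<Rightarrow> complex) \<Rightarrow> bool" where
  "triangular A R \<longleftrightarrow> quasitriangular A R \<and> inv\<^bsub>tensor2 A\<^esub> R = flip R"

definition tensor_expr ::
    "('b, 'm) alg_scheme \<Rightarrow> ('b \<times> 'b \<Rightarrow> complex) \<Rightarrow> nat \<Rightarrow>
     (nat \<Rightarrow> 'b \<Rightarrow> complex) \<Rightarrow> (nat \<Rightarrow> 'b \<Rightarrow> complex) \<Rightarrow> bool" where
  "tensor_expr A R r x y \<longleftrightarrow>
     (\<forall>i<r. x i \<in> carrier A \<and> y i \<in> carrier A) \<and> R = (\<lambda>p. \<Sum>i<r. tens (x i) (y i) p)"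

definition shortest_expr ::
    "('b, 'm) alg_scheme \<Rightarrow> ('b \<times> 'b \<Rightarrow> complex) \<Rightarrow> nat \<Rightarrow>
     (nat \<Rightarrow> 'b \<Rightarrow> complex) \<Rightarrow> (nat \<Rightarrow> 'b \<Rightarrow> complex) \<Rightarrow> bool" where
  "shortest_expr A R r x y \<longleftrightarrow>
     tensor_expr A R r x y \<and> (\<forall>r' x' y'. tensor_expr A R r' x' y' \<longrightarrow> r \<le> r')"

definition lin_span :: "nat \<Rightarrow> (nat \<Rightarrow> 'b \<Rightarrow> complex) \<Rightarrow> ('b \<Rightarrow> complex) set" where
  "lin_span r x = {(\<lambda>z. \<Sum>i<r. c i * x i z) | c. True}"

definition subalgebra :: "('b, 'm) alg_scheme \<Rightarrow> ('b \<Rightarrow> complex) set \<Rightarrow> bool" where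
  "subalgebra A U \<longleftrightarrow>
     U \<subseteq> carrier A \<and> \<one>\<^bsub>A\<^esub> \<in> U \<and>
     (\<forall>s\<in>U. \<forall>t\<in>U. s \<otimes>\<^bsub>A\<^esub> t \<in> U \<and> (\<lambda>z. s z + t z) \<in> U) \<and>
     (\<forall>c. \<forall>s\<in>U. (\<lambda>z. c * s z) \<in> U)"

definition generated_subalgebra ::
    "('b, 'm) alg_scheme \<Rightarrow> ('b \<Rightarrow> complex) set \<Rightarrow> ('b \<Rightarrow> complex) set" where
  "generated_subalgebra A V = \<Inter>{U. subalgebra A U \<and> V \<subseteq> U}"

text \<open>
  The two spans do not depend on the chosen shortest expression. They are Hopf subalgebras
  whenever (A, R) is quasitriangular, so the subalgebra they generate is also the
  Hopf subalgebra they generate.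
\<close>

definition minimal_quasitriangular ::
    "('b, 'm) bialg_scheme \<Rightarrow> ('b \<times> 'b \<Rightarrow> complex) \<Rightarrow> bool" where
  "minimal_quasitriangular A R \<longleftrightarrow>
     quasitriangular A R \<and>
     (\<exists>r x y. shortest_expr A R r x y \<and>
        generated_subalgebra A (lin_span r x \<union> lin_span r y) = carrier A)"

definition is_twist :: "('b, 'm) bialg_scheme \<Rightarrow> ('b \<times> 'b \<Rightarrow> complex) \<Rightarrow> bool" where
  "is_twist A J \<longleftrightarrow>
     J \<in> Units (tensor2 A) \<and>
     comult_left A J \<otimes>\<^bsub>tensor3 A\<^esub> leg12 A J = comult_right A J \<otimes>\<^bsub>tensor3 A\<^esub> leg23 A J \<and>
     counit_left A J = \<one>\<^bsub>A\<^esub> \<and> counit_right A J = \<one>\<^bsub>A\<^esub>"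

definition twisted ::
    "('b, 'm) bialg_scheme \<Rightarrow> ('b \<times> 'b \<Rightarrow> complex) \<Rightarrow> ('b, 'm) bialg_scheme" where
  "twisted A J = A\<lparr>comult := \<lambda>s. inv\<^bsub>tensor2 A\<^esub> J \<otimes>\<^bsub>tensor2 A\<^esub> comult A s \<otimes>\<^bsub>tensor2 A\<^esub> J\<rparr>"

definition twist_R ::
    "('b, 'm) bialg_scheme \<Rightarrow> ('b \<times> 'b \<Rightarrow> complex) \<Rightarrow> 'b \<times> 'b \<Rightarrow> complex" where
  "twist_R A J = inv\<^bsub>tensor2 A\<^esub> (flip J) \<otimes>\<^bsub>tensor2 A\<^esub> J"

definition group_algebra :: "('g, 'm) monoid_scheme \<Rightarrow> 'g bialg" where
  "group_algebra G =
     \<lparr>carrier = vecs (carrier G),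
      monoid.mult = (\<lambda>s t z. \<Sum>x\<in>carrier G. \<Sum>y\<in>carrier G. s x * t y * bvec (x \<otimes>\<^bsub>G\<^esub> y) z),
      one = bvec \<one>\<^bsub>G\<^esub>,
      basis = carrier G,
      comult = (\<lambda>s (a, b). if a = b then s a else 0),
      counit = (\<lambda>s. \<Sum>x\<in>carrier G. s x)\<rparr>"

definition minimal_twist :: "('g, 'm) monoid_scheme \<Rightarrow> ('g \<times> 'g \<Rightarrow> complex) \<Rightarrow> bool" where
  "minimal_twist G J \<longleftrightarrow>
     is_twist (group_algebra G) J \<and>
     minimal_quasitriangular (twisted (group_algebra G) J) (twist_R (group_algebra G) J)"


section \<open>Symplectic structures\<close>

definition Cstar :: "complex monoid" where
  "Cstar = \<lparr>carrier = - {0}, monoid.mult = (*), one = 1\<rparr>"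

definition dual_group :: "('a, 'm) monoid_scheme \<Rightarrow> ('a \<Rightarrow> complex) monoid" where
  "dual_group H =
     \<lparr>carrier = hom H Cstar \<inter> extensional (carrier H),
      monoid.mult = (\<lambda>\<xi> \<eta>. (\<lambda>x\<in>carrier H. \<xi> x * \<eta> x)),
      one = (\<lambda>x\<in>carrier H. 1)\<rparr>"

text \<open>The adjoint of B from H to its dual, with the bidual of H identified with H.\<close>

definition dual_map :: "('a, 'm) monoid_scheme \<Rightarrow> ('a \<Rightarrow> 'a \<Rightarrow> complex) \<Rightarrow> 'a \<Rightarrow> 'a \<Rightarrow> complex" where
  "dual_map H B = (\<lambda>x. (\<lambda>y\<in>carrier H. B y x))"

definition symplectic_structure :: "('a, 'm) monoid_scheme \<Rightarrow> ('a \<Rightarrow> 'a \<Rightarrow> complex) \<Rightarrow> bool" where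
  "symplectic_structure H B \<longleftrightarrow>
     B \<in> iso H (dual_group H) \<and>
     (\<forall>x\<in>carrier H. dual_map H B x = inv\<^bsub>dual_group H\<^esub> (B x))"

text \<open>
  The pairing takes values in \<open>2\<pi>i(\<real>/\<int>)\<close>; the principal logarithm picks a representative. Only
  exponentials of integer combinations of its values are ever used, and these do not depend
  on the representative.
\<close>

definition pairing :: "'a \<Rightarrow> ('a \<Rightarrow> complex) \<Rightarrow> complex" where
  "pairing x \<xi> = Ln (\<xi> x)"

definition sform :: "('a \<Rightarrow> 'a \<Rightarrow> complex) \<Rightarrow> 'a \<Rightarrow> 'a \<Rightarrow> complex" where
  "sform B x y = pairing x (B y)"

definition J_of :: "('a, 'm) monoid_scheme \<Rightarrow> ('a \<Rightarrow> 'a \<Rightarrow> complex) \<Rightarrow> 'a \<times> 'a \<Rightarrow> complex" where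
  "J_of H B = (\<lambda>p. inverse (of_nat (order H)) *
     (\<Sum>x\<in>carrier H. \<Sum>y\<in>carrier H. exp (sform B x y) * tens (bvec x) (bvec y) p))"

definition gsqrt :: "('a, 'm) monoid_scheme \<Rightarrow> 'a \<Rightarrow> 'a" where
  "gsqrt H x = (THE z. z \<in> carrier H \<and> z [^]\<^bsub>H\<^esub> (2::nat) = x)"


section \<open>Hierarchies\<close>

text \<open>
  The element of the semidirect product written hg, with h in H and g in G, is represented by the
  list h # g. Since ghg^-1 = \<rho>(g)(h), one has (hg)(h'g') = (h \<rho>(g)(h')) (gg').
\<close>

definition semidirect ::
    "('a list \<Rightarrow> 'a \<Rightarrow> 'a) \<Rightarrow> 'a list monoid \<Rightarrow> 'a monoid \<Rightarrow> 'a list monoid" where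
  "semidirect \<rho> G H =
     \<lparr>carrier = {h # g | h g. h \<in> carrier H \<and> g \<in> carrier G},
      monoid.mult = (\<lambda>u v. (hd u \<otimes>\<^bsub>H\<^esub> \<rho> (tl u) (hd v)) # (tl u \<otimes>\<^bsub>G\<^esub> tl v)),
      one = \<one>\<^bsub>H\<^esub> # \<one>\<^bsub>G\<^esub>\<rparr>"

text \<open>
  An auxiliary trivial level 0, acting trivially on H 1, makes G 1 the group of
  one-element lists [h], i.e. H 1 itself, and covers the j = 1 summand of the R-matrix formula.
  The value \<rho> 0 is never used.
\<close>

definition action ::
    "(nat \<Rightarrow> 'a monoid) \<Rightarrow> (nat \<Rightarrow> 'a list \<Rightarrow> 'a \<Rightarrow> 'a) \<Rightarrow> nat \<Rightarrow> 'a list \<Rightarrow> 'a \<Rightarrow> 'a" where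
  "action H \<rho> i = (if i = 0 then (\<lambda>_. \<one>\<^bsub>AutoGroup (H 1)\<^esub>) else \<rho> i)"

primrec hgroup ::
    "(nat \<Rightarrow> 'a monoid) \<Rightarrow> (nat \<Rightarrow> 'a list \<Rightarrow> 'a \<Rightarrow> 'a) \<Rightarrow> nat \<Rightarrow> 'a list monoid" where
  "hgroup H \<rho> 0 = \<lparr>carrier = {[]}, monoid.mult = (\<lambda>_ _. []), one = []\<rparr>"
| "hgroup H \<rho> (Suc i) = semidirect (action H \<rho> i) (hgroup H \<rho> i) (H (Suc i))"

text \<open>The canonical embedding of H j into G i, for \<open>1 \<le> j \<le> i\<close>.\<close>

primrec embed ::
    "(nat \<Rightarrow> 'a monoid) \<Rightarrow> (nat \<Rightarrow> 'a list \<Rightarrow> 'a \<Rightarrow> 'a) \<Rightarrow> nat \<Rightarrow> nat \<Rightarrow> 'a \<Rightarrow> 'a list" where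
  "embed H \<rho> 0 j x = []"
| "embed H \<rho> (Suc i) j x =
     (if j = Suc i then x # \<one>\<^bsub>hgroup H \<rho> i\<^esub> else \<one>\<^bsub>H (Suc i)\<^esub> # embed H \<rho> i j x)"

definition hierarchy ::
    "nat \<Rightarrow> (nat \<Rightarrow> 'a monoid) \<Rightarrow> (nat \<Rightarrow> 'a list \<Rightarrow> 'a \<Rightarrow> 'a) \<Rightarrow> bool" where
  "hierarchy n H \<rho> \<longleftrightarrow>
     (\<forall>i\<in>{1..n}. Group.group (H i) \<and> finite (carrier (H i))) \<and>
     (\<forall>i\<in>{2..n}. \<rho> (i - 1) \<in> hom (hgroup H \<rho> (i - 1)) (AutoGroup (H i)))"

definition twist_hierarchy ::
    "nat \<Rightarrow> (nat \<Rightarrow> 'a monoid) \<Rightarrow> (nat \<Rightarrow> 'a list \<Rightarrow> 'a \<Rightarrow> 'a) \<Rightarrow>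
     (nat \<Rightarrow> 'a \<times> 'a \<Rightarrow> complex) \<Rightarrow> bool" where
  "twist_hierarchy n H \<rho> J \<longleftrightarrow>
     hierarchy n H \<rho> \<and>
     (\<forall>i\<in>{1..n}. is_twist (group_algebra (H i)) (J i)) \<and>
     (\<forall>i\<in>{2..n}. \<forall>g\<in>carrier (hgroup H \<rho> (i - 1)).
        push (map_prod (\<rho> (i - 1) g) (\<rho> (i - 1) g)) (carrier (H i) \<times> carrier (H i)) (J i) = J i)"

definition symplectic_hierarchy ::
    "nat \<Rightarrow> (nat \<Rightarrow> 'a monoid) \<Rightarrow> (nat \<Rightarrow> 'a list \<Rightarrow> 'a \<Rightarrow> 'a) \<Rightarrow>
     (nat \<Rightarrow> 'a \<times> 'a \<Rightarrow> complex) \<Rightarrow> (nat \<Rightarrow> 'a \<Rightarrow> 'a \<Rightarrow> complex) \<Rightarrow> bool" where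
  "symplectic_hierarchy n H \<rho> J B \<longleftrightarrow>
     twist_hierarchy n H \<rho> J \<and>
     (\<forall>i\<in>{1..n}. comm_group (H i) \<and> odd (order (H i)) \<and>
        symplectic_structure (H i) (B i) \<and> J i = J_of (H i) (B i))"

text \<open>The product f k * ... * f 1 in M (decreasing indices, as in \<open>x\<^sub>n \<cdots> x\<^sub>1\<close>).\<close>

primrec desc_prod :: "('a, 'm) monoid_scheme \<Rightarrow> (nat \<Rightarrow> 'a) \<Rightarrow> nat \<Rightarrow> 'a" where
  "desc_prod M f 0 = \<one>\<^bsub>M\<^esub>"
| "desc_prod M f (Suc k) = f (Suc k) \<otimes>\<^bsub>M\<^esub> desc_prod M f k"

definition hword ::
    "(nat \<Rightarrow> 'a monoid) \<Rightarrow> (nat \<Rightarrow> 'a list \<Rightarrow> 'a \<Rightarrow> 'a) \<Rightarrow> nat \<Rightarrow> (nat \<Rightarrow> 'a) \<Rightarrow> 'a list" where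
  "hword H \<rho> i x = desc_prod (hgroup H \<rho> i) (\<lambda>j. embed H \<rho> i j (x j)) i"

definition hierarchy_twist ::
    "(nat \<Rightarrow> 'a monoid) \<Rightarrow> (nat \<Rightarrow> 'a list \<Rightarrow> 'a \<Rightarrow> 'a) \<Rightarrow>
     (nat \<Rightarrow> 'a \<times> 'a \<Rightarrow> complex) \<Rightarrow> nat \<Rightarrow> 'a list \<times> 'a list \<Rightarrow> complex" where
  "hierarchy_twist H \<rho> J n =
     desc_prod (tensor2 (group_algebra (hgroup H \<rho> n)))
       (\<lambda>i. push (map_prod (embed H \<rho> n i) (embed H \<rho> n i)) (carrier (H i) \<times> carrier (H i)) (J i)) n"

text \<open>\<open>\<rho>\<^sub>j\<^sub>-\<^sub>1(x\<^sub>j\<^sub>-\<^sub>1\<^sup>1\<^sup>/\<^sup>2 \<cdots> x\<^sub>1\<^sup>1\<^sup>/\<^sup>2)\<^sup>-\<^sup>1\<close>, an automorphism of H j.\<close>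

definition untwist ::
    "(nat \<Rightarrow> 'a monoid) \<Rightarrow> (nat \<Rightarrow> 'a list \<Rightarrow> 'a \<Rightarrow> 'a) \<Rightarrow> nat \<Rightarrow> (nat \<Rightarrow> 'a) \<Rightarrow> 'a \<Rightarrow> 'a" where
  "untwist H \<rho> j x =
     inv\<^bsub>AutoGroup (H j)\<^esub> (action H \<rho> (j - 1) (hword H \<rho> (j - 1) (\<lambda>i. gsqrt (H i) (x i))))"

end

theory Submission
  imports Defs "HOL-Algebra.Multiplicative_Group"
begin

text \<open>
  The assertions about the Hopf algebra structure hold for every twist J of a group algebra:
  twisting by J always gives a triangular Hopf algebra with R-matrix \<open>J\<^sub>2\<^sub>1\<inverse>J\<close>. The antipode is
  \<open>Q\<inverse> S Q\<close> with Q obtained from J by (a, b) \<mapsto> \<open>a\<inverse>b\<close>, and the hexagon identities follow from the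
  twist equation and its images under permutations of the three tensor factors
  (\<open>triangular_twisted\<close>).

  That the product \<open>J\<^sub>n \<cdots> J\<^sub>1\<close> is a twist follows level by level: if K is a twist for G, and J is a
  twist for H invariant under the action of G, then the coproducts of the legs of K are diagonal
  elements of G and so commute with J; hence JK is a twist for the semidirect product
  (\<open>is_twist_twist_product\<close>).

  For the R-matrix formula, the coefficient of \<open>J\<^sub>2\<^sub>1\<inverse>J\<close> at (g, g') is a sum over pairs of elements of
  the group. Going from G to the semidirect product with H, the twist of H enters both factors of
  this sum, weighted by a quantity that is invariant under simultaneous right translation. On an
  abelian group of odd order such a sum collapses to a single term, located at the square roots
  of the two arguments (\<open>J_of_convolution\<close>); this is where the halves in the formula come from.
  To make this an induction, the statement that is carried from level to level involves an
  arbitrary weight invariant under right translations (\<open>collapses\<close>). The constant weight 1 gives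
  the R-matrix.

  For minimality, the coefficients of R form a generalised Hadamard matrix: distinct rows
  satisfy \<open>\<Sum>\<^sub>y R(x, y) / R(z, y) = 0\<close>. This too passes from level to level, since the new factor
  is a nondegenerate character sum (\<open>hadamard_coeff_ext\<close>). So R is invertible as a matrix, the
  left components of any expression for R span the group algebra, and nothing is left
  to generate (\<open>minimal_twistI\<close>).
\<close>

section \<open>Vectors tested against functions\<close>

text \<open>
  The linear functional on vectors that extends a function \<phi> on the basis. Vectors are compared by
  their values under all such functionals, so that a product or a pushforward turns into
  a substitution in \<phi>, and identities in tensor powers become identities in the group.
\<close>

definition ev :: "'b set \<Rightarrow> ('b \<Rightarrow> complex) \<Rightarrow> ('b \<Rightarrow> complex) \<Rightarrow> complex" where
  "ev X t \<phi> = (\<Sum>x\<in>X. t x * \<phi> x)"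

lemma ev_cong:
  "s = t \<Longrightarrow> (\<And>x. x \<in> X \<Longrightarrow> \<phi> x = \<psi> x) \<Longrightarrow> ev X s \<phi> = ev X t \<psi>"
  unfolding ev_def by (rule sum.cong) auto

lemma ev_swap:
  "ev X s (\<lambda>x. ev Y t (\<lambda>y. \<phi> x y)) = ev Y t (\<lambda>y. ev X s (\<lambda>x. \<phi> x y))"
  unfolding ev_def sum_distrib_left
  by (subst sum.swap) (simp add: mult_ac)

lemma ev_sum: "(\<Sum>c\<in>C. ev X t (\<phi> c)) = ev X t (\<lambda>x. \<Sum>c\<in>C. \<phi> c x)"
  unfolding ev_def sum_distrib_left by (rule sum.swap)

lemma ev_mult_right: "ev X t (\<lambda>x. \<phi> x * c) = ev X t \<phi> * c"
  unfolding ev_def sum_distrib_right by (simp add: mult_ac)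

lemma ev_mult_left: "ev X t (\<lambda>x. c * \<phi> x) = c * ev X t \<phi>"
  unfolding ev_def sum_distrib_left by (simp add: mult_ac)

lemma ev_smult: "ev X (\<lambda>x. c * t x) \<phi> = c * ev X t \<phi>"
  unfolding ev_def sum_distrib_left by (simp add: mult_ac)

lemma ev_const: "ev X t (\<lambda>x. c) = (\<Sum>x\<in>X. t x) * c"
  unfolding ev_def by (simp add: sum_distrib_right)

lemma ev_add: "ev X (\<lambda>x. s x + t x) \<phi> = ev X s \<phi> + ev X t \<phi>"
  unfolding ev_def by (simp add: sum.distrib algebra_simps)

lemma ev_add_right: "ev X t (\<lambda>x. \<phi> x + \<psi> x) = ev X t \<phi> + ev X t \<psi>"
  unfolding ev_def by (simp add: sum.distrib algebra_simps)

lemma ev_bvec [simp]: "finite X \<Longrightarrow> x \<in> X \<Longrightarrow> ev X (bvec x) \<phi> = \<phi> x"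
  by (simp add: ev_def bvec_def if_distrib[where f="\<lambda>c. c * _"] cong: if_cong)

lemma ev_test_bvec:
  "finite X \<Longrightarrow> t \<in> vecs X \<Longrightarrow> ev X t (\<lambda>x. bvec x z) = t z"
  by (simp add: ev_def bvec_def vecs_def if_distrib[where f="\<lambda>c. _ * c"] cong: if_cong)

text \<open>
  Basis indicator functions already separate vectors.
\<close>

lemma vecs_eqI:
  assumes "finite X" "s \<in> vecs X" "t \<in> vecs X" "\<And>\<phi>. ev X s \<phi> = ev X t \<phi>"
  shows "s = t"
  using assms(4)[of "\<lambda>x. bvec x _"] ev_test_bvec[OF assms(1)] assms(2,3) by auto

lemma ev_Times_fst:
  "ev (X \<times> Y) t \<phi> = (\<Sum>y\<in>Y. ev X (\<lambda>x. t (x, y)) (\<lambda>x. \<phi> (x, y)))"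
  unfolding ev_def by (subst sum.swap) (simp add: sum.cartesian_product case_prod_unfold)

lemma ev_Times_snd:
  "ev (X \<times> Y) t \<phi> = (\<Sum>x\<in>X. ev Y (\<lambda>y. t (x, y)) (\<lambda>y. \<phi> (x, y)))"
  unfolding ev_def by (simp add: sum.cartesian_product case_prod_unfold)

lemma bvec_in_vecs [simp]: "bvec x \<in> vecs X \<longleftrightarrow> x \<in> X"
  by (auto simp: bvec_def vecs_def)

lemma tens_bvec: "tens (bvec a) (bvec b) = bvec (a, b)"
  by (auto simp: tens_def bvec_def fun_eq_iff)

lemma push_in_vecs: "f \<in> X \<rightarrow> Z \<Longrightarrow> push f X t \<in> vecs Z"
  by (auto simp: push_def vecs_def bvec_def Pi_iff intro!: sum.neutral)

lemma ev_push:
  assumes "finite X" "finite Z" "f \<in> X \<rightarrow> Z"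
  shows "ev Z (push f X t) \<phi> = ev X t (\<lambda>x. \<phi> (f x))"
proof -
  have "ev Z (push f X t) \<phi> = (\<Sum>x\<in>X. t x * ev Z (bvec (f x)) \<phi>)"
    unfolding ev_def push_def sum_distrib_left sum_distrib_right
    by (subst sum.swap) (simp add: mult_ac)
  also have "\<dots> = ev X t (\<lambda>x. \<phi> (f x))"
    unfolding ev_def[of X] using assms by (intro sum.cong) (auto simp: Pi_iff)
  finally show ?thesis .
qed

lemma push_bvec: "finite X \<Longrightarrow> x \<in> X \<Longrightarrow> push f X (bvec x) = bvec (f x)"
  by (auto simp: push_def bvec_def fun_eq_iff if_distrib[where f="\<lambda>c. c * _"] cong: if_cong)

lemma push_cong: "(\<And>x. x \<in> X \<Longrightarrow> f x = g x) \<Longrightarrow> push f X t = push g X t"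
  by (simp add: push_def)

lemma push_push:
  assumes "finite X" "finite Y" "finite Z" "f \<in> X \<rightarrow> Y" "g \<in> Y \<rightarrow> Z"
  shows "push g Y (push f X t) = push (\<lambda>x. g (f x)) X t"
proof (rule vecs_eqI[of Z])
  show "push g Y (push f X t) \<in> vecs Z" "push (\<lambda>x. g (f x)) X t \<in> vecs Z"
    using assms by (auto intro!: push_in_vecs)
  show "ev Z (push g Y (push f X t)) \<phi> = ev Z (push (\<lambda>x. g (f x)) X t) \<phi>" for \<phi>
    using assms by (simp add: ev_push Pi_iff)
qed (use assms in auto)

lemma push_inj_apply:
  assumes "finite X" "inj_on f X" "x \<in> X"
  shows "push f X t (f x) = t x"
proof -
  have "push f X t (f x) = (\<Sum>y\<in>X. if y = x then t y else 0)"
    unfolding push_def bvec_def using assms by (intro sum.cong) (auto dest: inj_onD)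
  thus ?thesis using assms by simp
qed

lemma push_eqI:
  assumes "finite X" "inj_on f X" "\<And>x. x \<in> X \<Longrightarrow> s (f x) = t x" "\<And>z. z \<notin> f ` X \<Longrightarrow> s z = 0"
  shows "s = push f X t"
proof
  fix z show "s z = push f X t z"
  proof (cases "z \<in> f ` X")
    case True
    then show ?thesis using assms by (auto simp: push_inj_apply)
  next
    case False
    then have "push f X t z = 0" unfolding push_def bvec_def by (intro sum.neutral) auto
    with False assms(4) show ?thesis by simp
  qed
qed

lemma push_id: "finite X \<Longrightarrow> t \<in> vecs X \<Longrightarrow> (\<And>x. x \<in> X \<Longrightarrow> f x = x) \<Longrightarrow> push f X t = t"
  using ev_test_bvec[of X t] by (auto simp: push_def ev_def fun_eq_iff)

section \<open>Group algebras and their tensor powers\<close>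

lemma group_algebra_simps [simp]:
  "carrier (group_algebra G) = vecs (carrier G)"
  "\<one>\<^bsub>group_algebra G\<^esub> = bvec \<one>\<^bsub>G\<^esub>"
  "basis (group_algebra G) = carrier G"
  "counit (group_algebra G) s = (\<Sum>x\<in>carrier G. s x)"
  "comult (group_algebra G) s = (\<lambda>(a, b). if a = b then s a else 0)"
  by (simp_all add: group_algebra_def)

lemma group_algebra_mult:
  "s \<otimes>\<^bsub>group_algebra G\<^esub> t = (\<lambda>z. \<Sum>x\<in>carrier G. \<Sum>y\<in>carrier G. s x * t y * bvec (x \<otimes>\<^bsub>G\<^esub> y) z)"
  by (simp add: group_algebra_def)

locale fin_group = Group.group G for G (structure) +
  assumes fin [simp, intro]: "finite (carrier G)"
begin

abbreviation A where "A \<equiv> group_algebra G"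

lemma mult_in_vecs: "s \<otimes>\<^bsub>A\<^esub> t \<in> vecs (carrier G)"
  by (auto simp: group_algebra_mult vecs_def bvec_def intro!: sum.neutral)

text \<open>
  Convolution becomes evaluation of \<phi> at a product; together with \<open>ev_push\<close> and \<open>ev_swap\<close> this
  carries all computations in group algebras below.
\<close>

lemma ev_mult: "ev (carrier G) (s \<otimes>\<^bsub>A\<^esub> t) \<phi> =
   ev (carrier G) s (\<lambda>x. ev (carrier G) t (\<lambda>y. \<phi> (x \<otimes> y)))"
proof -
  have "ev (carrier G) (s \<otimes>\<^bsub>A\<^esub> t) \<phi> =
     (\<Sum>x\<in>carrier G. \<Sum>y\<in>carrier G. s x * t y * ev (carrier G) (bvec (x \<otimes> y)) \<phi>)"
    unfolding ev_def group_algebra_mult sum_distrib_left sum_distrib_right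
    by (subst sum.swap, rule sum.cong[OF refl], subst sum.swap) (simp add: mult_ac)
  also have "\<dots> = (\<Sum>x\<in>carrier G. \<Sum>y\<in>carrier G. s x * t y * \<phi> (x \<otimes> y))"
    by (intro sum.cong) auto
  finally show ?thesis by (simp add: ev_def sum_distrib_left mult_ac)
qed

lemma mult_apply:
  assumes "z \<in> carrier G"
  shows "(s \<otimes>\<^bsub>A\<^esub> t) z = ev (carrier G) s (\<lambda>x. t (inv x \<otimes> z))"
proof -
  have "(s \<otimes>\<^bsub>A\<^esub> t) z = (\<Sum>x\<in>carrier G. s x * (\<Sum>y\<in>carrier G. if y = inv x \<otimes> z then t y else 0))"
    unfolding group_algebra_mult sum_distrib_left
    using assms by (intro sum.cong) (auto simp: bvec_def inv_solve_left m_assoc)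
  also have "\<dots> = (\<Sum>x\<in>carrier G. s x * t (inv x \<otimes> z))"
    using assms by (intro sum.cong) auto
  finally show ?thesis by (simp add: ev_def)
qed

lemma mult_bvec: "x \<in> carrier G \<Longrightarrow> y \<in> carrier G \<Longrightarrow> bvec x \<otimes>\<^bsub>A\<^esub> bvec y = bvec (x \<otimes> y)"
  by (rule vecs_eqI[of "carrier G"]) (auto simp: ev_mult mult_in_vecs)

lemma monoid_group_algebra: "Group.monoid A"
proof (rule monoidI)
  fix s t u assume "s \<in> carrier A" "t \<in> carrier A" "u \<in> carrier A"
  show "s \<otimes>\<^bsub>A\<^esub> t \<otimes>\<^bsub>A\<^esub> u = s \<otimes>\<^bsub>A\<^esub> (t \<otimes>\<^bsub>A\<^esub> u)"
    by (rule vecs_eqI[of "carrier G"]) (auto simp: ev_mult mult_in_vecs m_assoc cong: ev_cong)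
next
  fix s assume s: "s \<in> carrier A"
  show "\<one>\<^bsub>A\<^esub> \<otimes>\<^bsub>A\<^esub> s = s"
    using s by (intro vecs_eqI[of "carrier G"]) (auto simp: ev_mult mult_in_vecs cong: ev_cong)
  show "s \<otimes>\<^bsub>A\<^esub> \<one>\<^bsub>A\<^esub> = s"
    using s by (intro vecs_eqI[of "carrier G"]) (auto simp: ev_mult mult_in_vecs cong: ev_cong)
qed (auto simp: mult_in_vecs)

sublocale alg: Group.monoid A
  by (rule monoid_group_algebra)

text \<open>
  Linear extension of a group homomorphism is an algebra homomorphism. All maps between tensor
  powers that occur in the axioms (coproducts on one leg, placement of legs, permutations, counits)
  are of this form.
\<close>

lemma push_mult:
  assumes "fin_group K" "f \<in> hom G K"
  shows "push f (carrier G) (s \<otimes>\<^bsub>A\<^esub> t) =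
         push f (carrier G) s \<otimes>\<^bsub>group_algebra K\<^esub> push f (carrier G) t"
proof -
  interpret K: fin_group K by fact
  have f: "f \<in> carrier G \<rightarrow> carrier K" using assms(2) by (simp add: hom_def)
  show ?thesis
    by (rule vecs_eqI[of "carrier K"])
       (use f assms(2) in \<open>auto simp: ev_mult K.ev_mult K.mult_in_vecs push_in_vecs ev_push hom_mult
          cong: ev_cong\<close>)
qed

lemma push_one: "fin_group K \<Longrightarrow> f \<in> hom G K \<Longrightarrow> push f (carrier G) (bvec \<one>) = bvec \<one>\<^bsub>K\<^esub>"
  using hom_one[of f G K] by (auto simp: push_bvec fin_group_def is_group)

lemma push_hom:
  "fin_group K \<Longrightarrow> f \<in> hom G K \<Longrightarrow> push f (carrier G) \<in> hom A (group_algebra K)"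
  by (auto simp: hom_def push_mult push_in_vecs)

lemma push_inverse:
  assumes K: "fin_group K" and f: "f \<in> hom G K" and J: "J \<in> Units A"
  shows "push f (carrier G) J \<in> Units (group_algebra K)"
    and "inv\<^bsub>group_algebra K\<^esub> (push f (carrier G) J) = push f (carrier G) (inv\<^bsub>A\<^esub> J)"
proof -
  interpret K: fin_group K by fact
  have f': "f \<in> carrier G \<rightarrow> carrier K" using f by (simp add: hom_def)
  note eq = push_mult[OF K f, symmetric] push_one[OF K f]
  have c: "push f (carrier G) J \<in> carrier K.A" "push f (carrier G) (inv\<^bsub>A\<^esub> J) \<in> carrier K.A"
    using push_in_vecs[OF f'] by auto
  have l: "push f (carrier G) (inv\<^bsub>A\<^esub> J) \<otimes>\<^bsub>K.A\<^esub> push f (carrier G) J = \<one>\<^bsub>K.A\<^esub>"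
    using J by (simp add: eq alg.Units_l_inv)
  have r: "push f (carrier G) J \<otimes>\<^bsub>K.A\<^esub> push f (carrier G) (inv\<^bsub>A\<^esub> J) = \<one>\<^bsub>K.A\<^esub>"
    using J by (simp add: eq alg.Units_r_inv)
  show "push f (carrier G) J \<in> Units (group_algebra K)"
    using l r c unfolding Units_def by blast
  show "inv\<^bsub>K.A\<^esub> (push f (carrier G) J) = push f (carrier G) (inv\<^bsub>A\<^esub> J)"
    by (rule K.alg.inv_unique'[symmetric]) (use c l r in auto)
qed

end

lemma fin_group_DirProd [intro]: "fin_group G \<Longrightarrow> fin_group K \<Longrightarrow> fin_group (G \<times>\<times> K)"
  by (simp add: fin_group_def fin_group_axioms_def DirProd_group)

text \<open>
  Tensor powers become group algebras themselves, so testing against functions works there too. The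
  truncation forgets the coproduct and counit, which tensor products do not carry.
\<close>

lemma tensor_group_algebra:
  assumes "fin_group G" "fin_group K"
  shows "tensor_alg (group_algebra G) (group_algebra K) = alg.truncate (group_algebra (G \<times>\<times> K))"
proof -
  interpret G: fin_group G by fact
  interpret K: fin_group K by fact
  show ?thesis
    unfolding tensor_alg_def alg.truncate_def
    by (auto simp: group_algebra_mult[of "G \<times>\<times> K" ] fun_eq_iff tens_bvec G.mult_bvec K.mult_bvec
        intro!: sum.cong)
qed

lemma alg_truncate_simps [simp]:
  "carrier (alg.truncate X) = carrier X"
  "monoid.mult (alg.truncate X) = monoid.mult X"
  "monoid.one (alg.truncate X) = monoid.one X"
  "basis (alg.truncate X) = basis X"
  "Units (alg.truncate X) = Units X"
  "m_inv (alg.truncate X) = m_inv X"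
  by (simp_all add: alg.truncate_def Units_def m_inv_def fun_eq_iff)

lemma tensor_alg_truncate [simp]: "tensor_alg X (alg.truncate Y) = tensor_alg X Y"
  by (simp add: tensor_alg_def)

lemma hom_pairI [intro]:
  "f \<in> hom G K \<Longrightarrow> g \<in> hom G L \<Longrightarrow> (\<lambda>x. (f x, g x)) \<in> hom G (K \<times>\<times> L)"
  by (auto simp: hom_def)

lemma (in Group.group) hom_components [intro]:
  "(\<lambda>a. a) \<in> hom G G" "fst \<in> hom (G \<times>\<times> K) G" "snd \<in> hom (K \<times>\<times> G) G"
  "Group.group K \<Longrightarrow> (\<lambda>a. \<one>\<^bsub>K\<^esub>) \<in> hom G K"
  by (auto simp: hom_def DirProd_def Group.group_def Group.monoid.r_one Group.monoid.one_closed)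

text \<open>
  The common computation behind both hexagon identities. Write J(1,2) for J placed in the first two of
  three tensor factors, J(12,3) for its image when the coproduct is applied to its first leg, and
  similarly for other factors. The first hexagon is the case d = J(12,3), e = J(1,23), f = J(13,2),
  g = J(3,12), u = J(1,3), v = J(3,2), x = J(1,2), y = J(2,3), z = J(3,1), where the last three
  hypotheses are instances of the twist equation.
\<close>

lemma (in Group.monoid) conjugate_quotient_eq:
  assumes "d \<in> Units G" "e \<in> Units G" "f \<in> Units G" "g \<in> Units G"
    and "u \<in> Units G" "v \<in> Units G" "x \<in> Units G" "y \<in> Units G" "z \<in> Units G"
    and "d \<otimes> x = e \<otimes> y" "f \<otimes> z = g \<otimes> x" "f \<otimes> u = e \<otimes> v"
  shows "inv x \<otimes> (inv g \<otimes> d) \<otimes> x = (inv z \<otimes> u) \<otimes> (inv v \<otimes> y)"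
proof -
  interpret U: Group.group "units_of G" by (rule units_group)
  note [simp] = units_of_carrier units_of_mult units_of_inv[symmetric]
  have m: "a \<otimes> b = a \<otimes>\<^bsub>units_of G\<^esub> b" for a b by (simp add: units_of_mult)
  have c: "d \<in> carrier (units_of G)" "e \<in> carrier (units_of G)" "f \<in> carrier (units_of G)"
     "g \<in> carrier (units_of G)" "u \<in> carrier (units_of G)" "v \<in> carrier (units_of G)"
     "x \<in> carrier (units_of G)" "y \<in> carrier (units_of G)" "z \<in> carrier (units_of G)"
    using assms by auto
  note eqs = assms(10-12)[unfolded m]
  have 1: "inv\<^bsub>units_of G\<^esub> x \<otimes>\<^bsub>units_of G\<^esub> inv\<^bsub>units_of G\<^esub> g = inv\<^bsub>units_of G\<^esub> z \<otimes>\<^bsub>units_of G\<^esub> inv\<^bsub>units_of G\<^esub> f"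
    using U.inv_mult_group[of g x] U.inv_mult_group[of f z] eqs(2) c by simp
  have 2: "inv\<^bsub>units_of G\<^esub> f \<otimes>\<^bsub>units_of G\<^esub> e = u \<otimes>\<^bsub>units_of G\<^esub> inv\<^bsub>units_of G\<^esub> v"
    using eqs(3) c by (metis U.inv_closed U.inv_solve_left U.inv_solve_right U.m_assoc U.m_closed)
  have "inv\<^bsub>units_of G\<^esub> x \<otimes>\<^bsub>units_of G\<^esub> (inv\<^bsub>units_of G\<^esub> g \<otimes>\<^bsub>units_of G\<^esub> d) \<otimes>\<^bsub>units_of G\<^esub> x
     = inv\<^bsub>units_of G\<^esub> z \<otimes>\<^bsub>units_of G\<^esub> (inv\<^bsub>units_of G\<^esub> f \<otimes>\<^bsub>units_of G\<^esub> e) \<otimes>\<^bsub>units_of G\<^esub> y"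
    using 1 eqs(1) c by (metis U.inv_closed U.m_assoc U.m_closed)
  also have "\<dots> = (inv\<^bsub>units_of G\<^esub> z \<otimes>\<^bsub>units_of G\<^esub> u) \<otimes>\<^bsub>units_of G\<^esub> (inv\<^bsub>units_of G\<^esub> v \<otimes>\<^bsub>units_of G\<^esub> y)"
    using 2 c by (simp add: U.m_assoc del: units_of_carrier units_of_mult units_of_inv)
  finally show ?thesis using assms by (simp add: m[symmetric])
qed

lemma fin_algebra_group_algebra:
  assumes "fin_group G" shows "fin_algebra (group_algebra G)"
proof -
  interpret fin_group G by fact
  show ?thesis
    using monoid_group_algebra
    by (auto simp: fin_algebra_def linear_on_vecs_def group_algebra_mult fun_eq_iff algebra_simps
        sum.distrib sum_distrib_left)
qed

context fin_group
begin

lemma tensor2_group_algebra: "tensor2 A = alg.truncate (group_algebra (G \<times>\<times> G))"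
  using tensor_group_algebra fin_group_axioms by blast

lemma tensor3_group_algebra: "tensor3 A = alg.truncate (group_algebra (G \<times>\<times> G \<times>\<times> G))"
  unfolding tensor2_group_algebra tensor_alg_truncate
  by (intro tensor_group_algebra fin_group_DirProd fin_group_axioms)

lemma comult_push:
  assumes "s \<in> vecs (carrier G)"
  shows "comult A s = push (\<lambda>a. (a, a)) (carrier G) s"
  using assms by (intro push_eqI) (auto simp: inj_on_def vecs_def image_iff)

lemma comult_left_push:
  assumes "t \<in> vecs (carrier (G \<times>\<times> G))"
  shows "comult_left A t = push (\<lambda>p. (fst p, fst p, snd p)) (carrier (G \<times>\<times> G)) t"
  using assms
  by (intro push_eqI) (force simp: inj_on_def vecs_def DirProd_def comult_left_def image_iff)+

lemma comult_right_push:
  assumes "t \<in> vecs (carrier (G \<times>\<times> G))"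
  shows "comult_right A t = push (\<lambda>p. (fst p, snd p, snd p)) (carrier (G \<times>\<times> G)) t"
  using assms
  by (intro push_eqI) (force simp: inj_on_def vecs_def DirProd_def comult_right_def image_iff)+

lemma leg12_push:
  assumes "t \<in> vecs (carrier (G \<times>\<times> G))"
  shows "leg12 A t = push (\<lambda>p. (fst p, snd p, \<one>)) (carrier (G \<times>\<times> G)) t"
  using assms
  by (intro push_eqI) (force simp: inj_on_def vecs_def DirProd_def leg12_def image_iff bvec_def)+

lemma leg13_push:
  assumes "t \<in> vecs (carrier (G \<times>\<times> G))"
  shows "leg13 A t = push (\<lambda>p. (fst p, \<one>, snd p)) (carrier (G \<times>\<times> G)) t"
  using assms
  by (intro push_eqI) (force simp: inj_on_def vecs_def DirProd_def leg13_def image_iff bvec_def)+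

lemma leg23_push:
  assumes "t \<in> vecs (carrier (G \<times>\<times> G))"
  shows "leg23 A t = push (\<lambda>p. (\<one>, fst p, snd p)) (carrier (G \<times>\<times> G)) t"
  using assms
  by (intro push_eqI) (force simp: inj_on_def vecs_def DirProd_def leg23_def image_iff bvec_def)+

lemma flip_push:
  assumes "t \<in> vecs (carrier (G \<times>\<times> G))"
  shows "flip t = push (\<lambda>p. (snd p, fst p)) (carrier (G \<times>\<times> G)) t"
  using assms
  by (intro push_eqI) (force simp: inj_on_def vecs_def DirProd_def flip_def image_iff)+

lemma counit_left_push:
  assumes "t \<in> vecs (carrier (G \<times>\<times> G))"
  shows "counit_left A t = push snd (carrier (G \<times>\<times> G)) t"
proof
  fix z
  have "push snd (carrier (G \<times>\<times> G)) t z = ev (carrier G \<times> carrier G) t (\<lambda>p. bvec (snd p) z)"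
    by (simp add: push_def ev_def DirProd_def)
  also have "\<dots> = (\<Sum>x\<in>carrier G. ev (carrier G) (\<lambda>y. t (x, y)) (\<lambda>y. bvec y z))"
    by (simp add: ev_Times_snd)
  also have "\<dots> = (\<Sum>x\<in>carrier G. t (x, z))"
    using assms by (intro sum.cong ev_test_bvec) (auto simp: vecs_def DirProd_def)
  finally show "counit_left A t z = push snd (carrier (G \<times>\<times> G)) t z"
    by (simp add: counit_left_def)
qed

lemma counit_right_push:
  assumes "t \<in> vecs (carrier (G \<times>\<times> G))"
  shows "counit_right A t = push fst (carrier (G \<times>\<times> G)) t"
proof
  fix z
  have "push fst (carrier (G \<times>\<times> G)) t z = ev (carrier G \<times> carrier G) t (\<lambda>p. bvec (fst p) z)"
    by (simp add: push_def ev_def DirProd_def)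
  also have "\<dots> = (\<Sum>y\<in>carrier G. ev (carrier G) (\<lambda>x. t (x, y)) (\<lambda>x. bvec x z))"
    by (simp add: ev_Times_fst)
  also have "\<dots> = (\<Sum>y\<in>carrier G. t (z, y))"
    using assms by (intro sum.cong ev_test_bvec) (auto simp: vecs_def DirProd_def)
  finally show "counit_right A t z = push fst (carrier (G \<times>\<times> G)) t z"
    by (simp add: counit_right_def)
qed

end

section \<open>Twisted group algebras are triangular Hopf algebras\<close>

(* Keeps the carriers of direct powers folded, as they occur in the statements about vecs below. *)
declare carrier_DirProd [simp del]

lemma (in Group.monoid) inv_mult_Units:
  assumes "x \<in> Units G" "y \<in> Units G"
  shows "inv (x \<otimes> y) = inv y \<otimes> inv x"
proof -
  interpret U: Group.group "units_of G" by (rule units_group)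
  show ?thesis
    using U.inv_mult_group[of x y] assms units_of_inv
    by (simp add: units_of_carrier units_of_mult)
qed

locale group_twist = fin_group G for G (structure) +
  fixes J :: "'a \<times> 'a \<Rightarrow> complex"
  assumes is_twist: "is_twist (group_algebra G) J"
begin

abbreviation GG where "GG \<equiv> G \<times>\<times> G"
abbreviation GGG where "GGG \<equiv> G \<times>\<times> (G \<times>\<times> G)"
abbreviation A2 where "A2 \<equiv> group_algebra GG"
abbreviation A3 where "A3 \<equiv> group_algebra GGG"

sublocale G2: fin_group GG using fin_group_axioms by blast
sublocale G3: fin_group GGG using fin_group_axioms by blast

abbreviation T where "T \<equiv> twisted A J"
abbreviation Ji where "Ji \<equiv> inv\<^bsub>A2\<^esub> J"
text \<open>
  The image of J in the threefold tensor power along a homomorphism from pairs to triples. With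
  p = (a, b), the triple (b, 1, a) gives J(3,1), and (a, a, b) gives J(12,3).
\<close>

abbreviation P where "P \<equiv> \<lambda>f. push f (carrier GG) J"
abbreviation R where "R \<equiv> twist_R A J"

lemma J_Units: "J \<in> Units A2"
  using is_twist by (simp add: is_twist_def tensor2_group_algebra)

lemma J_vecs: "J \<in> vecs (carrier GG)" "Ji \<in> vecs (carrier GG)"
  using J_Units G2.alg.Units_closed[of J] G2.alg.Units_inv_closed[of J] by simp_all

lemma triple_homI: 
  "f \<in> hom GG G \<Longrightarrow> g \<in> hom GG G \<Longrightarrow> h \<in> hom GG G \<Longrightarrow> (\<lambda>p. (f p, g p, h p)) \<in> hom GG GGG"
  by (intro hom_pairI)

lemma component_homs:
  "fst \<in> hom GG G" "snd \<in> hom GG G" "(\<lambda>_. \<one>) \<in> hom GG G"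
  using G2.hom_components(4)[OF is_group] hom_components(2,3) by auto

lemma P_Units:
  "f \<in> hom GG G \<Longrightarrow> g \<in> hom GG G \<Longrightarrow> h \<in> hom GG G \<Longrightarrow> P (\<lambda>p. (f p, g p, h p)) \<in> Units A3"
  by (intro G2.push_inverse triple_homI J_Units G3.fin_group_axioms)

lemma inv_P:
  "f \<in> hom GG G \<Longrightarrow> g \<in> hom GG G \<Longrightarrow> h \<in> hom GG G \<Longrightarrow>
   inv\<^bsub>A3\<^esub> (P (\<lambda>p. (f p, g p, h p))) = push (\<lambda>p. (f p, g p, h p)) (carrier GG) Ji"
  by (intro G2.push_inverse triple_homI J_Units G3.fin_group_axioms)

lemma push_counit: "push snd (carrier GG) J = bvec \<one>" "push fst (carrier GG) J = bvec \<one>"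
  using is_twist by (auto simp: is_twist_def counit_left_push counit_right_push J_vecs)

lemma push_counit_inv: "push snd (carrier GG) Ji = bvec \<one>" "push fst (carrier GG) Ji = bvec \<one>"
  using G2.push_inverse(2)[OF fin_group_axioms _ J_Units, of fst]
    G2.push_inverse(2)[OF fin_group_axioms _ J_Units, of snd] component_homs push_counit
  alg.inv_one by auto

lemma twist_equation:
  "P (\<lambda>p. (fst p, fst p, snd p)) \<otimes>\<^bsub>A3\<^esub> P (\<lambda>p. (fst p, snd p, \<one>)) =
   P (\<lambda>p. (fst p, snd p, snd p)) \<otimes>\<^bsub>A3\<^esub> P (\<lambda>p. (\<one>, fst p, snd p))"
  using is_twist
  by (simp add: is_twist_def tensor3_group_algebra comult_left_push comult_right_push leg12_push
      leg23_push J_vecs)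

lemma push_P:
  assumes "\<pi> \<in> hom GGG GGG" "f \<in> hom GG GGG"
  shows "push \<pi> (carrier GGG) (P f) = P (\<lambda>p. \<pi> (f p))"
  using assms by (intro push_push[OF G2.fin G3.fin G3.fin]) (simp_all add: hom_def)

text \<open>
  The twist equation holds with its indices permuted because permuting the tensor factors is an
  algebra automorphism. Cocommutativity is built in: J(12,3) and J(21,3) are the same element.
\<close>

lemma permuted_twist_equation:
  assumes "(\<lambda>(x, y, z). (\<pi>1 x y z, \<pi>2 x y z, \<pi>3 x y z)) \<in> hom GGG GGG"
  shows "P (\<lambda>(a, b). (\<pi>1 a a b, \<pi>2 a a b, \<pi>3 a a b)) \<otimes>\<^bsub>A3\<^esub> P (\<lambda>(a, b). (\<pi>1 a b \<one>, \<pi>2 a b \<one>, \<pi>3 a b \<one>)) =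
   P (\<lambda>(a, b). (\<pi>1 a b b, \<pi>2 a b b, \<pi>3 a b b)) \<otimes>\<^bsub>A3\<^esub> P (\<lambda>(a, b). (\<pi>1 \<one> a b, \<pi>2 \<one> a b, \<pi>3 \<one> a b))"
proof -
  note push = push_P[OF assms triple_homI]
  show ?thesis
    using arg_cong[OF twist_equation,
        where f = "push (\<lambda>(x, y, z). (\<pi>1 x y z, \<pi>2 x y z, \<pi>3 x y z)) (carrier GGG)"]
    unfolding G3.push_mult[OF G3.fin_group_axioms assms]
      push[OF component_homs(1) component_homs(1) component_homs(2)]
      push[OF component_homs(1) component_homs(2) component_homs(3)]
      push[OF component_homs(1) component_homs(2) component_homs(2)]
      push[OF component_homs(3) component_homs(1) component_homs(2)]
    by (simp add: case_prod_unfold)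
qed

lemma permutation_homs:
  "(\<lambda>(x, y, z). (y, z, x)) \<in> hom GGG GGG"
  "(\<lambda>(x, y, z). (x, z, y)) \<in> hom GGG GGG"
  "(\<lambda>(x, y, z). (z, x, y)) \<in> hom GGG GGG"
  "(\<lambda>(x, y, z). (y, x, z)) \<in> hom GGG GGG"
  by (auto simp: hom_def DirProd_def)

lemma R_eq: "R = push (\<lambda>p. (snd p, fst p)) (carrier GG) Ji \<otimes>\<^bsub>A2\<^esub> J"
  and inv_R: "R \<in> Units A2" "inv\<^bsub>A2\<^esub> R = Ji \<otimes>\<^bsub>A2\<^esub> push (\<lambda>p. (snd p, fst p)) (carrier GG) J"
proof -
  have h: "(\<lambda>p. (snd p, fst p)) \<in> hom GG GG" by (intro hom_pairI component_homs)
  note inverse = G2.push_inverse[OF G2.fin_group_axioms h J_Units]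
  show R: "R = push (\<lambda>p. (snd p, fst p)) (carrier GG) Ji \<otimes>\<^bsub>A2\<^esub> J"
    by (simp add: twist_R_def tensor2_group_algebra flip_push J_vecs inverse(2))
  have u: "push (\<lambda>p. (snd p, fst p)) (carrier GG) Ji \<in> Units A2"
    using G2.alg.Units_inv_Units[OF inverse(1)] unfolding inverse(2) .
  show "R \<in> Units A2" unfolding R by (intro G2.alg.Units_m_closed u J_Units)
  have inv_u: "inv\<^bsub>A2\<^esub> (push (\<lambda>p. (snd p, fst p)) (carrier GG) Ji) =
      push (\<lambda>p. (snd p, fst p)) (carrier GG) J"
    using G2.alg.Units_inv_inv[OF inverse(1)] unfolding inverse(2) .
  show "inv\<^bsub>A2\<^esub> R = Ji \<otimes>\<^bsub>A2\<^esub> push (\<lambda>p. (snd p, fst p)) (carrier GG) J"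
    unfolding R using G2.alg.inv_mult_Units[OF u J_Units] inv_u by simp
qed

text \<open>
  Agrees with the coproduct of T on vectors (\<open>comult_twisted\<close>); a convolution on the direct square, so
  that \<open>ev_mult\<close> applies.
\<close>

definition tcomult :: "('a \<Rightarrow> complex) \<Rightarrow> 'a \<times> 'a \<Rightarrow> complex" where
  "tcomult s = Ji \<otimes>\<^bsub>A2\<^esub> push (\<lambda>a. (a, a)) (carrier G) s \<otimes>\<^bsub>A2\<^esub> J"

lemma diag_hom: "(\<lambda>a. (a, a)) \<in> hom G GG"
  by (intro hom_pairI hom_components)

lemma diag_in_vecs: "push (\<lambda>a. (a, a)) (carrier G) s \<in> vecs (carrier GG)"
  using diag_hom by (intro push_in_vecs) (auto simp: hom_def)

lemma twisted_simps:
  "carrier T = vecs (carrier G)" "monoid.mult T = monoid.mult A" "\<one>\<^bsub>T\<^esub> = bvec \<one>"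
  "basis T = carrier G" "counit T = counit A"
  "tensor2 T = alg.truncate A2" "tensor3 T = alg.truncate A3"
  "leg12 T = leg12 A" "leg23 T = leg23 A" "leg13 T = leg13 A"
proof -
  obtain c where T: "T = A\<lparr>comult := c\<rparr>" by (simp add: twisted_def)
  show "carrier T = vecs (carrier G)" "monoid.mult T = monoid.mult A" "\<one>\<^bsub>T\<^esub> = bvec \<one>"
    "basis T = carrier G" "counit T = counit A"
    "leg12 T = leg12 A" "leg23 T = leg23 A" "leg13 T = leg13 A"
    unfolding T by (simp_all add: fun_eq_iff leg12_def leg23_def leg13_def)
  show "tensor2 T = alg.truncate A2" "tensor3 T = alg.truncate A3"
    unfolding tensor2_group_algebra[symmetric] tensor3_group_algebra[symmetric] T
    by (simp_all add: tensor_alg_def)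
qed

lemma comult_twisted: "s \<in> vecs (carrier G) \<Longrightarrow> comult T s = tcomult s"
  by (simp add: twisted_def tcomult_def tensor2_group_algebra comult_push del: group_algebra_simps(5))

lemma ev_tcomult:
  "ev (carrier GG) (tcomult s) \<phi> =
   ev (carrier GG) Ji (\<lambda>(f, g). ev (carrier G) s (\<lambda>w. ev (carrier GG) J (\<lambda>(a, b).
     \<phi> (f \<otimes> w \<otimes> a, g \<otimes> w \<otimes> b))))"
proof -
  have d: "(\<lambda>a. (a, a)) \<in> carrier G \<rightarrow> carrier GG" using diag_hom by (simp add: hom_def)
  show ?thesis
    by (simp add: tcomult_def G2.ev_mult ev_push[OF fin G2.fin d] case_prod_unfold mult_DirProd' cong: ev_cong)
qed

lemma tcomult_in_vecs: "tcomult s \<in> vecs (carrier GG)"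
  by (simp add: tcomult_def G2.mult_in_vecs)

lemma tcomult_linear: "linear_on_vecs (carrier G) tcomult"
  unfolding linear_on_vecs_def
proof (intro conjI ballI allI)
  fix s t assume s: "s \<in> vecs (carrier G)" and t: "t \<in> vecs (carrier G)"
  show "tcomult (\<lambda>x. s x + t x) = (\<lambda>z. tcomult s z + tcomult t z)"
    using tcomult_in_vecs[of s] tcomult_in_vecs[of t]
    by (intro vecs_eqI[OF G2.fin tcomult_in_vecs])
       (auto simp: ev_add ev_add_right ev_tcomult vecs_def case_prod_unfold)
next
  fix c s assume s: "s \<in> vecs (carrier G)"
  show "tcomult (\<lambda>x. c * s x) = (\<lambda>z. c * tcomult s z)"
    using tcomult_in_vecs[of s]
    by (intro vecs_eqI[OF G2.fin tcomult_in_vecs])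
       (auto simp: ev_smult ev_mult_left ev_tcomult vecs_def case_prod_unfold)
qed

text \<open>
  The coproduct on one leg is computed on the slices along the other leg; testing against functions
  identifies it with a conjugation by J(1,2).
\<close>

lemma comult_left_twisted:
  assumes t: "t \<in> vecs (carrier GG)"
  shows "comult_left T t = push (\<lambda>p. (fst p, snd p, \<one>)) (carrier GG) Ji \<otimes>\<^bsub>A3\<^esub>
    push (\<lambda>p. (fst p, fst p, snd p)) (carrier GG) t \<otimes>\<^bsub>A3\<^esub>
    P (\<lambda>p. (fst p, snd p, \<one>))"
    (is "_ = ?Ji \<otimes>\<^bsub>A3\<^esub> ?t \<otimes>\<^bsub>A3\<^esub> ?J")
proof -
  have slice: "(\<lambda>x. t (x, c)) \<in> vecs (carrier G)" for c
    using t by (auto simp: vecs_def carrier_DirProd)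
  have eq: "comult_left T t (a, b, c) = tcomult (\<lambda>x. t (x, c)) (a, b)" for a b c
    by (simp add: comult_left_def comult_twisted[OF slice])
  have zero: "tcomult (\<lambda>x. t (x, c)) = (\<lambda>_. 0)" if "c \<notin> carrier G" for c
    using t that by (simp add: vecs_def carrier_DirProd tcomult_def push_def group_algebra_mult)
  have v: "comult_left T t \<in> vecs (carrier GGG)"
    using zero tcomult_in_vecs by (auto simp: vecs_def carrier_DirProd eq)
  have f: "(\<lambda>p. (fst p, snd p, \<one>)) \<in> carrier GG \<rightarrow> carrier GGG"
    "(\<lambda>p. (fst p, fst p, snd p)) \<in> carrier GG \<rightarrow> carrier GGG"
    by (auto simp: carrier_DirProd)
  show ?thesis
  proof (rule vecs_eqI[OF G3.fin v G3.mult_in_vecs])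
    fix \<phi>
    have "ev (carrier GGG) (comult_left T t) \<phi> =
      (\<Sum>a\<in>carrier G. \<Sum>b\<in>carrier G. \<Sum>c\<in>carrier G. tcomult (\<lambda>x. t (x, c)) (a, b) * \<phi> (a, b, c))"
      unfolding carrier_DirProd ev_Times_snd eq by (simp add: ev_def)
    also have "\<dots> = (\<Sum>c\<in>carrier G. \<Sum>a\<in>carrier G. \<Sum>b\<in>carrier G. tcomult (\<lambda>x. t (x, c)) (a, b) * \<phi> (a, b, c))"
      by (subst (2) sum.swap, subst sum.swap, rule refl)
    also have "\<dots> = (\<Sum>c\<in>carrier G. ev (carrier GG) (tcomult (\<lambda>x. t (x, c))) (\<lambda>(a, b). \<phi> (a, b, c)))"
      unfolding carrier_DirProd ev_Times_snd by (simp add: ev_def)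
    also have "\<dots> = ev (carrier GG) Ji (\<lambda>(f, g). ev (carrier GG) t (\<lambda>(w, c). ev (carrier GG) J (\<lambda>(a, b).
     \<phi> (f \<otimes> w \<otimes> a, g \<otimes> w \<otimes> b, c))))"
      unfolding ev_tcomult ev_sum
      by (rule ev_cong) (auto simp: case_prod_unfold carrier_DirProd ev_Times_fst[of _ _ t])
    also have "\<dots> = ev (carrier GGG) (?Ji \<otimes>\<^bsub>A3\<^esub> ?t \<otimes>\<^bsub>A3\<^esub> ?J) \<phi>"
      unfolding G3.ev_mult ev_push[OF G2.fin G3.fin f(1)] ev_push[OF G2.fin G3.fin f(2)]
      by (auto simp: case_prod_unfold mult_DirProd' carrier_DirProd intro!: ev_cong)
    finally show "ev (carrier GGG) (comult_left T t) \<phi> = ev (carrier GGG) (?Ji \<otimes>\<^bsub>A3\<^esub> ?t \<otimes>\<^bsub>A3\<^esub> ?J) \<phi>" .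
  qed
qed

lemma comult_right_twisted:
  assumes t: "t \<in> vecs (carrier GG)"
  shows "comult_right T t = push (\<lambda>p. (\<one>, fst p, snd p)) (carrier GG) Ji \<otimes>\<^bsub>A3\<^esub>
    push (\<lambda>p. (fst p, snd p, snd p)) (carrier GG) t \<otimes>\<^bsub>A3\<^esub>
    P (\<lambda>p. (\<one>, fst p, snd p))"
    (is "_ = ?Ji \<otimes>\<^bsub>A3\<^esub> ?t \<otimes>\<^bsub>A3\<^esub> ?J")
proof -
  have slice: "(\<lambda>y. t (a, y)) \<in> vecs (carrier G)" for a
    using t by (auto simp: vecs_def carrier_DirProd)
  have eq: "comult_right T t (a, b, c) = tcomult (\<lambda>y. t (a, y)) (b, c)" for a b c
    by (simp add: comult_right_def comult_twisted[OF slice])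
  have zero: "tcomult (\<lambda>y. t (a, y)) = (\<lambda>_. 0)" if "a \<notin> carrier G" for a
    using t that by (simp add: vecs_def carrier_DirProd tcomult_def push_def group_algebra_mult)
  have v: "comult_right T t \<in> vecs (carrier GGG)"
    using zero tcomult_in_vecs by (auto simp: vecs_def carrier_DirProd eq)
  have f: "(\<lambda>p. (\<one>, fst p, snd p)) \<in> carrier GG \<rightarrow> carrier GGG"
    "(\<lambda>p. (fst p, snd p, snd p)) \<in> carrier GG \<rightarrow> carrier GGG"
    by (auto simp: carrier_DirProd)
  show ?thesis
  proof (rule vecs_eqI[OF G3.fin v G3.mult_in_vecs])
    fix \<phi>
    have "ev (carrier GGG) (comult_right T t) \<phi> =
      (\<Sum>a\<in>carrier G. ev (carrier GG) (tcomult (\<lambda>y. t (a, y))) (\<lambda>(b, c). \<phi> (a, b, c)))"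
      unfolding carrier_DirProd ev_Times_snd eq by simp
    also have "\<dots> = ev (carrier GG) Ji (\<lambda>(f, g). ev (carrier GG) t (\<lambda>(c, w). ev (carrier GG) J (\<lambda>(a, b).
     \<phi> (c, f \<otimes> w \<otimes> a, g \<otimes> w \<otimes> b))))"
      unfolding ev_tcomult ev_sum
      by (rule ev_cong) (auto simp: case_prod_unfold carrier_DirProd ev_Times_snd[of _ _ t])
    also have "\<dots> = ev (carrier GGG) (?Ji \<otimes>\<^bsub>A3\<^esub> ?t \<otimes>\<^bsub>A3\<^esub> ?J) \<phi>"
      unfolding G3.ev_mult ev_push[OF G2.fin G3.fin f(1)] ev_push[OF G2.fin G3.fin f(2)]
      by (auto simp: case_prod_unfold mult_DirProd' carrier_DirProd intro!: ev_cong)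
    finally show "ev (carrier GGG) (comult_right T t) \<phi> = ev (carrier GGG) (?Ji \<otimes>\<^bsub>A3\<^esub> ?t \<otimes>\<^bsub>A3\<^esub> ?J) \<phi>" .
  qed
qed

lemma fin_algebra_twisted: "fin_algebra T"
  using fin_algebra_group_algebra[OF fin_group_axioms]
  by (simp add: fin_algebra_def Group.monoid_def twisted_simps)

lemma conj_regroup:
  assumes x: "x \<in> Units A3" and y: "y \<in> Units A3" and s: "s \<in> carrier A3"
  shows "inv\<^bsub>A3\<^esub> x \<otimes>\<^bsub>A3\<^esub> (inv\<^bsub>A3\<^esub> y \<otimes>\<^bsub>A3\<^esub> s \<otimes>\<^bsub>A3\<^esub> y) \<otimes>\<^bsub>A3\<^esub> x =
    inv\<^bsub>A3\<^esub> (y \<otimes>\<^bsub>A3\<^esub> x) \<otimes>\<^bsub>A3\<^esub> s \<otimes>\<^bsub>A3\<^esub> (y \<otimes>\<^bsub>A3\<^esub> x)"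
proof -
  note c = x[THEN G3.alg.Units_closed] y[THEN G3.alg.Units_closed] 
    x[THEN G3.alg.Units_inv_closed] y[THEN G3.alg.Units_inv_closed] s
  show ?thesis
    using c by (simp add: G3.alg.inv_mult_Units x y G3.alg.m_assoc G3.mult_in_vecs)
qed

text \<open>
  Both iterated coproducts of s conjugate the diagonal element by one of the two sides of the twist
  equation.
\<close>

lemma twisted_coassoc:
  assumes s: "s \<in> vecs (carrier G)"
  shows "comult_left T (tcomult s) = comult_right T (tcomult s)"
proof -
  let ?l = "\<lambda>p. (fst p, fst p, snd p)" and ?r = "\<lambda>p. (fst p, snd p, snd p)"
  let ?jl = "\<lambda>p. (fst p, snd p, \<one>)" and ?jr = "\<lambda>p. (\<one>, fst p, snd p)"
  let ?s = "push (\<lambda>a. (a, a, a)) (carrier G) s"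
  have l: "?l \<in> hom GG GGG" and r: "?r \<in> hom GG GGG"
    by (intro triple_homI component_homs)+
  have d: "(\<lambda>a. (a, a)) \<in> carrier G \<rightarrow> carrier GG" by (simp add: carrier_DirProd)
  have s_vecs: "?s \<in> carrier A3" by (simp add: carrier_DirProd push_in_vecs)
  note U = P_Units[OF component_homs(1) component_homs(1) component_homs(2)]
    P_Units[OF component_homs(1) component_homs(2) component_homs(2)]
    P_Units[OF component_homs(1) component_homs(2) component_homs(3)]
    P_Units[OF component_homs(3) component_homs(1) component_homs(2)]
  note I = inv_P[OF component_homs(1) component_homs(1) component_homs(2), symmetric]
    inv_P[OF component_homs(1) component_homs(2) component_homs(2), symmetric]
    inv_P[OF component_homs(1) component_homs(2) component_homs(3), symmetric]
    inv_P[OF component_homs(3) component_homs(1) component_homs(2), symmetric]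
  have "push ?l (carrier GG) (push (\<lambda>a. (a, a)) (carrier G) s) = ?s"
    "push ?r (carrier GG) (push (\<lambda>a. (a, a)) (carrier G) s) = ?s"
    using l r d push_push[OF fin G2.fin G3.fin d, of ?l s] push_push[OF fin G2.fin G3.fin d, of ?r s]
    by (simp_all add: hom_def)
  then have pl: "push ?l (carrier GG) (tcomult s) = inv\<^bsub>A3\<^esub> (P ?l) \<otimes>\<^bsub>A3\<^esub> ?s \<otimes>\<^bsub>A3\<^esub> P ?l"
    and pr: "push ?r (carrier GG) (tcomult s) = inv\<^bsub>A3\<^esub> (P ?r) \<otimes>\<^bsub>A3\<^esub> ?s \<otimes>\<^bsub>A3\<^esub> P ?r"
    unfolding tcomult_def G2.push_mult[OF G3.fin_group_axioms l] G2.push_mult[OF G3.fin_group_axioms r] I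
    by simp_all
  show ?thesis
    unfolding comult_left_twisted[OF tcomult_in_vecs] comult_right_twisted[OF tcomult_in_vecs] pl pr I
      conj_regroup[OF U(3) U(1) s_vecs] conj_regroup[OF U(4) U(2) s_vecs] twist_equation
    by (rule refl)
qed

lemma twisted_counit:
  assumes s: "s \<in> vecs (carrier G)"
  shows "counit_left T (tcomult s) = s" "counit_right T (tcomult s) = s"
proof -
  have d: "(\<lambda>a. (a, a)) \<in> carrier G \<rightarrow> carrier GG" by (simp add: carrier_DirProd)
  have p: "fst \<in> carrier GG \<rightarrow> carrier G" "snd \<in> carrier GG \<rightarrow> carrier G"
    by (auto simp: carrier_DirProd)
  have "push fst (carrier GG) (push (\<lambda>a. (a, a)) (carrier G) s) = s"
    "push snd (carrier GG) (push (\<lambda>a. (a, a)) (carrier G) s) = s"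
    using push_push[OF fin G2.fin fin d p(1), of s] push_push[OF fin G2.fin fin d p(2), of s] s
    by (simp_all add: push_id)
  then have "push fst (carrier GG) (tcomult s) = s" "push snd (carrier GG) (tcomult s) = s"
    unfolding tcomult_def using s
    by (simp_all add: G2.push_mult[OF fin_group_axioms] component_homs push_counit push_counit_inv
        alg.l_one[simplified] alg.r_one[simplified])
  then show "counit_left T (tcomult s) = s" "counit_right T (tcomult s) = s"
    using counit_left_push[OF tcomult_in_vecs, of s] counit_right_push[OF tcomult_in_vecs, of s]
    by (simp_all add: counit_left_def counit_right_def twisted_simps)
qed

lemma tcomult_mult: "tcomult (s \<otimes>\<^bsub>A\<^esub> t) = tcomult s \<otimes>\<^bsub>A2\<^esub> tcomult t"
proof -
  let ?d = "push (\<lambda>a. (a, a)) (carrier G)"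
  have c: "?d s \<in> carrier A2" "?d t \<in> carrier A2" "J \<in> carrier A2" "Ji \<in> carrier A2"
    using diag_in_vecs J_vecs by auto
  have "tcomult s \<otimes>\<^bsub>A2\<^esub> tcomult t = Ji \<otimes>\<^bsub>A2\<^esub> ?d s \<otimes>\<^bsub>A2\<^esub> (J \<otimes>\<^bsub>A2\<^esub> Ji) \<otimes>\<^bsub>A2\<^esub> ?d t \<otimes>\<^bsub>A2\<^esub> J"
    unfolding tcomult_def using c by (simp add: G2.alg.m_assoc G2.mult_in_vecs)
  also have "\<dots> = tcomult (s \<otimes>\<^bsub>A\<^esub> t)"
    unfolding tcomult_def push_mult[OF G2.fin_group_axioms diag_hom] G2.alg.Units_r_inv[OF J_Units]
    using c G2.alg.r_one[of "Ji \<otimes>\<^bsub>A2\<^esub> ?d s"] by (simp add: G2.alg.m_assoc G2.mult_in_vecs)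
  finally show ?thesis by simp
qed

lemma tcomult_one: "tcomult (bvec \<one>) = bvec \<one>\<^bsub>GG\<^esub>"
  unfolding tcomult_def push_one[OF G2.fin_group_axioms diag_hom]
  using G2.alg.r_one[of Ji] G2.alg.Units_l_inv[OF J_Units] J_vecs by simp

lemma counit_mult: "counit A (s \<otimes>\<^bsub>A\<^esub> t) = counit A s * counit A t"
  using ev_mult[of s t "\<lambda>_. 1"] by (simp add: ev_const)

lemma bialgebra_twisted: "bialgebra T"
  unfolding bialgebra_def twisted_simps alg_truncate_simps group_algebra_simps(1-3)
proof (intro conjI ballI)
  show "linear_on_vecs (carrier G) (comult T)"
    using tcomult_linear by (auto simp: linear_on_vecs_def comult_twisted vecs_def)
  show "linear_on_vecs (carrier G) (\<lambda>t (_ :: unit). counit A t)"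
    by (simp add: linear_on_vecs_def sum.distrib sum_distrib_left)
  fix s assume s: "s \<in> vecs (carrier G)"
  show "comult_left T (comult T s) = comult_right T (comult T s)"
    using s by (simp add: comult_twisted twisted_coassoc)
  show "counit_left T (comult T s) = s" "counit_right T (comult T s) = s"
    using s by (simp_all add: comult_twisted twisted_counit)
  fix t assume t: "t \<in> vecs (carrier G)"
  show "comult T (s \<otimes>\<^bsub>A\<^esub> t) = comult T s \<otimes>\<^bsub>A2\<^esub> comult T t"
    using s t by (simp add: comult_twisted tcomult_mult mult_in_vecs)
  show "counit A (s \<otimes>\<^bsub>A\<^esub> t) = counit A s * counit A t" by (rule counit_mult)
next
  show "counit A (bvec \<one>) = 1" by (simp add: bvec_def)
qed (auto simp: fin_algebra_twisted comult_twisted tcomult_in_vecs tcomult_one)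

text \<open>
  The element \<open>\<Sum> S(a) b\<close> for \<open>J = \<Sum> a \<otimes> b\<close>, whose conjugation turns the antipode S of the group algebra
  into that of the twisted Hopf algebra.
\<close>

definition Q :: "'a \<Rightarrow> complex" where
  "Q = push (\<lambda>(a, b). inv a \<otimes> b) (carrier GG) J"

text \<open>
  The inverse of Q (see \<open>ev_Q'_Q\<close>), formed from \<open>J\<inverse>\<close>.
\<close>

definition Q' :: "'a \<Rightarrow> complex" where
  "Q' = push (\<lambda>(a, b). a \<otimes> inv b) (carrier GG) Ji"

definition tantipode :: "('a \<Rightarrow> complex) \<Rightarrow> 'a \<Rightarrow> complex" where
  "tantipode s = Q' \<otimes>\<^bsub>A\<^esub> push (\<lambda>x. inv x) (carrier G) s \<otimes>\<^bsub>A\<^esub> Q"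

lemma ev_Q:
  "ev (carrier G) Q \<phi> = ev (carrier GG) J (\<lambda>(a, b). \<phi> (inv a \<otimes> b))"
  "ev (carrier G) Q' \<phi> = ev (carrier GG) Ji (\<lambda>(a, b). \<phi> (a \<otimes> inv b))"
  unfolding Q_def Q'_def by (subst ev_push; auto simp: case_prod_unfold carrier_DirProd)+

lemma ev_tantipode:
  "ev (carrier G) (tantipode s) \<phi> = ev (carrier G) Q' (\<lambda>q. ev (carrier G) s (\<lambda>x. ev (carrier G) Q
     (\<lambda>r. \<phi> (q \<otimes> inv x \<otimes> r))))"
  by (simp add: tantipode_def ev_mult ev_push cong: ev_cong)

lemma ev_J_Ji:
  "ev (carrier GG) J (\<lambda>p. ev (carrier GG) Ji (\<lambda>q. \<phi> (p \<otimes>\<^bsub>GG\<^esub> q))) = \<phi> \<one>\<^bsub>GG\<^esub>"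
  using G2.ev_mult[of J Ji \<phi>] ev_bvec[OF G2.fin G2.one_closed, of \<phi>]
  by (simp add: G2.alg.Units_r_inv[OF J_Units] del: one_DirProd)

lemma cancel_inv:
  "x \<in> carrier G \<Longrightarrow> y \<in> carrier G \<Longrightarrow> inv x \<otimes> (x \<otimes> y) = y"
  "x \<in> carrier G \<Longrightarrow> y \<in> carrier G \<Longrightarrow> x \<otimes> (inv x \<otimes> y) = y"
  by (simp_all add: m_assoc[symmetric])

text \<open>
  The identity \<open>Q'Q = 1\<close>. The twist equation says that the inverse of J(1,23) times J(12,3) equals
  J(2,3) times the inverse of J(1,2). Apply the linear map (x, y, z) \<mapsto> \<open>x y\<inverse> z\<close> to both sides: the
  right-hand side becomes \<open>Q'Q\<close>, while on the left the doubled components cancel and the counit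
  conditions give 1.
\<close>

lemma ev_Q'_Q: "ev (carrier G) Q' (\<lambda>q. ev (carrier G) Q (\<lambda>r. \<phi> (q \<otimes> r))) = \<phi> \<one>"
proof -
  let ?l = "\<lambda>p. (fst p, fst p, snd p)" and ?r = "\<lambda>p. (fst p, snd p, snd p)"
  let ?jl = "\<lambda>p. (fst p, snd p, \<one>)" and ?jr = "\<lambda>p. (\<one>, fst p, snd p)"
  define \<psi> where "\<psi> = (\<lambda>(x, y, z). \<phi> (x \<otimes> inv y \<otimes> z))"
  note U = P_Units[OF component_homs(1) component_homs(1) component_homs(2)]
    P_Units[OF component_homs(1) component_homs(2) component_homs(2)]
    P_Units[OF component_homs(1) component_homs(2) component_homs(3)]
    P_Units[OF component_homs(3) component_homs(1) component_homs(2)]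
  note c = U[THEN G3.alg.Units_closed] U[THEN G3.alg.Units_inv_closed]
  have f: "?l \<in> carrier GG \<rightarrow> carrier GGG" "?r \<in> carrier GG \<rightarrow> carrier GGG"
    "?jl \<in> carrier GG \<rightarrow> carrier GGG" "?jr \<in> carrier GG \<rightarrow> carrier GGG"
    by (auto simp: carrier_DirProd)
  have "inv\<^bsub>A3\<^esub> (P ?r) \<otimes>\<^bsub>A3\<^esub> P ?l = inv\<^bsub>A3\<^esub> (P ?r) \<otimes>\<^bsub>A3\<^esub> (P ?l \<otimes>\<^bsub>A3\<^esub> P ?jl) \<otimes>\<^bsub>A3\<^esub> inv\<^bsub>A3\<^esub> (P ?jl)"
    using c U(3) G3.alg.r_one[OF c(1)] G3.alg.m_closed[OF c(1) c(3)]
    by (simp add: G3.alg.m_assoc del: group_algebra_simps(1,2))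
  also have "\<dots> = P ?jr \<otimes>\<^bsub>A3\<^esub> inv\<^bsub>A3\<^esub> (P ?jl)"
    unfolding twist_equation
    using c U(2) G3.alg.l_one[OF c(4)]
    by (simp add: G3.alg.m_assoc[symmetric] del: group_algebra_simps(1,2))
  finally have eq: "push ?r (carrier GG) Ji \<otimes>\<^bsub>A3\<^esub> P ?l = P ?jr \<otimes>\<^bsub>A3\<^esub> push ?jl (carrier GG) Ji"
    by (simp only: inv_P component_homs)
  \<comment> \<open>The map (x, y, z) \<mapsto> \<open>x y\<inverse> z\<close> applied to J(2,3) times the inverse of J(1,2).\<close>
  have "ev (carrier G) Q' (\<lambda>q. ev (carrier G) Q (\<lambda>r. \<phi> (q \<otimes> r))) =
    ev (carrier GG) J (\<lambda>(a, b). ev (carrier GG) Ji (\<lambda>(f, g). \<phi> (f \<otimes> inv g \<otimes> (inv a \<otimes> b))))"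
    unfolding ev_Q case_prod_unfold by (rule ev_swap)
  also have "\<dots> = ev (carrier GGG) (P ?jr \<otimes>\<^bsub>A3\<^esub> push ?jl (carrier GG) Ji) \<psi>"
    unfolding G3.ev_mult ev_push[OF G2.fin G3.fin f(3)] ev_push[OF G2.fin G3.fin f(4)]
    by (auto simp: \<psi>_def case_prod_unfold mult_DirProd' carrier_DirProd m_assoc inv_mult_group
        intro!: ev_cong)
  also have "\<dots> = ev (carrier GG) Ji (\<lambda>p. ev (carrier GG) J (\<lambda>q. \<phi> (fst p \<otimes> snd q)))"
    unfolding eq[symmetric] G3.ev_mult ev_push[OF G2.fin G3.fin f(1)] ev_push[OF G2.fin G3.fin f(2)]
    by (auto simp: \<psi>_def case_prod_unfold mult_DirProd' carrier_DirProd inv_mult_group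
        m_assoc cancel_inv intro!: ev_cong)
  also have "\<dots> = ev (carrier G) (push fst (carrier GG) Ji) (\<lambda>x. ev (carrier G) (push snd (carrier GG) J) (\<lambda>y. \<phi> (x \<otimes> y)))"
    by (subst (1 2) ev_push) (auto simp: carrier_DirProd)
  also have "\<dots> = \<phi> \<one>"
    by (simp add: push_counit push_counit_inv)
  finally show ?thesis .
qed

lemma mult_map_twisted: "mult_map T t = push (\<lambda>(x, y). x \<otimes> y) (carrier GG) t"
  by (auto simp: mult_map_def twisted_simps push_def carrier_DirProd mult_bvec fun_eq_iff intro!: sum.cong)

text \<open>
  Writing out \<open>S\<^sup>J\<close> and \<open>\<Delta>\<^sup>J\<close>, the innermost part is \<open>S(f) Q g\<close> with \<open>J\<inverse> = \<Sum> f \<otimes> g\<close>. This is the image of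
  \<open>J J\<inverse> = 1\<close> under (u, v) \<mapsto> \<open>u\<inverse> v\<close>, so it is 1. What remains collapses by the antipode axiom for
  group elements, and then by \<open>Q'Q = 1\<close>.
\<close>

lemma antipode_left:
  assumes s: "s \<in> vecs (carrier G)"
  shows "mult_map T (\<lambda>(a, b). tantipode (\<lambda>x. tcomult s (x, b)) a) = (\<lambda>z. counit A s * bvec \<one> z)"
proof (rule vecs_eqI[OF fin])
  show "mult_map T (\<lambda>(a, b). tantipode (\<lambda>x. tcomult s (x, b)) a) \<in> vecs (carrier G)"
    unfolding mult_map_twisted by (rule push_in_vecs) (auto simp: carrier_DirProd)
  show "(\<lambda>z. counit A s * bvec \<one> z) \<in> vecs (carrier G)" by (auto simp: vecs_def bvec_def)
  fix \<phi>
  have "ev (carrier G) (mult_map T (\<lambda>(a, b). tantipode (\<lambda>x. tcomult s (x, b)) a)) \<phi> =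
    (\<Sum>y\<in>carrier G. ev (carrier G) (tantipode (\<lambda>x. tcomult s (x, y))) (\<lambda>x. \<phi> (x \<otimes> y)))"
    unfolding mult_map_twisted
    by (subst ev_push) (auto simp: carrier_DirProd ev_Times_fst)
  also have "\<dots> = ev (carrier G) Q' (\<lambda>q. ev (carrier GG) (tcomult s) (\<lambda>p. ev (carrier G) Q
      (\<lambda>r. \<phi> (q \<otimes> inv (fst p) \<otimes> r \<otimes> snd p))))"
    by (simp add: ev_tantipode ev_sum carrier_DirProd ev_Times_fst)
  also have "\<dots> = ev (carrier G) Q' (\<lambda>q. ev (carrier G) s (\<lambda>w. ev (carrier GG) J (\<lambda>p.
      \<phi> (q \<otimes> (inv (fst p) \<otimes> snd p)))))"
  proof (rule ev_cong[OF refl])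
    fix q assume q: "q \<in> carrier G"
    have "ev (carrier GG) (tcomult s) (\<lambda>p. ev (carrier G) Q (\<lambda>r. \<phi> (q \<otimes> inv (fst p) \<otimes> r \<otimes> snd p))) =
      ev (carrier GG) Ji (\<lambda>f. ev (carrier G) s (\<lambda>w. ev (carrier GG) J (\<lambda>p. ev (carrier GG) J (\<lambda>a.
        \<phi> (q \<otimes> inv (fst f \<otimes> w \<otimes> fst p) \<otimes> (inv (fst a) \<otimes> snd a) \<otimes> (snd f \<otimes> w \<otimes> snd p))))))"
      unfolding ev_tcomult ev_Q by (simp add: case_prod_unfold)
    also have "\<dots> = ev (carrier G) s (\<lambda>w. ev (carrier GG) J (\<lambda>p. ev (carrier GG) J (\<lambda>a.
       ev (carrier GG) Ji (\<lambda>f. 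
        \<phi> (q \<otimes> inv (fst f \<otimes> w \<otimes> fst p) \<otimes> (inv (fst a) \<otimes> snd a) \<otimes> (snd f \<otimes> w \<otimes> snd p))))))"
      by (subst ev_swap, rule ev_cong[OF refl], subst ev_swap, rule ev_cong[OF refl], rule ev_swap)
    also have "\<dots> = ev (carrier G) s (\<lambda>w. ev (carrier GG) J (\<lambda>p. ev (carrier GG) J (\<lambda>a.
       ev (carrier GG) Ji (\<lambda>f. (\<lambda>u.
        \<phi> (q \<otimes> inv (fst p) \<otimes> inv w \<otimes> inv (fst u) \<otimes> snd u \<otimes> w \<otimes> snd p)) (a \<otimes>\<^bsub>GG\<^esub> f)))))"
      using q
      by (auto simp: mult_DirProd' carrier_DirProd m_assoc inv_mult_group intro!: ev_cong)
    also have "\<dots> = ev (carrier G) s (\<lambda>w. ev (carrier GG) J (\<lambda>p.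
        \<phi> (q \<otimes> (inv (fst p) \<otimes> snd p))))"
      using q
      by (intro ev_cong refl trans[OF ev_J_Ji]) (auto simp: carrier_DirProd m_assoc cancel_inv)
    finally show "ev (carrier GG) (tcomult s) (\<lambda>p. ev (carrier G) Q (\<lambda>r. \<phi> (q \<otimes> inv (fst p) \<otimes> r \<otimes> snd p))) = \<dots>" .
  qed
  also have "\<dots> = counit A s * ev (carrier G) Q' (\<lambda>q. ev (carrier G) Q (\<lambda>r. \<phi> (q \<otimes> r)))"
    by (simp add: ev_const ev_mult_left ev_Q case_prod_unfold)
  also have "\<dots> = ev (carrier G) (\<lambda>z. counit A s * bvec \<one> z) \<phi>"
    unfolding ev_Q'_Q by (simp add: ev_smult)
  finally show "ev (carrier G) (mult_map T (\<lambda>(a, b). tantipode (\<lambda>x. tcomult s (x, b)) a)) \<phi> = \<dots>" .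
qed

text \<open>
  As on the left, now with \<open>a Q' S(b)\<close> being the image of \<open>J J\<inverse> = 1\<close> under (u, v) \<mapsto> \<open>u v\<inverse>\<close>.
\<close>

lemma antipode_right:
  assumes s: "s \<in> vecs (carrier G)"
  shows "mult_map T (\<lambda>(a, b). tantipode (\<lambda>y. tcomult s (a, y)) b) = (\<lambda>z. counit A s * bvec \<one> z)"
proof (rule vecs_eqI[OF fin])
  show "mult_map T (\<lambda>(a, b). tantipode (\<lambda>y. tcomult s (a, y)) b) \<in> vecs (carrier G)"
    unfolding mult_map_twisted by (rule push_in_vecs) (auto simp: carrier_DirProd)
  show "(\<lambda>z. counit A s * bvec \<one> z) \<in> vecs (carrier G)" by (auto simp: vecs_def bvec_def)
  fix \<phi>
  have "ev (carrier G) (mult_map T (\<lambda>(a, b). tantipode (\<lambda>y. tcomult s (a, y)) b)) \<phi> =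
    (\<Sum>x\<in>carrier G. ev (carrier G) (tantipode (\<lambda>y. tcomult s (x, y))) (\<lambda>y. \<phi> (x \<otimes> y)))"
    unfolding mult_map_twisted
    by (subst ev_push) (auto simp: carrier_DirProd ev_Times_snd)
  also have "\<dots> = ev (carrier G) Q' (\<lambda>q. ev (carrier GG) (tcomult s) (\<lambda>p. ev (carrier G) Q
      (\<lambda>r. \<phi> (fst p \<otimes> (q \<otimes> inv (snd p) \<otimes> r)))))"
    by (simp add: ev_tantipode ev_sum carrier_DirProd ev_Times_snd)
  also have "\<dots> = ev (carrier G) Q (\<lambda>r. ev (carrier GG) (tcomult s) (\<lambda>p. ev (carrier G) Q'
      (\<lambda>q. \<phi> (fst p \<otimes> (q \<otimes> inv (snd p) \<otimes> r)))))"
    by (subst ev_swap, subst (2) ev_swap, subst ev_swap, rule refl)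
  also have "\<dots> = ev (carrier G) Q (\<lambda>r. ev (carrier G) s (\<lambda>w. ev (carrier GG) Ji (\<lambda>f.
      \<phi> (fst f \<otimes> inv (snd f) \<otimes> r))))"
  proof (rule ev_cong[OF refl])
    fix r assume r: "r \<in> carrier G"
    have "ev (carrier GG) (tcomult s) (\<lambda>p. ev (carrier G) Q' (\<lambda>q. \<phi> (fst p \<otimes> (q \<otimes> inv (snd p) \<otimes> r)))) =
      ev (carrier GG) Ji (\<lambda>f. ev (carrier G) s (\<lambda>w. ev (carrier GG) J (\<lambda>p. ev (carrier GG) Ji (\<lambda>a.
        \<phi> (fst f \<otimes> w \<otimes> fst p \<otimes> (fst a \<otimes> inv (snd a) \<otimes> inv (snd f \<otimes> w \<otimes> snd p) \<otimes> r))))))"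
      unfolding ev_tcomult ev_Q by (simp add: case_prod_unfold)
    also have "\<dots> = ev (carrier GG) Ji (\<lambda>f. ev (carrier G) s (\<lambda>w. ev (carrier GG) J (\<lambda>p.
       ev (carrier GG) Ji (\<lambda>a. (\<lambda>u.
        \<phi> (fst f \<otimes> w \<otimes> fst u \<otimes> inv (snd u) \<otimes> inv w \<otimes> inv (snd f) \<otimes> r)) (p \<otimes>\<^bsub>GG\<^esub> a)))))"
      using r
      by (auto simp: mult_DirProd' carrier_DirProd m_assoc inv_mult_group intro!: ev_cong)
    also have "\<dots> = ev (carrier GG) Ji (\<lambda>f. ev (carrier G) s (\<lambda>w. 
        \<phi> (fst f \<otimes> inv (snd f) \<otimes> r)))"
      using r
      by (intro ev_cong refl trans[OF ev_J_Ji]) (auto simp: carrier_DirProd m_assoc cancel_inv)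
    also have "\<dots> = ev (carrier G) s (\<lambda>w. ev (carrier GG) Ji (\<lambda>f.
      \<phi> (fst f \<otimes> inv (snd f) \<otimes> r)))"
      by (rule ev_swap)
    finally show "ev (carrier GG) (tcomult s) (\<lambda>p. ev (carrier G) Q' (\<lambda>q. \<phi> (fst p \<otimes> (q \<otimes> inv (snd p) \<otimes> r)))) = \<dots>" .
  qed
  also have "\<dots> = counit A s * ev (carrier G) Q (\<lambda>r. ev (carrier G) Q' (\<lambda>q. \<phi> (q \<otimes> r)))"
    by (simp add: ev_const ev_mult_left ev_Q(2) case_prod_unfold)
  also have "\<dots> = ev (carrier G) (\<lambda>z. counit A s * bvec \<one> z) \<phi>"
    unfolding ev_swap[of _ Q] ev_Q'_Q by (simp add: ev_smult)
  finally show "ev (carrier G) (mult_map T (\<lambda>(a, b). tantipode (\<lambda>y. tcomult s (a, y)) b)) \<phi> = \<dots>" .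
qed

lemma tantipode_linear: "linear_on_vecs (carrier G) tantipode"
  unfolding linear_on_vecs_def
proof (intro conjI ballI allI)
  have v: "tantipode s \<in> vecs (carrier G)" for s by (simp add: tantipode_def mult_in_vecs)
  fix s t assume "s \<in> vecs (carrier G)" "t \<in> vecs (carrier G)"
  show "tantipode (\<lambda>x. s x + t x) = (\<lambda>z. tantipode s z + tantipode t z)"
    using v[of s] v[of t]
    by (intro vecs_eqI[OF fin v]) (auto simp: ev_add ev_add_right ev_tantipode vecs_def)
next
  have v: "tantipode s \<in> vecs (carrier G)" for s by (simp add: tantipode_def mult_in_vecs)
  fix c s assume "s \<in> vecs (carrier G)"
  show "tantipode (\<lambda>x. c * s x) = (\<lambda>z. c * tantipode s z)"
    using v[of s]
    by (intro vecs_eqI[OF fin v]) (auto simp: ev_smult ev_mult_left ev_tantipode vecs_def)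
qed

lemma hopf_algebra_twisted: "hopf_algebra T"
proof -
  have "is_antipode T tantipode"
    using tantipode_linear antipode_left antipode_right
    by (auto simp: is_antipode_def twisted_simps comult_twisted tantipode_def mult_in_vecs
        simp del: group_algebra_simps(4,5))
  then show ?thesis using bialgebra_twisted by (auto simp: hopf_algebra_def)
qed

lemma swap_hom: "(\<lambda>p. (snd p, fst p)) \<in> hom GG GG"
  by (intro hom_pairI component_homs)

text \<open>
  The coproduct of the group algebra is symmetric, so flipping the twisted coproduct only replaces
  J by \<open>J\<^sub>2\<^sub>1\<close>.
\<close>

lemma flip_tcomult:
  assumes "s \<in> vecs (carrier G)"
  shows "flip (tcomult s) = R \<otimes>\<^bsub>A2\<^esub> tcomult s \<otimes>\<^bsub>A2\<^esub> inv\<^bsub>A2\<^esub> R"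
proof -
  let ?\<sigma> = "push (\<lambda>p. (snd p, fst p)) (carrier GG)" and ?d = "push (\<lambda>a. (a, a)) (carrier G) s"
  have d: "(\<lambda>a. (a, a)) \<in> carrier G \<rightarrow> carrier GG" by (simp add: carrier_DirProd)
  have \<sigma>: "(\<lambda>p. (snd p, fst p)) \<in> carrier GG \<rightarrow> carrier GG" by (auto simp: carrier_DirProd)
  have sym: "?\<sigma> ?d = ?d"
    using push_push[OF fin G2.fin G2.fin d \<sigma>, of s] by simp
  note m = G2.mult_in_vecs push_in_vecs[OF \<sigma>] diag_in_vecs J_vecs
  have "flip (tcomult s) = ?\<sigma> Ji \<otimes>\<^bsub>A2\<^esub> ?d \<otimes>\<^bsub>A2\<^esub> ?\<sigma> J"
    unfolding flip_push[OF tcomult_in_vecs] unfolding tcomult_def G2.push_mult[OF G2.fin_group_axioms swap_hom] sym ..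
  also have "\<dots> = ?\<sigma> Ji \<otimes>\<^bsub>A2\<^esub> (J \<otimes>\<^bsub>A2\<^esub> Ji) \<otimes>\<^bsub>A2\<^esub> ?d \<otimes>\<^bsub>A2\<^esub> (J \<otimes>\<^bsub>A2\<^esub> Ji) \<otimes>\<^bsub>A2\<^esub> ?\<sigma> J"
    unfolding G2.alg.Units_r_inv[OF J_Units] using m by (simp add: G2.alg.r_one[unfolded group_algebra_simps] del: one_DirProd)
  also have "\<dots> = R \<otimes>\<^bsub>A2\<^esub> tcomult s \<otimes>\<^bsub>A2\<^esub> inv\<^bsub>A2\<^esub> R"
    unfolding inv_R(2) unfolding R_eq tcomult_def using m by (simp add: G2.alg.m_assoc)
  finally show ?thesis .
qed

lemma R_vecs: "R \<in> vecs (carrier GG)"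
  by (simp add: R_eq G2.mult_in_vecs)

lemma inv_R_flip: "inv\<^bsub>A2\<^esub> R = flip R"
proof -
  let ?\<sigma> = "push (\<lambda>p. (snd p, fst p)) (carrier GG)"
  have \<sigma>: "(\<lambda>p. (snd p, fst p)) \<in> carrier GG \<rightarrow> carrier GG" by (auto simp: carrier_DirProd)
  have "?\<sigma> (?\<sigma> Ji) = Ji"
    using push_push[OF G2.fin G2.fin G2.fin \<sigma> \<sigma>, of Ji] J_vecs by (simp add: push_id)
  then have "?\<sigma> R = inv\<^bsub>A2\<^esub> R"
    unfolding inv_R(2) by (simp add: R_eq G2.push_mult[OF G2.fin_group_axioms swap_hom])
  then show ?thesis by (simp add: flip_push R_vecs)
qed

lemma push_R:
  assumes "f \<in> hom GG G" "g \<in> hom GG G" "h \<in> hom GG G"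
    and "f' \<in> hom GG G" "g' \<in> hom GG G" "h' \<in> hom GG G"
    and "\<And>p. (f' p, g' p, h' p) = (f (snd p, fst p), g (snd p, fst p), h (snd p, fst p))"
  shows "push (\<lambda>p. (f p, g p, h p)) (carrier GG) R =
    inv\<^bsub>A3\<^esub> (P (\<lambda>p. (f' p, g' p, h' p))) \<otimes>\<^bsub>A3\<^esub> P (\<lambda>p. (f p, g p, h p))"
proof -
  note h = triple_homI[OF assms(1-3)]
  have \<sigma>: "(\<lambda>p. (snd p, fst p)) \<in> carrier GG \<rightarrow> carrier GG" by (auto simp: carrier_DirProd)
  have f: "(\<lambda>p. (f p, g p, h p)) \<in> carrier GG \<rightarrow> carrier GGG" using h by (simp add: hom_def)
  show ?thesis
    unfolding inv_P[OF assms(4-6)] unfolding R_eq G2.push_mult[OF G3.fin_group_axioms h]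
      push_push[OF G2.fin G2.fin G3.fin \<sigma> f] assms(7) by (rule refl)
qed

text \<open>
  The digits say which factors replace 1, 2, 3 in J(12,3) J(1,2) = J(1,23) J(2,3); here the result is
  J(31,2) J(3,1) = J(3,12) J(1,2). For 231 and 213 the two sides are exchanged.
\<close>

lemma twist_equation_312:
  "P (\<lambda>p. (fst p, snd p, fst p)) \<otimes>\<^bsub>A3\<^esub> P (\<lambda>p. (snd p, \<one>, fst p)) =
   P (\<lambda>p. (snd p, snd p, fst p)) \<otimes>\<^bsub>A3\<^esub> P (\<lambda>p. (fst p, snd p, \<one>))"
  using permuted_twist_equation[OF permutation_homs(1)] by (simp add: case_prod_unfold)

lemma twist_equation_132:
  "P (\<lambda>p. (fst p, snd p, fst p)) \<otimes>\<^bsub>A3\<^esub> P (\<lambda>p. (fst p, \<one>, snd p)) =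
   P (\<lambda>p. (fst p, snd p, snd p)) \<otimes>\<^bsub>A3\<^esub> P (\<lambda>p. (\<one>, snd p, fst p))"
  using permuted_twist_equation[OF permutation_homs(2)] by (simp add: case_prod_unfold)

lemma twist_equation_231:
  "P (\<lambda>p. (snd p, fst p, snd p)) \<otimes>\<^bsub>A3\<^esub> P (\<lambda>p. (snd p, \<one>, fst p)) =
   P (\<lambda>p. (snd p, fst p, fst p)) \<otimes>\<^bsub>A3\<^esub> P (\<lambda>p. (\<one>, fst p, snd p))"
  using permuted_twist_equation[OF permutation_homs(3)] by (simp add: case_prod_unfold)

lemma twist_equation_213:
  "P (\<lambda>p. (snd p, fst p, snd p)) \<otimes>\<^bsub>A3\<^esub> P (\<lambda>p. (fst p, \<one>, snd p)) =
   P (\<lambda>p. (fst p, fst p, snd p)) \<otimes>\<^bsub>A3\<^esub> P (\<lambda>p. (snd p, fst p, \<one>))"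
  using permuted_twist_equation[OF permutation_homs(4)] by (simp add: case_prod_unfold)

lemma hexagon_left: "comult_left T R = leg13 A R \<otimes>\<^bsub>A3\<^esub> leg23 A R"
proof -
  note c = component_homs
  have "push (\<lambda>p. (fst p, fst p, snd p)) (carrier GG) R =
    inv\<^bsub>A3\<^esub> (P (\<lambda>p. (snd p, snd p, fst p))) \<otimes>\<^bsub>A3\<^esub> P (\<lambda>p. (fst p, fst p, snd p))"
    by (rule push_R[OF c(1) c(1) c(2) c(2) c(2) c(1)]) simp
  moreover have "push (\<lambda>p. (fst p, \<one>, snd p)) (carrier GG) R =
    inv\<^bsub>A3\<^esub> (P (\<lambda>p. (snd p, \<one>, fst p))) \<otimes>\<^bsub>A3\<^esub> P (\<lambda>p. (fst p, \<one>, snd p))"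
    by (rule push_R[OF c(1) c(3) c(2) c(2) c(3) c(1)]) simp
  moreover have "push (\<lambda>p. (\<one>, fst p, snd p)) (carrier GG) R =
    inv\<^bsub>A3\<^esub> (P (\<lambda>p. (\<one>, snd p, fst p))) \<otimes>\<^bsub>A3\<^esub> P (\<lambda>p. (\<one>, fst p, snd p))"
    by (rule push_R[OF c(3) c(1) c(2) c(3) c(2) c(1)]) simp
  ultimately show ?thesis
    unfolding comult_left_twisted[OF R_vecs] leg13_push[OF R_vecs] leg23_push[OF R_vecs]
      inv_P[OF c(1) c(2) c(3), symmetric]
    by (simp only:) (rule G3.alg.conjugate_quotient_eq[OF P_Units P_Units P_Units P_Units P_Units
          P_Units P_Units P_Units P_Units twist_equation twist_equation_312 twist_equation_132];
        rule c)
qed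

lemma hexagon_right: "comult_right T R = leg13 A R \<otimes>\<^bsub>A3\<^esub> leg12 A R"
proof -
  note c = component_homs
  have "push (\<lambda>p. (fst p, snd p, snd p)) (carrier GG) R =
    inv\<^bsub>A3\<^esub> (P (\<lambda>p. (snd p, fst p, fst p))) \<otimes>\<^bsub>A3\<^esub> P (\<lambda>p. (fst p, snd p, snd p))"
    by (rule push_R[OF c(1) c(2) c(2) c(2) c(1) c(1)]) simp
  moreover have "push (\<lambda>p. (fst p, \<one>, snd p)) (carrier GG) R =
    inv\<^bsub>A3\<^esub> (P (\<lambda>p. (snd p, \<one>, fst p))) \<otimes>\<^bsub>A3\<^esub> P (\<lambda>p. (fst p, \<one>, snd p))"
    by (rule push_R[OF c(1) c(3) c(2) c(2) c(3) c(1)]) simp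
  moreover have "push (\<lambda>p. (fst p, snd p, \<one>)) (carrier GG) R =
    inv\<^bsub>A3\<^esub> (P (\<lambda>p. (snd p, fst p, \<one>))) \<otimes>\<^bsub>A3\<^esub> P (\<lambda>p. (fst p, snd p, \<one>))"
    by (rule push_R[OF c(1) c(2) c(3) c(2) c(1) c(3)]) simp
  ultimately show ?thesis
    unfolding comult_right_twisted[OF R_vecs] leg13_push[OF R_vecs] leg12_push[OF R_vecs]
      inv_P[OF c(3) c(1) c(2), symmetric]
    by (simp only:) (rule G3.alg.conjugate_quotient_eq[OF P_Units P_Units P_Units P_Units P_Units
          P_Units P_Units P_Units P_Units twist_equation[symmetric] twist_equation_231
          twist_equation_213]; rule c)
qed

lemma triangular_twisted: "triangular T R"
proof -
  have "tensor_alg T A2 = alg.truncate A3"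
    using twisted_simps(7) by (simp add: twisted_simps(6))
  then show ?thesis
    unfolding triangular_def quasitriangular_def twisted_simps alg_truncate_simps tensor_alg_truncate
    using hopf_algebra_twisted inv_R(1) inv_R_flip hexagon_left hexagon_right
    by (auto simp: comult_twisted flip_tcomult)
qed

section \<open>A criterion for minimality\<close>

text \<open>
  A right inverse S of the coefficient matrix of R writes each basis vector as a combination of the
  columns of R, and these are combinations of the left components \<open>x\<^sub>i\<close> of any expression
  \<open>R = \<Sum> x\<^sub>i \<otimes> y\<^sub>i\<close>. So for a shortest expression, which exists because some finite expression does, the
  \<open>x\<^sub>i\<close> alone span the whole algebra.
\<close>

lemma minimal_twistI:
  assumes S: "\<And>x z. x \<in> carrier G \<Longrightarrow> z \<in> carrier G \<Longrightarrow>
     (\<Sum>y\<in>carrier G. R (x, y) * S y z) = (if x = z then 1 else 0)"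
  shows "minimal_twist G J"
proof -
  let ?expr = "\<lambda>r. \<exists>x y. tensor_expr T R r x y"
  obtain xs where xs: "set xs = carrier G" "distinct xs"
    using finite_distinct_list[OF fin] by blast
  have R0: "R (a, b) = 0" if "a \<notin> carrier G \<or> b \<notin> carrier G" for a b
    using R_vecs that by (auto simp: vecs_def carrier_DirProd)
  \<comment> \<open>Expanding R along the rows of its matrix gives one expression.\<close>
  have "tensor_expr T R (length xs) (\<lambda>i. bvec (xs ! i)) (\<lambda>i b. R (xs ! i, b))"
    unfolding tensor_expr_def
  proof (intro conjI allI impI ext)
    fix i assume "i < length xs"
    then show "bvec (xs ! i) \<in> carrier T" "(\<lambda>b. R (xs ! i, b)) \<in> carrier T"
      using xs nth_mem R0 by (auto simp: twisted_simps vecs_def bvec_def)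
  next
    fix p :: "'a \<times> 'a"
    obtain a b where p: "p = (a, b)" by (cases p)
    have "(\<Sum>i<length xs. tens (bvec (xs ! i)) (\<lambda>b. R (xs ! i, b)) p) =
      (\<Sum>c\<in>carrier G. bvec c a * R (c, b))"
      unfolding p tens_def using xs
      by (subst sum.reindex_bij_betw[symmetric, of "(!) xs" "{..<length xs}"])
         (auto intro!: bij_betw_nth)
    also have "\<dots> = R (a, b)"
      using R0 by (simp add: bvec_def if_distrib[where f="\<lambda>c. c * _"] cong: if_cong)
    finally show "R p = (\<Sum>i<length xs. tens (bvec (xs ! i)) (\<lambda>b. R (xs ! i, b)) p)" by (simp add: p)
  qed
  then have ex: "?expr (length xs)" by blast
  define r where "r = (LEAST r. ?expr r)"
  obtain x y where xy: "tensor_expr T R r x y"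
    using LeastI[of ?expr, OF ex] unfolding r_def by blast
  have short: "shortest_expr T R r x y"
    using xy Least_le[of ?expr] unfolding shortest_expr_def r_def by blast
  have span: "s \<in> lin_span r x" if s: "s \<in> vecs (carrier G)" for s
  proof -
    have "s = (\<lambda>a. \<Sum>i<r. (\<Sum>z\<in>carrier G. s z * (\<Sum>b\<in>carrier G. y i b * S b z)) * x i a)"
    proof
      fix a
      have "(\<Sum>i<r. (\<Sum>z\<in>carrier G. s z * (\<Sum>b\<in>carrier G. y i b * S b z)) * x i a) =
        (\<Sum>z\<in>carrier G. s z * (\<Sum>b\<in>carrier G. (\<Sum>i<r. x i a * y i b) * S b z))"
        unfolding sum_distrib_left sum_distrib_right
        by (subst sum.swap, rule sum.cong[OF refl], subst sum.swap) (simp add: mult_ac)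
      also have "\<dots> = (\<Sum>z\<in>carrier G. s z * (\<Sum>b\<in>carrier G. R (a, b) * S b z))"
        using xy by (simp add: tensor_expr_def tens_def fun_eq_iff)
      also have "\<dots> = s a"
      proof (cases "a \<in> carrier G")
        case True
        then have "(\<Sum>z\<in>carrier G. s z * (\<Sum>b\<in>carrier G. R (a, b) * S b z)) =
            (\<Sum>z\<in>carrier G. if a = z then s z else 0)"
          using S by (intro sum.cong) auto
        with True show ?thesis by simp
      next
        case False
        with s show ?thesis by (simp add: R0 vecs_def)
      qed
      finally show "s a = (\<Sum>i<r. (\<Sum>z\<in>carrier G. s z * (\<Sum>b\<in>carrier G. y i b * S b z)) * x i a)"
        by simp
    qed
    then show ?thesis
      unfolding lin_span_def
      by (intro CollectI exI[of _ "\<lambda>i. \<Sum>z\<in>carrier G. s z * (\<Sum>b\<in>carrier G. y i b * S b z)"] conjI TrueI)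
  qed
  have "subalgebra T (carrier T)"
    by (auto simp: subalgebra_def twisted_simps mult_in_vecs) (auto simp: vecs_def)
  moreover have "lin_span r x \<union> lin_span r y \<subseteq> carrier T"
    using xy by (auto simp: lin_span_def tensor_expr_def twisted_simps vecs_def intro!: sum.neutral)
  ultimately have "generated_subalgebra T (lin_span r x \<union> lin_span r y) = carrier T"
    using span by (auto simp: generated_subalgebra_def twisted_simps)
  then show ?thesis
    using is_twist short triangular_twisted
    by (auto simp: minimal_twist_def minimal_quasitriangular_def triangular_def)
qed

end

section \<open>Twists of semidirect products\<close>

lemma map_prod_hom: "f \<in> hom G K \<Longrightarrow> g \<in> hom G' K' \<Longrightarrow> map_prod f g \<in> hom (G \<times>\<times> G') (K \<times>\<times> K')"
  by (auto simp: hom_def DirProd_def)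

lemma (in fin_group) is_twist_iff:
  "is_twist A J \<longleftrightarrow> J \<in> Units (group_algebra (G \<times>\<times> G)) \<and>
     push (\<lambda>p. (fst p, fst p, snd p)) (carrier (G \<times>\<times> G)) J
       \<otimes>\<^bsub>group_algebra (G \<times>\<times> G \<times>\<times> G)\<^esub> push (\<lambda>p. (fst p, snd p, \<one>)) (carrier (G \<times>\<times> G)) J =
     push (\<lambda>p. (fst p, snd p, snd p)) (carrier (G \<times>\<times> G)) J
       \<otimes>\<^bsub>group_algebra (G \<times>\<times> G \<times>\<times> G)\<^esub> push (\<lambda>p. (\<one>, fst p, snd p)) (carrier (G \<times>\<times> G)) J \<and>
     push snd (carrier (G \<times>\<times> G)) J = bvec \<one> \<and> push fst (carrier (G \<times>\<times> G)) J = bvec \<one>"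
proof (cases "J \<in> Units (group_algebra (G \<times>\<times> G))")
  case True
  then have J: "J \<in> vecs (carrier (G \<times>\<times> G))" by (simp add: Units_def)
  have t3: "tensor_alg A (group_algebra (G \<times>\<times> G)) = alg.truncate (group_algebra (G \<times>\<times> G \<times>\<times> G))"
    by (intro tensor_group_algebra fin_group_DirProd fin_group_axioms)
  show ?thesis
    unfolding is_twist_def tensor2_group_algebra tensor_alg_truncate t3 alg_truncate_simps
      comult_left_push[OF J] comult_right_push[OF J] leg12_push[OF J] leg23_push[OF J]
      counit_left_push[OF J] counit_right_push[OF J] group_algebra_simps by (rule refl)
next
  case False
  then show ?thesis by (simp add: is_twist_def tensor2_group_algebra)
qed

text \<open>
  All structure maps in the twist axioms are natural with respect to group homomorphisms.
\<close>

lemma is_twist_push: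
  assumes "fin_group K" "fin_group G" and f: "f \<in> hom K G" and J: "is_twist (group_algebra K) J"
  shows "is_twist (group_algebra G) (push (map_prod f f) (carrier (K \<times>\<times> K)) J)"
proof -
  interpret K: group_twist K J using assms by (simp add: group_twist_def group_twist_axioms_def)
  interpret fin_group G by fact
  let ?GG = "G \<times>\<times> G" and ?GGG = "G \<times>\<times> G \<times>\<times> G"
  let ?F = "map_prod f f" and ?F3 = "map_prod f (map_prod f f)"
  have G2: "fin_group ?GG" and G3: "fin_group ?GGG" using assms by auto
  interpret G2: fin_group ?GG by (rule G2)
  interpret G3: fin_group ?GGG by (rule G3)
  have F: "?F \<in> hom K.GG ?GG" and F3: "?F3 \<in> hom K.GGG ?GGG" by (intro map_prod_hom f)+
  have F': "?F \<in> carrier K.GG \<rightarrow> carrier ?GG" and F3': "?F3 \<in> carrier K.GGG \<rightarrow> carrier ?GGG"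
    and f': "f \<in> carrier K \<rightarrow> carrier G"
    using F F3 f by (auto simp: hom_def)
  have one: "f \<one>\<^bsub>K\<^esub> = \<one>\<^bsub>G\<^esub>" using hom_one[OF f] K.is_group is_group by simp
  have push3: "push c (carrier ?GG) (push ?F (carrier K.GG) J) = push ?F3 (carrier K.GGG) (K.P d)"
    if "c \<in> carrier ?GG \<rightarrow> carrier ?GGG" "d \<in> carrier K.GG \<rightarrow> carrier K.GGG" "\<And>p. c (?F p) = ?F3 (d p)"
    for c d
    using that by (simp add: push_push[OF K.G2.fin G2.fin G3.fin F'] push_push[OF K.G2.fin K.G3.fin G3.fin _ F3'])
  have push1: "push c (carrier ?GG) (push ?F (carrier K.GG) J) = push f (carrier K) (push c' (carrier K.GG) J)"
    if "c \<in> carrier ?GG \<rightarrow> carrier G" "c' \<in> carrier K.GG \<rightarrow> carrier K" "\<And>p. c (?F p) = f (c' p)" for c c'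
    using that by (simp add: push_push[OF K.G2.fin G2.fin fin F'] push_push[OF K.G2.fin K.fin fin _ f'])
  note [simp] = carrier_DirProd
  have l: "push (\<lambda>p. (fst p, fst p, snd p)) (carrier ?GG) (push ?F (carrier K.GG) J) =
      push ?F3 (carrier K.GGG) (K.P (\<lambda>p. (fst p, fst p, snd p)))"
    by (rule push3) auto
  have r: "push (\<lambda>p. (fst p, snd p, snd p)) (carrier ?GG) (push ?F (carrier K.GG) J) =
      push ?F3 (carrier K.GGG) (K.P (\<lambda>p. (fst p, snd p, snd p)))"
    by (rule push3) auto
  have jl: "push (\<lambda>p. (fst p, snd p, \<one>\<^bsub>G\<^esub>)) (carrier ?GG) (push ?F (carrier K.GG) J) =
      push ?F3 (carrier K.GGG) (K.P (\<lambda>p. (fst p, snd p, \<one>\<^bsub>K\<^esub>)))"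
    by (rule push3) (auto simp: one)
  have jr: "push (\<lambda>p. (\<one>\<^bsub>G\<^esub>, fst p, snd p)) (carrier ?GG) (push ?F (carrier K.GG) J) =
      push ?F3 (carrier K.GGG) (K.P (\<lambda>p. (\<one>\<^bsub>K\<^esub>, fst p, snd p)))"
    by (rule push3) (auto simp: one)
  have counits: "push snd (carrier ?GG) (push ?F (carrier K.GG) J) = push f (carrier K) (push snd (carrier K.GG) J)"
    "push fst (carrier ?GG) (push ?F (carrier K.GG) J) = push f (carrier K) (push fst (carrier K.GG) J)"
    by (rule push1; auto)+
  show ?thesis
    unfolding is_twist_iff l r jl jr counits K.push_counit
      K.G3.push_mult[OF G3 F3, symmetric] K.twist_equation
    using K.G2.push_inverse(1)[OF G2 F K.J_Units] K.push_one[OF fin_group_axioms f] by simp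
qed

text \<open>
  The two commutation relations are exactly what lets the two twist equations be multiplied
  together.
\<close>

lemma is_twist_mult:
  assumes "is_twist (group_algebra G) U" "is_twist (group_algebra G) V" and G: "fin_group G"
    and comm_l: "push (\<lambda>p. (fst p, fst p, snd p)) (carrier (G \<times>\<times> G)) V
       \<otimes>\<^bsub>group_algebra (G \<times>\<times> G \<times>\<times> G)\<^esub> push (\<lambda>p. (fst p, snd p, \<one>\<^bsub>G\<^esub>)) (carrier (G \<times>\<times> G)) U =
      push (\<lambda>p. (fst p, snd p, \<one>\<^bsub>G\<^esub>)) (carrier (G \<times>\<times> G)) U
       \<otimes>\<^bsub>group_algebra (G \<times>\<times> G \<times>\<times> G)\<^esub> push (\<lambda>p. (fst p, fst p, snd p)) (carrier (G \<times>\<times> G)) V"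
    and comm_r: "push (\<lambda>p. (fst p, snd p, snd p)) (carrier (G \<times>\<times> G)) V
       \<otimes>\<^bsub>group_algebra (G \<times>\<times> G \<times>\<times> G)\<^esub> push (\<lambda>p. (\<one>\<^bsub>G\<^esub>, fst p, snd p)) (carrier (G \<times>\<times> G)) U =
      push (\<lambda>p. (\<one>\<^bsub>G\<^esub>, fst p, snd p)) (carrier (G \<times>\<times> G)) U
       \<otimes>\<^bsub>group_algebra (G \<times>\<times> G \<times>\<times> G)\<^esub> push (\<lambda>p. (fst p, snd p, snd p)) (carrier (G \<times>\<times> G)) V"
  shows "is_twist (group_algebra G) (U \<otimes>\<^bsub>group_algebra (G \<times>\<times> G)\<^esub> V)"
proof -
  interpret U: group_twist G U using assms by (simp add: group_twist_def group_twist_axioms_def)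
  interpret V: group_twist G V using assms by (simp add: group_twist_def group_twist_axioms_def)
  note c = U.component_homs
  note mult = U.G2.push_mult[OF U.G3.fin_group_axioms U.triple_homI]
  note m = mult[OF c(1) c(1) c(2)] mult[OF c(1) c(2) c(2)] mult[OF c(1) c(2) c(3)] mult[OF c(3) c(1) c(2)]
  note PU = U.P_Units[THEN U.G3.alg.Units_closed]
  note PV = V.P_Units[THEN U.G3.alg.Units_closed]
  note cl = PU[OF c(1) c(1) c(2)] PU[OF c(1) c(2) c(2)] PU[OF c(1) c(2) c(3)] PU[OF c(3) c(1) c(2)]
    PV[OF c(1) c(1) c(2)] PV[OF c(1) c(2) c(2)] PV[OF c(1) c(2) c(3)] PV[OF c(3) c(1) c(2)]
  have swap_middle: "(u \<otimes>\<^bsub>U.A3\<^esub> v) \<otimes>\<^bsub>U.A3\<^esub> (u' \<otimes>\<^bsub>U.A3\<^esub> v') = (u \<otimes>\<^bsub>U.A3\<^esub> u') \<otimes>\<^bsub>U.A3\<^esub> (v \<otimes>\<^bsub>U.A3\<^esub> v')"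
    if "v \<otimes>\<^bsub>U.A3\<^esub> u' = u' \<otimes>\<^bsub>U.A3\<^esub> v" "u \<in> carrier U.A3" "v \<in> carrier U.A3" "u' \<in> carrier U.A3" "v' \<in> carrier U.A3"
    for u v u' v'
  proof -
    have "(u \<otimes>\<^bsub>U.A3\<^esub> v) \<otimes>\<^bsub>U.A3\<^esub> (u' \<otimes>\<^bsub>U.A3\<^esub> v') = u \<otimes>\<^bsub>U.A3\<^esub> (v \<otimes>\<^bsub>U.A3\<^esub> u') \<otimes>\<^bsub>U.A3\<^esub> v'"
      using that(2-) by (simp add: U.G3.alg.m_assoc U.G3.mult_in_vecs)
    also have "\<dots> = (u \<otimes>\<^bsub>U.A3\<^esub> u') \<otimes>\<^bsub>U.A3\<^esub> (v \<otimes>\<^bsub>U.A3\<^esub> v')"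
      unfolding that(1) using that(2-) by (simp add: U.G3.alg.m_assoc U.G3.mult_in_vecs)
    finally show ?thesis .
  qed
  show ?thesis
    unfolding U.is_twist_iff m swap_middle[OF comm_l cl(1) cl(5) cl(3) cl(7)]
      swap_middle[OF comm_r cl(2) cl(6) cl(4) cl(8)] U.twist_equation V.twist_equation
    using U.G2.alg.Units_m_closed[OF U.J_Units V.J_Units]
    by (simp add: U.G2.push_mult[OF U.fin_group_axioms] c U.push_counit V.push_counit
        U.alg.l_one[unfolded group_algebra_simps])
qed

locale group_action = G: fin_group G + H: fin_group H
  for G :: "'a list monoid" and H :: "'a monoid" +
  fixes \<phi> :: "'a list \<Rightarrow> 'a \<Rightarrow> 'a"
  assumes action_hom: "\<phi> \<in> hom G (AutoGroup H)"
begin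

abbreviation S where "S \<equiv> semidirect \<phi> G H"

lemma carrier_AutoGroup: "carrier (AutoGroup H) = auto H"
  by (simp add: AutoGroup_def)

lemma action_auto: "g \<in> carrier G \<Longrightarrow> \<phi> g \<in> auto H"
  using action_hom by (auto simp: hom_def carrier_AutoGroup)

lemma action_in_hom: "g \<in> carrier G \<Longrightarrow> \<phi> g \<in> hom H H"
  using action_auto by (auto simp: auto_def)

lemma action_closed [simp]: "g \<in> carrier G \<Longrightarrow> h \<in> carrier H \<Longrightarrow> \<phi> g h \<in> carrier H"
  using action_in_hom by (auto simp: hom_def)

lemma action_mult: "g \<in> carrier G \<Longrightarrow> h \<in> carrier H \<Longrightarrow> k \<in> carrier H \<Longrightarrow>
  \<phi> g (h \<otimes>\<^bsub>H\<^esub> k) = \<phi> g h \<otimes>\<^bsub>H\<^esub> \<phi> g k"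
  using action_in_hom by (auto simp: hom_def)

lemma action_unit [simp]: "g \<in> carrier G \<Longrightarrow> \<phi> g \<one>\<^bsub>H\<^esub> = \<one>\<^bsub>H\<^esub>"
  using action_in_hom hom_one H.is_group by blast

lemma action_action: "g \<in> carrier G \<Longrightarrow> k \<in> carrier G \<Longrightarrow> h \<in> carrier H \<Longrightarrow>
  \<phi> (g \<otimes>\<^bsub>G\<^esub> k) h = \<phi> g (\<phi> k h)"
  using hom_mult[OF action_hom] action_auto
  by (simp add: AutoGroup_def BijGroup_def auto_def compose_def)

lemma action_one [simp]: "h \<in> carrier H \<Longrightarrow> \<phi> \<one>\<^bsub>G\<^esub> h = h"
  using hom_one[OF action_hom G.is_group H.AutoGroup] by (simp add: AutoGroup_def BijGroup_def)

lemma action_inverse [simp]: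
  "g \<in> carrier G \<Longrightarrow> h \<in> carrier H \<Longrightarrow> \<phi> (inv\<^bsub>G\<^esub> g) (\<phi> g h) = h"
  "g \<in> carrier G \<Longrightarrow> h \<in> carrier H \<Longrightarrow> \<phi> g (\<phi> (inv\<^bsub>G\<^esub> g) h) = h"
  by (simp_all add: action_action[symmetric])

lemma inv_AutoGroup_action: "g \<in> carrier G \<Longrightarrow> inv\<^bsub>AutoGroup H\<^esub> (\<phi> g) = \<phi> (inv\<^bsub>G\<^esub> g)"
  using group_hom.hom_inv[of G "AutoGroup H" \<phi>] action_hom
  by (simp add: group_hom_def group_hom_axioms_def G.is_group H.AutoGroup)

lemma semidirect_simps [simp]:
  "h # g \<in> carrier S \<longleftrightarrow> h \<in> carrier H \<and> g \<in> carrier G"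
  "(h # g) \<otimes>\<^bsub>S\<^esub> (k # g') = (h \<otimes>\<^bsub>H\<^esub> \<phi> g k) # (g \<otimes>\<^bsub>G\<^esub> g')"
  "\<one>\<^bsub>S\<^esub> = \<one>\<^bsub>H\<^esub> # \<one>\<^bsub>G\<^esub>"
  by (auto simp: semidirect_def)

lemma semidirect_carrierE:
  assumes "u \<in> carrier S"
  obtains h g where "u = h # g" "h \<in> carrier H" "g \<in> carrier G"
  using assms by (auto simp: semidirect_def)

lemma carrier_semidirect_eq: "carrier S = (\<lambda>(h, g). h # g) ` (carrier H \<times> carrier G)"
  by (auto simp: semidirect_def)

lemma group_semidirect: "Group.group S"
proof (rule groupI)
  fix u v assume "u \<in> carrier S" "v \<in> carrier S"
  then show "u \<otimes>\<^bsub>S\<^esub> v \<in> carrier S" by (auto elim!: semidirect_carrierE)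
  fix w assume "w \<in> carrier S"
  with \<open>u \<in> carrier S\<close> \<open>v \<in> carrier S\<close> show "u \<otimes>\<^bsub>S\<^esub> v \<otimes>\<^bsub>S\<^esub> w = u \<otimes>\<^bsub>S\<^esub> (v \<otimes>\<^bsub>S\<^esub> w)"
    by (auto elim!: semidirect_carrierE simp: H.m_assoc G.m_assoc action_mult action_action)
next
  fix u assume "u \<in> carrier S"
  then obtain h g where u: "u = h # g" "h \<in> carrier H" "g \<in> carrier G" by (rule semidirect_carrierE)
  show "\<one>\<^bsub>S\<^esub> \<otimes>\<^bsub>S\<^esub> u = u" using u by simp
  show "\<exists>v\<in>carrier S. v \<otimes>\<^bsub>S\<^esub> u = \<one>\<^bsub>S\<^esub>"
    using u by (intro bexI[of _ "\<phi> (inv\<^bsub>G\<^esub> g) (inv\<^bsub>H\<^esub> h) # inv\<^bsub>G\<^esub> g"]) (auto simp: action_mult[symmetric])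
qed auto

sublocale S: fin_group S
  using group_semidirect by (simp add: fin_group_def fin_group_axioms_def carrier_semidirect_eq)

definition \<iota> where "\<iota> g = \<one>\<^bsub>H\<^esub> # g"
definition \<kappa> where "\<kappa> h = h # \<one>\<^bsub>G\<^esub>"

lemma \<iota>_hom: "\<iota> \<in> hom G S" and \<kappa>_hom: "\<kappa> \<in> hom H S"
  by (auto simp: hom_def \<iota>_def \<kappa>_def)

lemma embeddings_closed [simp]:
  "g \<in> carrier G \<Longrightarrow> \<iota> g \<in> carrier S" "h \<in> carrier H \<Longrightarrow> \<kappa> h \<in> carrier S"
  by (auto simp: \<iota>_def \<kappa>_def)

lemma \<iota>_\<kappa>: "g \<in> carrier G \<Longrightarrow> h \<in> carrier H \<Longrightarrow> \<iota> g \<otimes>\<^bsub>S\<^esub> \<kappa> h = \<kappa> (\<phi> g h) \<otimes>\<^bsub>S\<^esub> \<iota> g"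
  by (simp add: \<iota>_def \<kappa>_def)

lemma \<kappa>_\<iota>: "g \<in> carrier G \<Longrightarrow> h \<in> carrier H \<Longrightarrow> \<kappa> h \<otimes>\<^bsub>S\<^esub> \<iota> g = h # g"
  by (simp add: \<iota>_def \<kappa>_def)

definition twist_product ::
    "('a \<times> 'a \<Rightarrow> complex) \<Rightarrow> ('a list \<times> 'a list \<Rightarrow> complex) \<Rightarrow> 'a list \<times> 'a list \<Rightarrow> complex" where
  "twist_product J K = push (map_prod \<kappa> \<kappa>) (carrier (H \<times>\<times> H)) J \<otimes>\<^bsub>group_algebra (S \<times>\<times> S)\<^esub>
     push (map_prod \<iota> \<iota>) (carrier (G \<times>\<times> G)) K"

definition invariant :: "('a \<times> 'a \<Rightarrow> complex) \<Rightarrow> bool" where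
  "invariant J \<longleftrightarrow> (\<forall>g\<in>carrier G. push (map_prod (\<phi> g) (\<phi> g)) (carrier (H \<times>\<times> H)) J = J)"

lemma ev_invariant:
  assumes "invariant J" "g \<in> carrier G"
  shows "ev (carrier (H \<times>\<times> H)) J (\<lambda>p. \<psi> (\<phi> g (fst p)) (\<phi> g (snd p))) =
    ev (carrier (H \<times>\<times> H)) J (\<lambda>p. \<psi> (fst p) (snd p))"
proof -
  have fin: "finite (carrier (H \<times>\<times> H))" by (simp add: carrier_DirProd)
  have "ev (carrier (H \<times>\<times> H)) (push (map_prod (\<phi> g) (\<phi> g)) (carrier (H \<times>\<times> H)) J) (\<lambda>p. \<psi> (fst p) (snd p)) =
    ev (carrier (H \<times>\<times> H)) J (\<lambda>p. \<psi> (\<phi> g (fst p)) (\<phi> g (snd p)))"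
    by (subst ev_push[OF fin fin]) (use assms(2) in \<open>auto simp: carrier_DirProd\<close>)
  with assms show ?thesis by (simp add: invariant_def)
qed

text \<open>
  The coproducts of the legs of K have equal components in two adjacent factors, so moving
  them past J conjugates J by a diagonal element of G, under which J is invariant.
\<close>

lemma is_twist_twist_product:
  assumes J: "is_twist (group_algebra H) J" and K: "is_twist (group_algebra G) K"
    and inv: "invariant J"
  shows "is_twist (group_algebra S) (twist_product J K)"
  unfolding twist_product_def
proof (rule is_twist_mult)
  let ?U = "push (map_prod \<kappa> \<kappa>) (carrier (H \<times>\<times> H)) J"
  let ?V = "push (map_prod \<iota> \<iota>) (carrier (G \<times>\<times> G)) K"
  show U: "is_twist (group_algebra S) ?U" and V: "is_twist (group_algebra S) ?V"
    using J K \<iota>_hom \<kappa>_hom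
    by (auto intro!: is_twist_push G.fin_group_axioms H.fin_group_axioms S.fin_group_axioms)
  show "fin_group S" by (rule S.fin_group_axioms)
  interpret U: group_twist S ?U
    using U S.fin_group_axioms by (simp add: group_twist_def group_twist_axioms_def)
  have fin: "finite (carrier (H \<times>\<times> H))" "finite (carrier (G \<times>\<times> G))" by (auto simp: carrier_DirProd)
  have ev_push_H: "ev (carrier U.GGG) (push f (carrier U.GG) ?U) \<psi> =
      ev (carrier (H \<times>\<times> H)) J (\<lambda>p. \<psi> (f (\<kappa> (fst p), \<kappa> (snd p))))"
    if "f \<in> carrier U.GG \<rightarrow> carrier U.GGG" for f \<psi>
    unfolding ev_push[OF U.G2.fin U.G3.fin that]
    by (subst ev_push[OF fin(1) U.G2.fin]) (auto simp: carrier_DirProd map_prod_def case_prod_unfold)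
  have ev_push_G: "ev (carrier U.GGG) (push f (carrier U.GG) ?V) \<psi> =
      ev (carrier (G \<times>\<times> G)) K (\<lambda>p. \<psi> (f (\<iota> (fst p), \<iota> (snd p))))"
    if "f \<in> carrier U.GG \<rightarrow> carrier U.GGG" for f \<psi>
    unfolding ev_push[OF U.G2.fin U.G3.fin that]
    by (subst ev_push[OF fin(2) U.G2.fin]) (auto simp: carrier_DirProd map_prod_def case_prod_unfold)
  have f: "(\<lambda>p. (fst p, fst p, snd p)) \<in> carrier U.GG \<rightarrow> carrier U.GGG"
    "(\<lambda>p. (fst p, snd p, snd p)) \<in> carrier U.GG \<rightarrow> carrier U.GGG"
    "(\<lambda>p. (fst p, snd p, \<one>\<^bsub>S\<^esub>)) \<in> carrier U.GG \<rightarrow> carrier U.GGG"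
    "(\<lambda>p. (\<one>\<^bsub>S\<^esub>, fst p, snd p)) \<in> carrier U.GG \<rightarrow> carrier U.GGG"
    by (auto simp: carrier_DirProd simp del: semidirect_simps)
  note ev = U.G3.ev_mult ev_push_H[OF f(3)] ev_push_H[OF f(4)] ev_push_G[OF f(1)] ev_push_G[OF f(2)]
  show "push (\<lambda>p. (fst p, fst p, snd p)) (carrier U.GG) ?V \<otimes>\<^bsub>U.A3\<^esub> push (\<lambda>p. (fst p, snd p, \<one>\<^bsub>S\<^esub>)) (carrier U.GG) ?U =
      push (\<lambda>p. (fst p, snd p, \<one>\<^bsub>S\<^esub>)) (carrier U.GG) ?U \<otimes>\<^bsub>U.A3\<^esub> push (\<lambda>p. (fst p, fst p, snd p)) (carrier U.GG) ?V"
  proof (rule vecs_eqI[OF U.G3.fin U.G3.mult_in_vecs U.G3.mult_in_vecs], unfold ev fst_conv snd_conv mult_DirProd)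
    fix \<psi>
    have "ev (carrier (G \<times>\<times> G)) K (\<lambda>a. ev (carrier (H \<times>\<times> H)) J (\<lambda>h. \<psi> (\<iota> (fst a) \<otimes>\<^bsub>S\<^esub> \<kappa> (fst h), \<iota> (fst a) \<otimes>\<^bsub>S\<^esub> \<kappa> (snd h), \<iota> (snd a) \<otimes>\<^bsub>S\<^esub> \<one>\<^bsub>S\<^esub>))) =
     ev (carrier (G \<times>\<times> G)) K (\<lambda>a. ev (carrier (H \<times>\<times> H)) J (\<lambda>h. \<psi> (\<kappa> (\<phi> (fst a) (fst h)) \<otimes>\<^bsub>S\<^esub> \<iota> (fst a), \<kappa> (\<phi> (fst a) (snd h)) \<otimes>\<^bsub>S\<^esub> \<iota> (fst a), \<one>\<^bsub>S\<^esub> \<otimes>\<^bsub>S\<^esub> \<iota> (snd a))))"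
      by (auto intro!: ev_cong simp: carrier_DirProd \<iota>_\<kappa> simp del: semidirect_simps)
    also have "\<dots> = ev (carrier (G \<times>\<times> G)) K (\<lambda>a. ev (carrier (H \<times>\<times> H)) J (\<lambda>h. \<psi> (\<kappa> (fst h) \<otimes>\<^bsub>S\<^esub> \<iota> (fst a), \<kappa> (snd h) \<otimes>\<^bsub>S\<^esub> \<iota> (fst a), \<one>\<^bsub>S\<^esub> \<otimes>\<^bsub>S\<^esub> \<iota> (snd a))))"
      by (intro ev_cong refl ev_invariant[OF inv]) (auto simp: carrier_DirProd)
    also have "\<dots> = ev (carrier (H \<times>\<times> H)) J (\<lambda>h. ev (carrier (G \<times>\<times> G)) K (\<lambda>a. \<psi> (\<kappa> (fst h) \<otimes>\<^bsub>S\<^esub> \<iota> (fst a), \<kappa> (snd h) \<otimes>\<^bsub>S\<^esub> \<iota> (fst a), \<one>\<^bsub>S\<^esub> \<otimes>\<^bsub>S\<^esub> \<iota> (snd a))))"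
      by (rule ev_swap)
    finally show "ev (carrier (G \<times>\<times> G)) K (\<lambda>a. ev (carrier (H \<times>\<times> H)) J (\<lambda>h. \<psi> (\<iota> (fst a) \<otimes>\<^bsub>S\<^esub> \<kappa> (fst h), \<iota> (fst a) \<otimes>\<^bsub>S\<^esub> \<kappa> (snd h), \<iota> (snd a) \<otimes>\<^bsub>S\<^esub> \<one>\<^bsub>S\<^esub>))) = \<dots>" .
  qed
  show "push (\<lambda>p. (fst p, snd p, snd p)) (carrier U.GG) ?V \<otimes>\<^bsub>U.A3\<^esub> push (\<lambda>p. (\<one>\<^bsub>S\<^esub>, fst p, snd p)) (carrier U.GG) ?U =
      push (\<lambda>p. (\<one>\<^bsub>S\<^esub>, fst p, snd p)) (carrier U.GG) ?U \<otimes>\<^bsub>U.A3\<^esub> push (\<lambda>p. (fst p, snd p, snd p)) (carrier U.GG) ?V"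
  proof (rule vecs_eqI[OF U.G3.fin U.G3.mult_in_vecs U.G3.mult_in_vecs], unfold ev fst_conv snd_conv mult_DirProd)
    fix \<psi>
    have "ev (carrier (G \<times>\<times> G)) K (\<lambda>a. ev (carrier (H \<times>\<times> H)) J (\<lambda>h. \<psi> (\<iota> (fst a) \<otimes>\<^bsub>S\<^esub> \<one>\<^bsub>S\<^esub>, \<iota> (snd a) \<otimes>\<^bsub>S\<^esub> \<kappa> (fst h), \<iota> (snd a) \<otimes>\<^bsub>S\<^esub> \<kappa> (snd h)))) =
     ev (carrier (G \<times>\<times> G)) K (\<lambda>a. ev (carrier (H \<times>\<times> H)) J (\<lambda>h. \<psi> (\<one>\<^bsub>S\<^esub> \<otimes>\<^bsub>S\<^esub> \<iota> (fst a), \<kappa> (\<phi> (snd a) (fst h)) \<otimes>\<^bsub>S\<^esub> \<iota> (snd a), \<kappa> (\<phi> (snd a) (snd h)) \<otimes>\<^bsub>S\<^esub> \<iota> (snd a))))"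
      by (auto intro!: ev_cong simp: carrier_DirProd \<iota>_\<kappa> simp del: semidirect_simps)
    also have "\<dots> = ev (carrier (G \<times>\<times> G)) K (\<lambda>a. ev (carrier (H \<times>\<times> H)) J (\<lambda>h. \<psi> (\<one>\<^bsub>S\<^esub> \<otimes>\<^bsub>S\<^esub> \<iota> (fst a), \<kappa> (fst h) \<otimes>\<^bsub>S\<^esub> \<iota> (snd a), \<kappa> (snd h) \<otimes>\<^bsub>S\<^esub> \<iota> (snd a))))"
      by (intro ev_cong refl ev_invariant[OF inv]) (auto simp: carrier_DirProd)
    also have "\<dots> = ev (carrier (H \<times>\<times> H)) J (\<lambda>h. ev (carrier (G \<times>\<times> G)) K (\<lambda>a. \<psi> (\<one>\<^bsub>S\<^esub> \<otimes>\<^bsub>S\<^esub> \<iota> (fst a), \<kappa> (fst h) \<otimes>\<^bsub>S\<^esub> \<iota> (snd a), \<kappa> (snd h) \<otimes>\<^bsub>S\<^esub> \<iota> (snd a))))"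
      by (rule ev_swap)
    finally show "ev (carrier (G \<times>\<times> G)) K (\<lambda>a. ev (carrier (H \<times>\<times> H)) J (\<lambda>h. \<psi> (\<iota> (fst a) \<otimes>\<^bsub>S\<^esub> \<one>\<^bsub>S\<^esub>, \<iota> (snd a) \<otimes>\<^bsub>S\<^esub> \<kappa> (fst h), \<iota> (snd a) \<otimes>\<^bsub>S\<^esub> \<kappa> (snd h)))) = \<dots>" .
  qed
qed

end

section \<open>Symplectic forms on abelian groups of odd order\<close>

lemma Cstar_simps [simp]:
  "carrier Cstar = - {0}" "x \<otimes>\<^bsub>Cstar\<^esub> y = x * y" "\<one>\<^bsub>Cstar\<^esub> = 1"
  by (simp_all add: Cstar_def)

lemma (in Group.group) character_one: "f \<in> hom G Cstar \<Longrightarrow> f \<one> = 1"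
  using hom_mult[of f G Cstar \<one> \<one>] by (auto simp: hom_def)

lemma (in Group.group) group_dual_group: "Group.group (dual_group G)"
proof (rule groupI)
  fix f assume f: "f \<in> carrier (dual_group G)"
  then have f0: "f x \<noteq> 0" if "x \<in> carrier G" for x using that by (auto simp: dual_group_def hom_def)
  show "\<one>\<^bsub>dual_group G\<^esub> \<otimes>\<^bsub>dual_group G\<^esub> f = f"
    using f by (auto simp: dual_group_def extensional_def fun_eq_iff)
  show "\<exists>g\<in>carrier (dual_group G). g \<otimes>\<^bsub>dual_group G\<^esub> f = \<one>\<^bsub>dual_group G\<^esub>"
    using f f0 by (intro bexI[of _ "\<lambda>x\<in>carrier G. inverse (f x)"])
      (auto simp: dual_group_def hom_def fun_eq_iff)
qed (auto simp: dual_group_def hom_def fun_eq_iff mult_ac)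

locale symplectic_group = fin_group H + Group.comm_group H for H (structure) +
  fixes B :: "'a \<Rightarrow> 'a \<Rightarrow> complex"
  assumes odd_order: "odd (order H)"
    and symplectic: "symplectic_structure H B"
begin

text \<open>
  The exponential of the form on H: \<omega>(x, y) = exp \<langle>x, y\<rangle>, see \<open>exp_sform\<close>.
\<close>

definition \<omega> where "\<omega> x y = B y x"

lemma B_in_dual: "y \<in> carrier H \<Longrightarrow> B y \<in> carrier (dual_group H)"
  using symplectic by (auto simp: symplectic_structure_def iso_def hom_def)

lemma B_hom: "y \<in> carrier H \<Longrightarrow> B y \<in> hom H Cstar"
  using B_in_dual by (auto simp: dual_group_def)

lemma \<omega>_nonzero [simp]: "x \<in> carrier H \<Longrightarrow> y \<in> carrier H \<Longrightarrow> \<omega> x y \<noteq> 0"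
  using B_hom by (auto simp: \<omega>_def hom_def)

lemma \<omega>_mult_left: "x \<in> carrier H \<Longrightarrow> x' \<in> carrier H \<Longrightarrow> y \<in> carrier H \<Longrightarrow>
   \<omega> (x \<otimes> x') y = \<omega> x y * \<omega> x' y"
  using B_hom by (auto simp: \<omega>_def hom_def)

lemma \<omega>_mult_right: "x \<in> carrier H \<Longrightarrow> y \<in> carrier H \<Longrightarrow> y' \<in> carrier H \<Longrightarrow>
   \<omega> x (y \<otimes> y') = \<omega> x y * \<omega> x y'"
  using symplectic
  by (auto simp: \<omega>_def symplectic_structure_def iso_def hom_def dual_group_def)

lemma \<omega>_skew: "x \<in> carrier H \<Longrightarrow> y \<in> carrier H \<Longrightarrow> \<omega> x y * \<omega> y x = 1"
proof -
  assume x: "x \<in> carrier H" and y: "y \<in> carrier H"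
  interpret D: Group.group "dual_group H" by (rule group_dual_group)
  have "dual_map H B x \<otimes>\<^bsub>dual_group H\<^esub> B x = \<one>\<^bsub>dual_group H\<^esub>"
    using symplectic x B_in_dual[OF x] by (simp add: symplectic_structure_def)
  then show ?thesis
    using x y by (auto simp: dual_group_def dual_map_def fun_eq_iff \<omega>_def mult.commute split: if_splits)
qed

lemma \<omega>_one: "x \<in> carrier H \<Longrightarrow> \<omega> \<one> x = 1" "x \<in> carrier H \<Longrightarrow> \<omega> x \<one> = 1"
  using character_one[OF B_hom, of x] \<omega>_skew[of x \<one>] by (auto simp: \<omega>_def)

lemma \<omega>_inv:
  "x \<in> carrier H \<Longrightarrow> y \<in> carrier H \<Longrightarrow> \<omega> (inv x) y = inverse (\<omega> x y)"
  "x \<in> carrier H \<Longrightarrow> y \<in> carrier H \<Longrightarrow> \<omega> x (inv y) = inverse (\<omega> x y)"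
proof -
  assume x: "x \<in> carrier H" and y: "y \<in> carrier H"
  have "\<omega> x y * \<omega> (inv x) y = 1"
    using \<omega>_mult_left[of x "inv x" y] x y by (simp add: \<omega>_one)
  then show "\<omega> (inv x) y = inverse (\<omega> x y)" by (rule inverse_unique[symmetric])
  have "\<omega> x y * \<omega> x (inv y) = 1"
    using \<omega>_mult_right[of x y "inv y"] x y by (simp add: \<omega>_one)
  then show "\<omega> x (inv y) = inverse (\<omega> x y)" by (rule inverse_unique[symmetric])
qed

lemma exp_sform: "x \<in> carrier H \<Longrightarrow> y \<in> carrier H \<Longrightarrow> exp (sform B x y) = \<omega> x y"
  using \<omega>_nonzero[of x y] by (simp add: sform_def pairing_def \<omega>_def)

lemma order_nonzero: "of_nat (order H) \<noteq> (0 :: complex)"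
  using odd_order by (metis even_zero of_nat_eq_0_iff)

lemma J_of_eq:
  "J_of H B (x, y) = (if x \<in> carrier H \<and> y \<in> carrier H then \<omega> x y / of_nat (order H) else 0)"
proof -
  have "J_of H B (x, y) = inverse (of_nat (order H)) *
     (\<Sum>a\<in>carrier H. \<Sum>b\<in>carrier H. if a = x \<and> b = y then \<omega> a b else 0)"
    unfolding J_of_def tens_bvec by (auto simp: bvec_def exp_sform intro!: sum.cong)
  also have "(\<Sum>a\<in>carrier H. \<Sum>b\<in>carrier H. if a = x \<and> b = y then \<omega> a b else 0) =
     (\<Sum>a\<in>carrier H. if a = x then (\<Sum>b\<in>carrier H. if b = y then \<omega> a b else 0) else 0)"
    by (intro sum.cong refl) auto
  also have "\<dots> = (if x \<in> carrier H \<and> y \<in> carrier H then \<omega> x y else 0)" by auto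
  finally show ?thesis by (simp add: divide_inverse)
qed

lemma \<omega>_orthogonality:
  assumes x: "x \<in> carrier H"
  shows "(\<Sum>y\<in>carrier H. \<omega> x y) = (if x = \<one> then of_nat (order H) else 0)"
proof (cases "x = \<one>")
  case True
  then show ?thesis by (simp add: \<omega>_one order_def)
next
  case False
  have "\<exists>z\<in>carrier H. \<omega> x z \<noteq> 1"
  proof (rule ccontr)
    assume "\<not> ?thesis"
    then have "\<omega> z x = 1" if "z \<in> carrier H" for z
      using \<omega>_skew[OF x that] that by simp
    then have "B x = B \<one>"
      using B_in_dual[OF x] B_in_dual[OF one_closed] \<omega>_one(2)
      by (intro extensionalityI[of _ "carrier H"]) (simp_all add: dual_group_def \<omega>_def)
    moreover have "inj_on B (carrier H)"
      using symplectic by (simp add: symplectic_structure_def iso_def bij_betw_def)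
    ultimately show False using inj_onD[of B "carrier H" x \<one>] x False by simp
  qed
  then obtain z where z: "z \<in> carrier H" "\<omega> x z \<noteq> 1" by blast
  have "(\<Sum>y\<in>carrier H. \<omega> x y) = (\<Sum>y\<in>carrier H. \<omega> x (z \<otimes> y))"
    using z by (intro sum.reindex_bij_witness[of _ "\<lambda>y. z \<otimes> y" "\<lambda>y. inv z \<otimes> y"])
      (auto simp: m_assoc[symmetric])
  also have "\<dots> = \<omega> x z * (\<Sum>y\<in>carrier H. \<omega> x y)"
    using x z by (simp add: \<omega>_mult_right sum_distrib_left)
  finally have "(1 - \<omega> x z) * (\<Sum>y\<in>carrier H. \<omega> x y) = 0" by (simp add: algebra_simps)
  with z False show ?thesis by simp
qed

lemma gsqrt_exists:
  obtains m :: nat where "\<And>x. x \<in> carrier H \<Longrightarrow> x [^] m \<otimes> x [^] m = x"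
proof -
  \<comment> \<open>Then x^(2m) = x^(|H| + 1) = x by Lagrange's theorem.\<close>
  obtain m where m: "Suc (order H) = m + m" using odd_order by (metis even_Suc evenE mult_2)
  have "x [^] m \<otimes> x [^] m = x" if x: "x \<in> carrier H" for x
  proof -
    have "x [^] m \<otimes> x [^] m = x [^] Suc (order H)" unfolding m by (rule nat_pow_mult[OF x])
    also have "\<dots> = x" using x by (simp only: nat_pow_Suc pow_order_eq_1 l_one)
    finally show ?thesis .
  qed
  then show ?thesis by (rule that)
qed

lemma square_inj:
  assumes "y \<in> carrier H" "z \<in> carrier H" "y \<otimes> y = z \<otimes> z"
  shows "y = z"
proof -
  obtain m :: nat where m: "\<And>x. x \<in> carrier H \<Longrightarrow> x [^] m \<otimes> x [^] m = x"
    using gsqrt_exists by blast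
  have "y = (y \<otimes> y) [^] m" using m[OF assms(1)] nat_pow_distrib[OF assms(1) assms(1), of m] by (simp only:)
  also have "\<dots> = z" unfolding assms(3)
    using m[OF assms(2)] nat_pow_distrib[OF assms(2) assms(2), of m] by (simp only:)
  finally show ?thesis .
qed

lemma gsqrt_eqI: "z \<in> carrier H \<Longrightarrow> z \<otimes> z = x \<Longrightarrow> gsqrt H x = z"
proof -
  assume z: "z \<in> carrier H" "z \<otimes> z = x"
  have square: "w [^] (2::nat) = w \<otimes> w" if "w \<in> carrier H" for w
    using that by (simp add: numeral_2_eq_2)
  show ?thesis
    unfolding gsqrt_def
  proof (rule the_equality)
    show "z \<in> carrier H \<and> z [^] (2::nat) = x" using z square by simp
    show "w = z" if w: "w \<in> carrier H \<and> w [^] (2::nat) = x" for w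
    proof (rule square_inj)
      show "w \<otimes> w = z \<otimes> z" using w z square[of w] by (simp only:)
    qed (use w z in auto)
  qed
qed

lemma gsqrt_closed [simp]: "x \<in> carrier H \<Longrightarrow> gsqrt H x \<in> carrier H"
  and gsqrt_square: "x \<in> carrier H \<Longrightarrow> gsqrt H x \<otimes> gsqrt H x = x"
proof -
  assume x: "x \<in> carrier H"
  obtain m :: nat where m: "\<And>x. x \<in> carrier H \<Longrightarrow> x [^] m \<otimes> x [^] m = x"
    using gsqrt_exists by blast
  have "gsqrt H x = x [^] m" by (rule gsqrt_eqI) (use x m in simp_all)
  then show "gsqrt H x \<in> carrier H" "gsqrt H x \<otimes> gsqrt H x = x" using x m by simp_all
qed

lemma gsqrt_hom: "f \<in> hom H H \<Longrightarrow> x \<in> carrier H \<Longrightarrow> gsqrt H (f x) = f (gsqrt H x)"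
proof (rule gsqrt_eqI)
  assume f: "f \<in> hom H H" and x: "x \<in> carrier H"
  show "f (gsqrt H x) \<in> carrier H" using f x by (auto simp: hom_def)
  show "f (gsqrt H x) \<otimes> f (gsqrt H x) = f x"
    using x by (simp add: hom_mult[OF f, symmetric] gsqrt_square)
qed

lemma square_quotient:
  assumes c: "c \<in> carrier H" and u: "u \<in> carrier H" and v: "v \<in> carrier H"
  shows "c \<otimes> c \<otimes> inv u \<otimes> v = \<one> \<longleftrightarrow> c = gsqrt H u \<otimes> inv (gsqrt H v)"
proof -
  define s t where "s = gsqrt H u" and "t = gsqrt H v"
  have s: "s \<in> carrier H" "u = s \<otimes> s" and t: "t \<in> carrier H" "v = t \<otimes> t"
    using u v by (simp_all add: s_def t_def gsqrt_square)
  have d: "s \<otimes> inv t \<in> carrier H" using s t by simp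
  have ct: "c \<otimes> t \<in> carrier H" using c t by simp
  have "c \<otimes> c \<otimes> inv u \<otimes> v = ((c \<otimes> t) \<otimes> (c \<otimes> t)) \<otimes> inv (s \<otimes> s)"
    unfolding s(2) t(2) using c s(1) t(1) by (simp add: m_ac)
  also have "\<dots> = \<one> \<longleftrightarrow> (c \<otimes> t) \<otimes> (c \<otimes> t) = s \<otimes> s"
    using inv_solve_right[of \<one> "(c \<otimes> t) \<otimes> (c \<otimes> t)" "s \<otimes> s"] ct s(1)
    by (metis inv_solve_right' l_one m_closed one_closed)
  also have "\<dots> \<longleftrightarrow> c \<otimes> t = s"
    using square_inj[OF ct s(1)] by blast
  also have "\<dots> \<longleftrightarrow> c = s \<otimes> inv t"
    using inv_solve_right[OF c s(1) t(1)] by auto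
  finally show ?thesis by (simp only: s_def t_def)
qed

text \<open>
  Substitute h = ck. Then the exponent is affine in k, because \<omega>(k, k) occurs twice and has square 1 by
  skew-symmetry. Hence the sum over k is a character sum. It vanishes unless \<open>c\<^sup>2 = u v\<inverse>\<close>, and in a group
  of odd order the only solution is the quotient of the square roots of u and v. For f = 1 this gives
  the R-matrix of a single symplectic group.
\<close>

lemma J_of_convolution:
  assumes u: "u \<in> carrier H" and v: "v \<in> carrier H"
    and f: "\<And>a b c. a \<in> carrier H \<Longrightarrow> b \<in> carrier H \<Longrightarrow> c \<in> carrier H \<Longrightarrow> f (a \<otimes> c) (b \<otimes> c) = f a b"
  shows "ev (carrier (H \<times>\<times> H)) (J_of H B) (\<lambda>(h, k). J_of H B (inv h \<otimes> u, inv k \<otimes> v) * f h k) =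
    \<omega> u (gsqrt H v) / of_nat (order H) * f (gsqrt H u) (gsqrt H v)"
proof -
  let ?N = "of_nat (order H) :: complex"
  let ?s = "gsqrt H u" and ?t = "gsqrt H v"
  have st: "?s \<in> carrier H" "?t \<in> carrier H" using u v by auto
  have skew: "\<omega> k k * \<omega> k k = 1" if "k \<in> carrier H" for k using \<omega>_skew that by blast
  have exponent: "\<omega> (c \<otimes> k) k * \<omega> (inv (c \<otimes> k) \<otimes> u) (inv k \<otimes> v) =
      \<omega> (inv c \<otimes> u) v * \<omega> (c \<otimes> c \<otimes> inv u \<otimes> v) k"
    if c: "c \<in> carrier H" and k: "k \<in> carrier H" for c k
  proof -
    have kv: "\<omega> v k = inverse (\<omega> k v)"
      using \<omega>_skew[OF k v] by (simp add: inverse_unique)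
    show ?thesis
      using c k u v skew[OF k]
      by (simp add: \<omega>_mult_left \<omega>_mult_right \<omega>_inv inv_mult kv divide_simps)
  qed
  have "ev (carrier (H \<times>\<times> H)) (J_of H B) (\<lambda>(h, k). J_of H B (inv h \<otimes> u, inv k \<otimes> v) * f h k) =
    (\<Sum>k\<in>carrier H. \<Sum>h\<in>carrier H. \<omega> h k * \<omega> (inv h \<otimes> u) (inv k \<otimes> v) * f h k / ?N^2)"
    unfolding carrier_DirProd ev_Times_fst unfolding ev_def
    using u v by (intro sum.cong refl) (auto simp: J_of_eq power2_eq_square)
  also have "\<dots> = (\<Sum>k\<in>carrier H. \<Sum>c\<in>carrier H. \<omega> (c \<otimes> k) k * \<omega> (inv (c \<otimes> k) \<otimes> u) (inv k \<otimes> v) * f (c \<otimes> k) k / ?N^2)"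
  proof (rule sum.cong[OF refl])
    fix k assume "k \<in> carrier H"
    then show "(\<Sum>h\<in>carrier H. \<omega> h k * \<omega> (inv h \<otimes> u) (inv k \<otimes> v) * f h k / ?N^2) =
      (\<Sum>c\<in>carrier H. \<omega> (c \<otimes> k) k * \<omega> (inv (c \<otimes> k) \<otimes> u) (inv k \<otimes> v) * f (c \<otimes> k) k / ?N^2)"
      by (intro sum.reindex_bij_witness[of _ "\<lambda>c. c \<otimes> k" "\<lambda>h. h \<otimes> inv k"])
         (auto simp: m_assoc)
  qed
  also have "\<dots> = (\<Sum>k\<in>carrier H. \<Sum>c\<in>carrier H. \<omega> (inv c \<otimes> u) v * f c \<one> / ?N^2 * \<omega> (c \<otimes> c \<otimes> inv u \<otimes> v) k)"
  proof (intro sum.cong refl)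
    fix k c assume k: "k \<in> carrier H" and c: "c \<in> carrier H"
    have "f (c \<otimes> k) k = f c \<one>" using f[OF c one_closed k] k by simp
    then show "\<omega> (c \<otimes> k) k * \<omega> (inv (c \<otimes> k) \<otimes> u) (inv k \<otimes> v) * f (c \<otimes> k) k / ?N^2 =
       \<omega> (inv c \<otimes> u) v * f c \<one> / ?N^2 * \<omega> (c \<otimes> c \<otimes> inv u \<otimes> v) k"
      unfolding exponent[OF c k] by simp
  qed
  also have "\<dots> = (\<Sum>c\<in>carrier H. \<omega> (inv c \<otimes> u) v * f c \<one> / ?N^2 * (\<Sum>k\<in>carrier H. \<omega> (c \<otimes> c \<otimes> inv u \<otimes> v) k))"
    unfolding sum_distrib_left by (rule sum.swap)
  also have "\<dots> = (\<Sum>c\<in>carrier H. if c = ?s \<otimes> inv ?t then \<omega> (inv c \<otimes> u) v * f c \<one> / ?N else 0)"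
    using u v order_nonzero
    by (intro sum.cong refl) (auto simp: \<omega>_orthogonality square_quotient power2_eq_square)
  also have "\<dots> = \<omega> (inv (?s \<otimes> inv ?t) \<otimes> u) v * f (?s \<otimes> inv ?t) \<one> / ?N"
    using st by simp
  also have "f (?s \<otimes> inv ?t) \<one> = f ?s ?t"
    using f[of "?s \<otimes> inv ?t" \<one> ?t] st by (simp add: m_assoc)
  also have "\<omega> (inv (?s \<otimes> inv ?t) \<otimes> u) v = \<omega> u ?t"
  proof -
    have "\<omega> (inv (?s \<otimes> inv ?t) \<otimes> (?s \<otimes> ?s)) (?t \<otimes> ?t) = \<omega> (?s \<otimes> ?s) ?t"
      using st skew[OF st(2)]
      by (simp add: \<omega>_mult_left \<omega>_mult_right \<omega>_inv inv_mult divide_simps)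
    then show ?thesis using u v by (simp only: gsqrt_square)
  qed
  finally show ?thesis by (simp add: field_simps)
qed

end

section \<open>The R-matrix at one level of a hierarchy\<close>

text \<open>
  The summands are those of the coefficient of \<open>K\<^sub>2\<^sub>1\<inverse>K\<close> at (g, g'), weighted by f. The weight is arbitrary,
  up to invariance under simultaneous right translation, since in the next level the sum over H
  produces such a weight. The element \<sigma>(g) plays the role of a square root of g.
\<close>

definition collapses ::
    "'g monoid \<Rightarrow> ('g \<times> 'g \<Rightarrow> complex) \<Rightarrow> ('g \<Rightarrow> 'g) \<Rightarrow> ('g \<Rightarrow> 'g \<Rightarrow> complex) \<Rightarrow> bool" where
  "collapses G K \<sigma> r \<longleftrightarrow>
     (\<forall>f. (\<forall>a\<in>carrier G. \<forall>b\<in>carrier G. \<forall>c\<in>carrier G. f (a \<otimes>\<^bsub>G\<^esub> c) (b \<otimes>\<^bsub>G\<^esub> c) = f a b) \<longrightarrow>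
       (\<forall>g\<in>carrier G. \<forall>g'\<in>carrier G.
          ev (carrier (G \<times>\<times> G)) (inv\<^bsub>group_algebra (G \<times>\<times> G)\<^esub> (flip K))
            (\<lambda>(a, b). K (inv\<^bsub>G\<^esub> a \<otimes>\<^bsub>G\<^esub> g, inv\<^bsub>G\<^esub> b \<otimes>\<^bsub>G\<^esub> g') * f a b) = r g g' * f (\<sigma> g) (\<sigma> g')))"

text \<open>
  The orthogonality of rows of a Hadamard matrix, with inverses in place of complex conjugates; for
  entries of constant modulus the two differ by a factor only.
\<close>

definition hadamard :: "'g monoid \<Rightarrow> ('g \<Rightarrow> 'g \<Rightarrow> complex) \<Rightarrow> bool" where
  "hadamard G r \<longleftrightarrow> (\<forall>x\<in>carrier G. \<forall>y\<in>carrier G. r x y \<noteq> 0) \<and>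
     (\<forall>x\<in>carrier G. \<forall>z\<in>carrier G.
        (\<Sum>y\<in>carrier G. r x y / r z y) = (if x = z then of_nat (order G) else 0))"

text \<open>
  By skew-symmetry, exchanging the legs inverts every coefficient, and the orthogonality relation in
  both variables shows that this inverts J.
\<close>

lemma (in symplectic_group) inv_flip_J_of:
  assumes "J_of H B \<in> Units (group_algebra (H \<times>\<times> H))"
  shows "inv\<^bsub>group_algebra (H \<times>\<times> H)\<^esub> (flip (J_of H B)) = J_of H B"
proof -
  let ?N = "of_nat (order H) :: complex" and ?A2 = "group_algebra (H \<times>\<times> H)"
  interpret H2: fin_group "H \<times>\<times> H" by (intro fin_group_DirProd fin_group_axioms)
  have vecs: "J_of H B \<in> vecs (carrier (H \<times>\<times> H))" "flip (J_of H B) \<in> vecs (carrier (H \<times>\<times> H))"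
    by (auto simp: vecs_def J_of_eq carrier_DirProd flip_def)
  have "J_of H B \<otimes>\<^bsub>?A2\<^esub> flip (J_of H B) = bvec \<one>\<^bsub>H \<times>\<times> H\<^esub>"
  proof
    fix p :: "'a \<times> 'a"
    obtain u v where p: "p = (u, v)" by (cases p)
    show "(J_of H B \<otimes>\<^bsub>?A2\<^esub> flip (J_of H B)) p = bvec \<one>\<^bsub>H \<times>\<times> H\<^esub> p"
    proof (cases "p \<in> carrier (H \<times>\<times> H)")
      case True
      then have u: "u \<in> carrier H" and v: "v \<in> carrier H" by (auto simp: p carrier_DirProd)
      have exponent: "\<omega> h k * \<omega> (inv k \<otimes> v) (inv h \<otimes> u) = \<omega> v u * (\<omega> u k * \<omega> v (inv h))"
        if h: "h \<in> carrier H" and k: "k \<in> carrier H" for h k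
      proof -
        have e: "\<omega> k h = inverse (\<omega> h k)" "\<omega> u k = inverse (\<omega> k u)"
          using \<omega>_skew[OF h k] \<omega>_skew[OF k u] by (simp_all add: inverse_unique)
        show ?thesis
          using h k u v by (simp add: \<omega>_mult_left \<omega>_mult_right \<omega>_inv e(1) e(2))
      qed
      have "(J_of H B \<otimes>\<^bsub>?A2\<^esub> flip (J_of H B)) p =
        (\<Sum>h\<in>carrier H. \<Sum>k\<in>carrier H. \<omega> h k * \<omega> (inv k \<otimes> v) (inv h \<otimes> u) / ?N^2)"
        unfolding H2.mult_apply[OF True] unfolding carrier_DirProd ev_Times_snd unfolding ev_def
        using u v by (intro sum.cong refl)
          (auto simp: J_of_eq p power2_eq_square flip_def inv_DirProd is_group)
      also have "\<dots> = (\<Sum>h\<in>carrier H. \<Sum>k\<in>carrier H. \<omega> v u / ?N^2 * (\<omega> u k * \<omega> v (inv h)))"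
        by (intro sum.cong refl) (simp add: exponent)
      also have "\<dots> = \<omega> v u / ?N^2 * ((\<Sum>k\<in>carrier H. \<omega> u k) * (\<Sum>h\<in>carrier H. \<omega> v (inv h)))"
        unfolding sum_product unfolding sum_distrib_left by (subst sum.swap) (rule refl)
      also have "(\<Sum>h\<in>carrier H. \<omega> v (inv h)) = (\<Sum>h\<in>carrier H. \<omega> v h)"
        by (rule sum.reindex_bij_witness[of _ "\<lambda>h. inv h" "\<lambda>h. inv h"]) auto
      finally show ?thesis
        using u v order_nonzero
        by (auto simp: \<omega>_orthogonality p bvec_def \<omega>_one power2_eq_square)
    next
      case False
      then show ?thesis
        using H2.mult_in_vecs[of "J_of H B" "flip (J_of H B)"] H2.one_closed
        by (cases p) (auto simp: vecs_def bvec_def)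
    qed
  qed
  then have "flip (J_of H B) = inv\<^bsub>?A2\<^esub> (J_of H B)"
    using vecs H2.alg.Units_r_inv[OF assms]
      H2.alg.inv_unique[of "inv\<^bsub>?A2\<^esub> (J_of H B)" "J_of H B" "flip (J_of H B)"]
      H2.alg.Units_l_inv[OF assms] H2.alg.Units_inv_closed[OF assms]
    by simp
  then show ?thesis using H2.alg.Units_inv_inv[OF assms] by simp
qed

locale symplectic_action = group_action G H \<phi> + H: symplectic_group H B
  for G :: "'a list monoid" and H :: "'a monoid" and \<phi> and B +
  assumes J_twist: "is_twist (group_algebra H) (J_of H B)"
    and J_invariant: "invariant (J_of H B)"
begin

abbreviation J where "J \<equiv> J_of H B"

lemma J_vecs: "J \<in> vecs (carrier (H \<times>\<times> H))"
  by (auto simp: vecs_def H.J_of_eq carrier_DirProd)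

lemma twist_product_apply:
  assumes "K \<in> vecs (carrier (G \<times>\<times> G))"
  shows "twist_product J K (h # a, k # b) = J (h, k) * K (a, b)"
proof -
  interpret S2: fin_group "S \<times>\<times> S" by (intro fin_group_DirProd S.fin_group_axioms)
  have fin: "finite (carrier (H \<times>\<times> H))" "finite (carrier (G \<times>\<times> G))" by (auto simp: carrier_DirProd)
  have maps: "map_prod \<kappa> \<kappa> \<in> carrier (H \<times>\<times> H) \<rightarrow> carrier (S \<times>\<times> S)"
    "map_prod \<iota> \<iota> \<in> carrier (G \<times>\<times> G) \<rightarrow> carrier (S \<times>\<times> S)"
    by (auto simp: carrier_DirProd)
  have "twist_product J K (h # a, k # b) =
    ev (carrier (S \<times>\<times> S)) (twist_product J K) (\<lambda>w. bvec w (h # a, k # b))"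
    by (rule ev_test_bvec[symmetric]) (auto simp: twist_product_def S2.mult_in_vecs)
  also have "\<dots> = ev (carrier (H \<times>\<times> H)) J (\<lambda>p. bvec p (h, k) * ev (carrier (G \<times>\<times> G)) K (\<lambda>q. bvec q (a, b)))"
    unfolding twist_product_def S2.ev_mult ev_push[OF fin(1) S2.fin maps(1)] ev_push[OF fin(2) S2.fin maps(2)]
      ev_mult_left[symmetric]
    by (auto intro!: ev_cong simp: carrier_DirProd \<kappa>_\<iota> simp del: semidirect_simps) (auto simp: bvec_def)
  also have "\<dots> = J (h, k) * K (a, b)"
    using fin assms J_vecs by (simp add: ev_mult_right ev_test_bvec)
  finally show ?thesis .
qed

lemma inv_embedded: 
  assumes "a \<in> carrier G" "h \<in> carrier H" "g \<in> carrier G" "u \<in> carrier H"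
  shows "inv\<^bsub>S\<^esub> (\<iota> a \<otimes>\<^bsub>S\<^esub> \<kappa> h) \<otimes>\<^bsub>S\<^esub> (u # g) =
    (inv\<^bsub>H\<^esub> h \<otimes>\<^bsub>H\<^esub> \<phi> (inv\<^bsub>G\<^esub> a) u) # (inv\<^bsub>G\<^esub> a \<otimes>\<^bsub>G\<^esub> g)"
proof -
  have "inv\<^bsub>S\<^esub> (\<iota> a \<otimes>\<^bsub>S\<^esub> \<kappa> h) = inv\<^bsub>H\<^esub> h # inv\<^bsub>G\<^esub> a"
    using assms by (intro S.inv_equality) (auto simp: \<iota>_def \<kappa>_def)
  then show ?thesis using assms by simp
qed

lemma \<omega>_invariant:
  assumes g: "g \<in> carrier G" and x: "x \<in> carrier H" and y: "y \<in> carrier H"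
  shows "H.\<omega> (\<phi> g x) (\<phi> g y) = H.\<omega> x y"
proof -
  have "inj_on (\<phi> g) (carrier H)"
    by (rule inj_on_inverseI[of _ "\<phi> (inv\<^bsub>G\<^esub> g)"]) (use g in simp)
  then have "inj_on (map_prod (\<phi> g) (\<phi> g)) (carrier (H \<times>\<times> H))"
    by (simp add: carrier_DirProd map_prod_inj_on)
  then have "push (map_prod (\<phi> g) (\<phi> g)) (carrier (H \<times>\<times> H)) J (map_prod (\<phi> g) (\<phi> g) (x, y)) = J (x, y)"
    using x y by (intro push_inj_apply) (auto simp: carrier_DirProd)
  then have "J (\<phi> g x, \<phi> g y) = J (x, y)"
    using J_invariant g by (simp add: invariant_def)
  then show ?thesis using g x y H.order_nonzero by (simp add: H.J_of_eq)
qed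

lemma gsqrt_action: "g \<in> carrier G \<Longrightarrow> x \<in> carrier H \<Longrightarrow> gsqrt H (\<phi> g x) = \<phi> g (gsqrt H x)"
  by (rule H.gsqrt_hom) (rule action_in_hom)

text \<open>
  The extension of the square root \<sigma> to the semidirect product. On words \<open>x\<^sub>n \<cdots> x\<^sub>1\<close>, iterating it gives
  \<open>x\<^sub>n\<^sup>1\<^sup>/\<^sup>2 \<cdots> x\<^sub>1\<^sup>1\<^sup>/\<^sup>2\<close>, which is in general not a square root in the group.
\<close>

definition sqrt_ext :: "('a list \<Rightarrow> 'a list) \<Rightarrow> 'a list \<Rightarrow> 'a list" where
  "sqrt_ext \<sigma> u = gsqrt H (hd u) # \<sigma> (tl u)"

definition coeff_ext ::
    "('a list \<Rightarrow> 'a list) \<Rightarrow> ('a list \<Rightarrow> 'a list \<Rightarrow> complex) \<Rightarrow> 'a list \<Rightarrow> 'a list \<Rightarrow> complex" where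
  "coeff_ext \<sigma> r u v = r (tl u) (tl v) *
     (H.\<omega> (\<phi> (inv\<^bsub>G\<^esub> (\<sigma> (tl u))) (hd u)) (\<phi> (inv\<^bsub>G\<^esub> (\<sigma> (tl v))) (gsqrt H (hd v))) /
      of_nat (order H))"

text \<open>
  The flip preserves the order of the factors J and K and inversion reverses it, so the factor from G
  comes first; the factor from H is again J by \<open>inv_flip_J_of\<close>.
\<close>

lemma inv_flip_twist_product:
  assumes K: "K \<in> Units (group_algebra (G \<times>\<times> G))"
  shows "inv\<^bsub>group_algebra (S \<times>\<times> S)\<^esub> (flip (twist_product J K)) =
     push (map_prod \<iota> \<iota>) (carrier (G \<times>\<times> G)) (inv\<^bsub>group_algebra (G \<times>\<times> G)\<^esub> (flip K))
       \<otimes>\<^bsub>group_algebra (S \<times>\<times> S)\<^esub> push (map_prod \<kappa> \<kappa>) (carrier (H \<times>\<times> H)) J"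
proof -
  let ?sw = "\<lambda>p. (snd p, fst p)"
  have fgG: "fin_group (G \<times>\<times> G)" and fgH: "fin_group (H \<times>\<times> H)" and fgS: "fin_group (S \<times>\<times> S)"
    by (intro fin_group_DirProd G.fin_group_axioms H.fin_group_axioms S.fin_group_axioms)+
  interpret G2: fin_group "G \<times>\<times> G" by (rule fgG)
  interpret H2: fin_group "H \<times>\<times> H" by (rule fgH)
  interpret S2: fin_group "S \<times>\<times> S" by (rule fgS)
  have swG: "?sw \<in> hom (G \<times>\<times> G) (G \<times>\<times> G)" and swH: "?sw \<in> hom (H \<times>\<times> H) (H \<times>\<times> H)"
    and swS: "?sw \<in> hom (S \<times>\<times> S) (S \<times>\<times> S)"
    by (auto simp: hom_def DirProd_def)
  have \<iota>: "map_prod \<iota> \<iota> \<in> hom (G \<times>\<times> G) (S \<times>\<times> S)" and \<kappa>: "map_prod \<kappa> \<kappa> \<in> hom (H \<times>\<times> H) (S \<times>\<times> S)"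
    by (intro map_prod_hom \<iota>_hom \<kappa>_hom)+
  have J: "J \<in> Units (group_algebra (H \<times>\<times> H))" using J_twist by (simp add: H.is_twist_iff)
  have Kv: "K \<in> vecs (carrier (G \<times>\<times> G))" using K by (simp add: Units_def)
  have funs: "?sw \<in> carrier (G \<times>\<times> G) \<rightarrow> carrier (G \<times>\<times> G)" "?sw \<in> carrier (H \<times>\<times> H) \<rightarrow> carrier (H \<times>\<times> H)"
    "?sw \<in> carrier (S \<times>\<times> S) \<rightarrow> carrier (S \<times>\<times> S)"
    "map_prod \<iota> \<iota> \<in> carrier (G \<times>\<times> G) \<rightarrow> carrier (S \<times>\<times> S)"
    "map_prod \<kappa> \<kappa> \<in> carrier (H \<times>\<times> H) \<rightarrow> carrier (S \<times>\<times> S)"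
    using swG swH swS \<iota> \<kappa> by (auto simp only: hom_def)
  have fK: "flip K = push ?sw (carrier (G \<times>\<times> G)) K" and fJ: "flip J = push ?sw (carrier (H \<times>\<times> H)) J"
    by (intro G.flip_push Kv H.flip_push J_vecs)+
  have KU: "flip K \<in> Units (group_algebra (G \<times>\<times> G))" and JU: "flip J \<in> Units (group_algebra (H \<times>\<times> H))"
    unfolding fK fJ by (intro G2.push_inverse H2.push_inverse fgG fgH swG swH K J)+
  have "flip (twist_product J K) = push ?sw (carrier (S \<times>\<times> S)) (twist_product J K)"
    by (intro S.flip_push) (simp add: twist_product_def S2.mult_in_vecs)
  also have "\<dots> = push (map_prod \<kappa> \<kappa>) (carrier (H \<times>\<times> H)) (flip J) \<otimes>\<^bsub>group_algebra (S \<times>\<times> S)\<^esub>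
      push (map_prod \<iota> \<iota>) (carrier (G \<times>\<times> G)) (flip K)"
    unfolding twist_product_def S2.push_mult[OF fgS swS] fK fJ
      push_push[OF H2.fin S2.fin S2.fin funs(5) funs(3)] push_push[OF G2.fin S2.fin S2.fin funs(4) funs(3)]
      push_push[OF H2.fin H2.fin S2.fin funs(2) funs(5)] push_push[OF G2.fin G2.fin S2.fin funs(1) funs(4)]
    by (simp add: map_prod_def case_prod_unfold)
  finally show ?thesis
    using S2.alg.inv_mult_Units[OF H2.push_inverse(1)[OF fgS \<kappa> JU] G2.push_inverse(1)[OF fgS \<iota> KU]]
    by (simp only: H2.push_inverse(2)[OF fgS \<kappa> JU] G2.push_inverse(2)[OF fgS \<iota> KU] H.inv_flip_J_of[OF J])
qed

text \<open>
  Since \<open>K\<^sub>2\<^sub>1\<inverse>\<close> stands to the left of \<open>J\<^sub>2\<^sub>1\<inverse> = J\<close>, the sum runs over products \<iota>(a)\<kappa>(h) and \<iota>(b)\<kappa>(k). The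
  inner sum over h and k is the one of \<open>J_of_convolution\<close>, with arguments \<phi>(\<open>a\<inverse>\<close>)u and \<phi>(\<open>b\<inverse>\<close>)v. Its value, as
  a function F of (a, b), is again invariant under simultaneous right translation, because moving c from a
  to the arguments is compensated by the invariance of the form. So the hypothesis on K applies with
  weight F, and evaluates a and b at \<sigma>(g) and \<sigma>(g').
\<close>

lemma collapses_twist_product:
  assumes K: "K \<in> Units (group_algebra (G \<times>\<times> G))" and IH: "collapses G K \<sigma> r"
    and \<sigma>: "\<And>g. g \<in> carrier G \<Longrightarrow> \<sigma> g \<in> carrier G"
  shows "collapses S (twist_product J K) (sqrt_ext \<sigma>) (coeff_ext \<sigma> r)"
  unfolding collapses_def
proof (intro allI impI ballI)
  fix f :: "'a list \<Rightarrow> 'a list \<Rightarrow> complex" and w w'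
  assume "\<forall>a\<in>carrier S. \<forall>b\<in>carrier S. \<forall>c\<in>carrier S. f (a \<otimes>\<^bsub>S\<^esub> c) (b \<otimes>\<^bsub>S\<^esub> c) = f a b"
  then have f: "f (a \<otimes>\<^bsub>S\<^esub> c) (b \<otimes>\<^bsub>S\<^esub> c) = f a b" if "a \<in> carrier S" "b \<in> carrier S" "c \<in> carrier S" for a b c
    using that by blast
  assume "w \<in> carrier S" "w' \<in> carrier S"
  then obtain u g v g' where w: "w = u # g" "w' = v # g'"
    and u: "u \<in> carrier H" and g: "g \<in> carrier G" and v: "v \<in> carrier H" and g': "g' \<in> carrier G"
    by (metis semidirect_carrierE)
  have Kv: "K \<in> vecs (carrier (G \<times>\<times> G))" using K by (simp add: Units_def)
  interpret S2: fin_group "S \<times>\<times> S" by (intro fin_group_DirProd S.fin_group_axioms)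
  have fin: "finite (carrier (H \<times>\<times> H))" "finite (carrier (G \<times>\<times> G))" by (auto simp: carrier_DirProd)
  have maps: "map_prod \<kappa> \<kappa> \<in> carrier (H \<times>\<times> H) \<rightarrow> carrier (S \<times>\<times> S)"
    "map_prod \<iota> \<iota> \<in> carrier (G \<times>\<times> G) \<rightarrow> carrier (S \<times>\<times> S)"
    by (auto simp: carrier_DirProd)
  let ?Ki = "inv\<^bsub>group_algebra (G \<times>\<times> G)\<^esub> (flip K)"
  let ?x = "\<lambda>a. \<phi> (inv\<^bsub>G\<^esub> a) u" and ?y = "\<lambda>b. \<phi> (inv\<^bsub>G\<^esub> b) v"
  define F where "F a b = H.\<omega> (?x a) (gsqrt H (?y b)) / of_nat (order H) *
     f (\<iota> a \<otimes>\<^bsub>S\<^esub> \<kappa> (gsqrt H (?x a))) (\<iota> b \<otimes>\<^bsub>S\<^esub> \<kappa> (gsqrt H (?y b)))" for a b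
  have "ev (carrier (S \<times>\<times> S)) (inv\<^bsub>group_algebra (S \<times>\<times> S)\<^esub> (flip (twist_product J K)))
      (\<lambda>(a, b). twist_product J K (inv\<^bsub>S\<^esub> a \<otimes>\<^bsub>S\<^esub> w, inv\<^bsub>S\<^esub> b \<otimes>\<^bsub>S\<^esub> w') * f a b) =
    ev (carrier (G \<times>\<times> G)) ?Ki (\<lambda>(a, b). ev (carrier (H \<times>\<times> H)) J (\<lambda>(h, k).
      twist_product J K (inv\<^bsub>S\<^esub> (\<iota> a \<otimes>\<^bsub>S\<^esub> \<kappa> h) \<otimes>\<^bsub>S\<^esub> w, inv\<^bsub>S\<^esub> (\<iota> b \<otimes>\<^bsub>S\<^esub> \<kappa> k) \<otimes>\<^bsub>S\<^esub> w') *
       f (\<iota> a \<otimes>\<^bsub>S\<^esub> \<kappa> h) (\<iota> b \<otimes>\<^bsub>S\<^esub> \<kappa> k)))"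
    unfolding inv_flip_twist_product[OF K] S2.ev_mult ev_push[OF fin(1) S2.fin maps(1)] ev_push[OF fin(2) S2.fin maps(2)]
    by (simp add: case_prod_unfold mult_DirProd' del: semidirect_simps)
  also have "\<dots> = ev (carrier (G \<times>\<times> G)) ?Ki (\<lambda>(a, b). ev (carrier (H \<times>\<times> H)) J (\<lambda>(h, k).
      J (inv\<^bsub>H\<^esub> h \<otimes>\<^bsub>H\<^esub> ?x a, inv\<^bsub>H\<^esub> k \<otimes>\<^bsub>H\<^esub> ?y b) * f (\<iota> a \<otimes>\<^bsub>S\<^esub> \<kappa> h) (\<iota> b \<otimes>\<^bsub>S\<^esub> \<kappa> k) *
      K (inv\<^bsub>G\<^esub> a \<otimes>\<^bsub>G\<^esub> g, inv\<^bsub>G\<^esub> b \<otimes>\<^bsub>G\<^esub> g')))"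
    using u v g g'
    by (auto intro!: ev_cong simp: carrier_DirProd w inv_embedded twist_product_apply[OF Kv]
        simp del: semidirect_simps)
  also have "\<dots> = ev (carrier (G \<times>\<times> G)) ?Ki (\<lambda>(a, b). K (inv\<^bsub>G\<^esub> a \<otimes>\<^bsub>G\<^esub> g, inv\<^bsub>G\<^esub> b \<otimes>\<^bsub>G\<^esub> g') * F a b)"
  proof (rule ev_cong[OF refl], clarsimp simp: carrier_DirProd simp del: semidirect_simps)
    fix a b assume a: "a \<in> carrier G" and b: "b \<in> carrier G"
    have "ev (carrier (H \<times>\<times> H)) J (\<lambda>(h, k).
      J (inv\<^bsub>H\<^esub> h \<otimes>\<^bsub>H\<^esub> ?x a, inv\<^bsub>H\<^esub> k \<otimes>\<^bsub>H\<^esub> ?y b) * f (\<iota> a \<otimes>\<^bsub>S\<^esub> \<kappa> h) (\<iota> b \<otimes>\<^bsub>S\<^esub> \<kappa> k)) = F a b"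
      unfolding F_def
    proof (rule H.J_of_convolution)
      fix h k c assume "h \<in> carrier H" "k \<in> carrier H" "c \<in> carrier H"
      then show "f (\<iota> a \<otimes>\<^bsub>S\<^esub> \<kappa> (h \<otimes>\<^bsub>H\<^esub> c)) (\<iota> b \<otimes>\<^bsub>S\<^esub> \<kappa> (k \<otimes>\<^bsub>H\<^esub> c)) = f (\<iota> a \<otimes>\<^bsub>S\<^esub> \<kappa> h) (\<iota> b \<otimes>\<^bsub>S\<^esub> \<kappa> k)"
        using a b f[of "\<iota> a \<otimes>\<^bsub>S\<^esub> \<kappa> h" "\<iota> b \<otimes>\<^bsub>S\<^esub> \<kappa> k" "\<kappa> c"]
        by (simp add: hom_mult[OF \<kappa>_hom] S.m_assoc del: semidirect_simps)
    qed (use a b u v in auto)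
    then show "ev (carrier H \<times> carrier H) J (\<lambda>(h, k).
      J (inv\<^bsub>H\<^esub> h \<otimes>\<^bsub>H\<^esub> ?x a, inv\<^bsub>H\<^esub> k \<otimes>\<^bsub>H\<^esub> ?y b) * f (\<iota> a \<otimes>\<^bsub>S\<^esub> \<kappa> h) (\<iota> b \<otimes>\<^bsub>S\<^esub> \<kappa> k) *
      K (inv\<^bsub>G\<^esub> a \<otimes>\<^bsub>G\<^esub> g, inv\<^bsub>G\<^esub> b \<otimes>\<^bsub>G\<^esub> g')) = K (inv\<^bsub>G\<^esub> a \<otimes>\<^bsub>G\<^esub> g, inv\<^bsub>G\<^esub> b \<otimes>\<^bsub>G\<^esub> g') * F a b"
      by (simp add: case_prod_unfold ev_mult_right carrier_DirProd)
  qed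
  also have "\<dots> = r g g' * F (\<sigma> g) (\<sigma> g')"
  proof -
    have "F (a \<otimes>\<^bsub>G\<^esub> c) (b \<otimes>\<^bsub>G\<^esub> c) = F a b" if a: "a \<in> carrier G" and b: "b \<in> carrier G" and c: "c \<in> carrier G" for a b c
    proof -
      have x: "\<phi> (inv\<^bsub>G\<^esub> (d \<otimes>\<^bsub>G\<^esub> c)) z = \<phi> (inv\<^bsub>G\<^esub> c) (\<phi> (inv\<^bsub>G\<^esub> d) z)" if "d \<in> carrier G" "z \<in> carrier H" for d z
        using that c by (simp add: G.inv_mult_group action_action)
      have shift: "\<iota> (d \<otimes>\<^bsub>G\<^esub> c) \<otimes>\<^bsub>S\<^esub> \<kappa> (\<phi> (inv\<^bsub>G\<^esub> c) z) = (\<iota> d \<otimes>\<^bsub>S\<^esub> \<kappa> z) \<otimes>\<^bsub>S\<^esub> \<iota> c"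
        if "d \<in> carrier G" "z \<in> carrier H" for d z
        using that c \<iota>_\<kappa>[of c "\<phi> (inv\<^bsub>G\<^esub> c) z"]
        by (simp add: hom_mult[OF \<iota>_hom] S.m_assoc del: semidirect_simps)
      show ?thesis
        unfolding F_def x[OF a u] x[OF b v]
        using a b c u v by (simp add: gsqrt_action \<omega>_invariant shift f del: semidirect_simps)
    qed
    then show ?thesis using IH g g' unfolding collapses_def by blast
  qed
  also have "\<dots> = coeff_ext \<sigma> r w w' * f (sqrt_ext \<sigma> w) (sqrt_ext \<sigma> w')"
  proof -
    have "\<iota> (\<sigma> c) \<otimes>\<^bsub>S\<^esub> \<kappa> (\<phi> (inv\<^bsub>G\<^esub> (\<sigma> c)) z) = z # \<sigma> c" if "c \<in> carrier G" "z \<in> carrier H" for c z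
      using that \<sigma>[of c] by (simp add: \<iota>_\<kappa> \<kappa>_\<iota> del: semidirect_simps)
    then show ?thesis
      using u v g g' \<sigma>[OF g] \<sigma>[OF g']
      by (simp add: F_def coeff_ext_def sqrt_ext_def w gsqrt_action del: semidirect_simps)
  qed
  finally show "ev (carrier (S \<times>\<times> S)) (inv\<^bsub>group_algebra (S \<times>\<times> S)\<^esub> (flip (twist_product J K)))
      (\<lambda>(a, b). twist_product J K (inv\<^bsub>S\<^esub> a \<otimes>\<^bsub>S\<^esub> w, inv\<^bsub>S\<^esub> b \<otimes>\<^bsub>S\<^esub> w') * f a b) =
      coeff_ext \<sigma> r w w' * f (sqrt_ext \<sigma> w) (sqrt_ext \<sigma> w')" .
qed

lemma sum_semidirect: "(\<Sum>w\<in>carrier S. F w) = (\<Sum>g\<in>carrier G. \<Sum>h\<in>carrier H. F (h # g))"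
proof -
  have "(\<Sum>w\<in>carrier S. F w) = (\<Sum>p\<in>carrier H \<times> carrier G. F (fst p # snd p))"
    unfolding carrier_semidirect_eq by (subst sum.reindex) (auto simp: inj_on_def case_prod_unfold)
  also have "\<dots> = (\<Sum>h\<in>carrier H. \<Sum>g\<in>carrier G. F (h # g))"
    by (simp add: sum.cartesian_product case_prod_unfold)
  also have "\<dots> = (\<Sum>g\<in>carrier G. \<Sum>h\<in>carrier H. F (h # g))" by (rule sum.swap)
  finally show ?thesis .
qed

lemma order_semidirect: "order S = order H * order G"
  unfolding order_def carrier_semidirect_eq
  by (subst card_image) (auto simp: inj_on_def card_cartesian_product)

text \<open>
  Summing first over the H-component, a character sum forces the H-components of the two rows to be
  equal after untwisting; summing then over G forces equality of the G-components, which makes the two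
  untwistings the same.
\<close>

lemma hadamard_coeff_ext:
  assumes r: "hadamard G r" and \<sigma>: "\<And>g. g \<in> carrier G \<Longrightarrow> \<sigma> g \<in> carrier G"
  shows "hadamard S (coeff_ext \<sigma> r)"
  unfolding hadamard_def
proof (intro conjI ballI)
  have r0: "r x y \<noteq> 0" if "x \<in> carrier G" "y \<in> carrier G" for x y
    using r that by (simp add: hadamard_def)
  show "coeff_ext \<sigma> r w w' \<noteq> 0" if "w \<in> carrier S" "w' \<in> carrier S" for w w'
    using that \<sigma> r0 H.order_nonzero by (auto elim!: semidirect_carrierE simp: coeff_ext_def)
  fix w w' assume "w \<in> carrier S" "w' \<in> carrier S"
  then obtain u g v g' where w: "w = u # g" "w' = v # g'"
    and u: "u \<in> carrier H" and g: "g \<in> carrier G" and v: "v \<in> carrier H" and g': "g' \<in> carrier G"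
    by (metis semidirect_carrierE)
  let ?x = "\<phi> (inv\<^bsub>G\<^esub> (\<sigma> g)) u" and ?y = "\<phi> (inv\<^bsub>G\<^esub> (\<sigma> g')) v"
  have xy: "?x \<in> carrier H" "?y \<in> carrier H" using u v g g' \<sigma> by auto
  have "(\<Sum>y\<in>carrier S. coeff_ext \<sigma> r w y / coeff_ext \<sigma> r w' y) =
    (\<Sum>b\<in>carrier G. \<Sum>k\<in>carrier H. r g b / r g' b * H.\<omega> (?x \<otimes>\<^bsub>H\<^esub> inv\<^bsub>H\<^esub> ?y) (\<phi> (inv\<^bsub>G\<^esub> (\<sigma> b)) (gsqrt H k)))"
    unfolding sum_semidirect
    using xy \<sigma> H.order_nonzero
    by (intro sum.cong refl) (simp add: coeff_ext_def w H.\<omega>_mult_left H.\<omega>_inv divide_simps)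
  also have "\<dots> = (\<Sum>b\<in>carrier G. \<Sum>k\<in>carrier H. r g b / r g' b * H.\<omega> (?x \<otimes>\<^bsub>H\<^esub> inv\<^bsub>H\<^esub> ?y) k)"
  proof (rule sum.cong[OF refl])
    fix b assume b: "b \<in> carrier G"
    show "(\<Sum>k\<in>carrier H. r g b / r g' b * H.\<omega> (?x \<otimes>\<^bsub>H\<^esub> inv\<^bsub>H\<^esub> ?y) (\<phi> (inv\<^bsub>G\<^esub> (\<sigma> b)) (gsqrt H k))) =
      (\<Sum>k\<in>carrier H. r g b / r g' b * H.\<omega> (?x \<otimes>\<^bsub>H\<^esub> inv\<^bsub>H\<^esub> ?y) k)"
      by (rule sum.reindex_bij_witness[of _ "\<lambda>k. \<phi> (\<sigma> b) (k \<otimes>\<^bsub>H\<^esub> k)" "\<lambda>k. \<phi> (inv\<^bsub>G\<^esub> (\<sigma> b)) (gsqrt H k)"])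
         (use \<sigma>[OF b] in \<open>auto simp: action_mult[symmetric] H.gsqrt_square gsqrt_action H.gsqrt_eqI\<close>)
  qed
  also have "\<dots> = (\<Sum>b\<in>carrier G. r g b / r g' b) * (\<Sum>k\<in>carrier H. H.\<omega> (?x \<otimes>\<^bsub>H\<^esub> inv\<^bsub>H\<^esub> ?y) k)"
    by (simp add: sum_product)
  also have "(\<Sum>b\<in>carrier G. r g b / r g' b) = (if g = g' then of_nat (order G) else 0)"
    using r g g' by (simp add: hadamard_def)
  also have "\<dots> * (\<Sum>k\<in>carrier H. H.\<omega> (?x \<otimes>\<^bsub>H\<^esub> inv\<^bsub>H\<^esub> ?y) k) = (if w = w' then of_nat (order S) else 0)"
  proof (cases "g = g'")
    case True
    have "?x \<otimes>\<^bsub>H\<^esub> inv\<^bsub>H\<^esub> ?y = \<one>\<^bsub>H\<^esub> \<longleftrightarrow> ?x = ?y"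
      using xy by (metis H.inv_solve_right' H.l_one H.one_closed)
    also have "\<dots> \<longleftrightarrow> u = v"
      using True u v \<sigma>[OF g] by (metis action_inverse(2))
    finally show ?thesis
      using True xy by (simp add: H.\<omega>_orthogonality order_semidirect w)
  next
    case False
    then show ?thesis by (simp add: w)
  qed
  finally show "(\<Sum>y\<in>carrier S. coeff_ext \<sigma> r w y / coeff_ext \<sigma> r w' y) = (if w = w' then of_nat (order S) else 0)" .
qed

end

section \<open>Symplectic hierarchies\<close>

lemma desc_prod_cong:
  "(\<And>j. j \<in> {1..k} \<Longrightarrow> f j = g j) \<Longrightarrow> desc_prod M f k = desc_prod M g k"
  by (induction k) auto

lemma desc_prod_closed:
  "Group.monoid M \<Longrightarrow> (\<And>j. j \<in> {1..k} \<Longrightarrow> e j \<in> carrier M) \<Longrightarrow> desc_prod M e k \<in> carrier M"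
  by (induction k) (auto simp: Group.monoid.m_closed Group.monoid.one_closed)

lemma hom_desc_prod:
  assumes "Group.monoid M" "f \<in> hom M N" "f \<one>\<^bsub>M\<^esub> = \<one>\<^bsub>N\<^esub>" "\<And>j. j \<in> {1..k} \<Longrightarrow> e j \<in> carrier M"
  shows "f (desc_prod M e k) = desc_prod N (\<lambda>j. f (e j)) k"
  using assms(4)
proof (induction k)
  case (Suc k)
  have "desc_prod M e k \<in> carrier M" by (intro desc_prod_closed assms(1) Suc.prems) auto
  with Suc show ?case by (simp add: hom_mult[OF assms(2)])
qed (simp add: assms(3))

primrec hsqrt :: "(nat \<Rightarrow> 'a monoid) \<Rightarrow> nat \<Rightarrow> 'a list \<Rightarrow> 'a list" where
  "hsqrt H 0 u = []"
| "hsqrt H (Suc m) u = gsqrt (H (Suc m)) (hd u) # hsqrt H m (tl u)"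

text \<open>
  The coefficient of the R-matrix at two elements of \<open>G\<^sub>m\<close>, including the factor \<open>|G\<^sub>m|\<inverse>\<close>. Starting at
  the trivial group \<open>G\<^sub>0\<close>, each step is an instance of \<open>coeff_ext\<close>.
\<close>

primrec hcoeff ::
    "(nat \<Rightarrow> 'a monoid) \<Rightarrow> (nat \<Rightarrow> 'a list \<Rightarrow> 'a \<Rightarrow> 'a) \<Rightarrow> (nat \<Rightarrow> 'a \<Rightarrow> 'a \<Rightarrow> complex) \<Rightarrow> nat \<Rightarrow>
     'a list \<Rightarrow> 'a list \<Rightarrow> complex" where
  "hcoeff H \<rho> B 0 u v = 1"
| "hcoeff H \<rho> B (Suc m) u v = hcoeff H \<rho> B m (tl u) (tl v) *
     (B (Suc m)
        (action H \<rho> m (inv\<^bsub>hgroup H \<rho> m\<^esub> (hsqrt H m (tl v))) (gsqrt (H (Suc m)) (hd v)))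
        (action H \<rho> m (inv\<^bsub>hgroup H \<rho> m\<^esub> (hsqrt H m (tl u))) (hd u)) /
      of_nat (order (H (Suc m))))"

locale hierarchical_twist =
  fixes n :: nat
    and H :: "nat \<Rightarrow> 'a monoid"
    and \<rho> :: "nat \<Rightarrow> 'a list \<Rightarrow> 'a \<Rightarrow> 'a"
    and J :: "nat \<Rightarrow> 'a \<times> 'a \<Rightarrow> complex"
    and B :: "nat \<Rightarrow> 'a \<Rightarrow> 'a \<Rightarrow> complex"
  assumes symplectic_hierarchy: "symplectic_hierarchy n H \<rho> J B"
begin

abbreviation \<G> where "\<G> \<equiv> hgroup H \<rho>"

lemma symplectic_group:
  assumes "m < n"
  shows "symplectic_group (H (Suc m)) (B (Suc m))"
proof -
  have "Suc m \<in> {1..n}" using assms by simp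
  then show ?thesis
    using symplectic_hierarchy
    unfolding symplectic_hierarchy_def twist_hierarchy_def hierarchy_def symplectic_group_def
      symplectic_group_axioms_def fin_group_def fin_group_axioms_def
    by blast
qed

lemma J_eq: "m < n \<Longrightarrow> J (Suc m) = J_of (H (Suc m)) (B (Suc m))"
  using symplectic_hierarchy by (auto simp: symplectic_hierarchy_def)

lemma J_is_twist: "m < n \<Longrightarrow> is_twist (group_algebra (H (Suc m))) (J (Suc m))"
  using symplectic_hierarchy by (auto simp: symplectic_hierarchy_def twist_hierarchy_def)

lemma fin_group_0: "fin_group (\<G> 0)"
  by (auto simp: fin_group_def fin_group_axioms_def intro!: groupI)

lemma action_hom:
  assumes "m < n"
  shows "action H \<rho> m \<in> hom (\<G> m) (AutoGroup (H (Suc m)))"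
proof (cases m)
  case 0
  interpret fin_group "\<G> 0" by (rule fin_group_0)
  interpret H: symplectic_group "H (Suc m)" "B (Suc m)" by (rule symplectic_group[OF assms])
  show ?thesis
    using hom_components(4)[OF H.AutoGroup] 0 by (simp add: action_def)
next
  case (Suc k)
  then have "Suc m \<in> {2..n}" using assms by auto
  then have "\<rho> (Suc m - 1) \<in> hom (\<G> (Suc m - 1)) (AutoGroup (H (Suc m)))"
    using symplectic_hierarchy
    unfolding symplectic_hierarchy_def twist_hierarchy_def hierarchy_def by blast
  then show ?thesis using Suc by (simp add: action_def)
qed

text \<open>
  At level 0 the acting group is trivial, so \<open>G\<^sub>1 = H\<^sub>1\<close> is treated like all later levels.
\<close>

lemma level:
  assumes "m < n" "fin_group (\<G> m)"
  shows "symplectic_action (\<G> m) (H (Suc m)) (action H \<rho> m) (B (Suc m))"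
proof -
  interpret H: symplectic_group "H (Suc m)" "B (Suc m)" by (rule symplectic_group[OF assms(1)])
  interpret group_action "\<G> m" "H (Suc m)" "action H \<rho> m"
    using assms action_hom[OF assms(1)] H.fin_group_axioms
    by (simp add: group_action_def group_action_axioms_def)
  have "invariant (J (Suc m))"
  proof (cases m)
    case 0
    have "J (Suc m) \<in> vecs (carrier (H (Suc m) \<times>\<times> H (Suc m)))"
      unfolding J_eq[OF assms(1)] by (auto simp: vecs_def H.J_of_eq carrier_DirProd)
    then have "push (map_prod (action H \<rho> m g) (action H \<rho> m g))
        (carrier (H (Suc m) \<times>\<times> H (Suc m))) (J (Suc m)) = J (Suc m)" for g
      using 0 H.fin by (intro push_id) (auto simp: carrier_DirProd action_def AutoGroup_def BijGroup_def)
    then show ?thesis by (simp add: invariant_def)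
  next
    case (Suc k)
    then have "Suc m \<in> {2..n}" using assms by auto
    then have "\<forall>g\<in>carrier (\<G> (Suc m - 1)). push (map_prod (\<rho> (Suc m - 1) g) (\<rho> (Suc m - 1) g))
        (carrier (H (Suc m)) \<times> carrier (H (Suc m))) (J (Suc m)) = J (Suc m)"
      using symplectic_hierarchy
      unfolding symplectic_hierarchy_def twist_hierarchy_def by blast
    moreover have "action H \<rho> m = \<rho> m" using Suc by (simp add: action_def)
    ultimately show ?thesis unfolding invariant_def carrier_DirProd by (simp only: diff_Suc_1)
  qed
  then show ?thesis
    using group_action_axioms H.symplectic_group_axioms J_is_twist[OF assms(1)]
    by (simp add: symplectic_action_def symplectic_action_axioms_def J_eq[OF assms(1)])
qed

lemma fin_group_hgroup: "m \<le> n \<Longrightarrow> fin_group (\<G> m)"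
proof (induction m)
  case (Suc m)
  then interpret symplectic_action "\<G> m" "H (Suc m)" "action H \<rho> m" "B (Suc m)"
    by (intro level) auto
  show ?case using S.fin_group_axioms by simp
qed (rule fin_group_0)

lemma symplectic_action: "m < n \<Longrightarrow> symplectic_action (\<G> m) (H (Suc m)) (action H \<rho> m) (B (Suc m))"
  by (intro level fin_group_hgroup) auto

lemma embed_closed: "m \<le> n \<Longrightarrow> j \<in> {1..m} \<Longrightarrow> x \<in> carrier (H j) \<Longrightarrow> embed H \<rho> m j x \<in> carrier (\<G> m)"
proof (induction m)
  case (Suc m)
  then interpret symplectic_action "\<G> m" "H (Suc m)" "action H \<rho> m" "B (Suc m)"
    by (intro symplectic_action) auto
  show ?case using Suc by (cases "j = Suc m") auto
qed simp

text \<open>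
  The factors \<open>J\<^sub>1, \<dots>, J\<^sub>m\<close> of the twist for \<open>G\<^sub>m\<^sub>+\<^sub>1\<close> are the images of those of the twist for \<open>G\<^sub>m\<close> under the
  inclusion \<iota>, which is compatible with products.
\<close>

lemma hierarchy_twist_Suc:
  assumes m: "m < n"
  shows "hierarchy_twist H \<rho> J (Suc m) =
    group_action.twist_product (\<G> m) (H (Suc m)) (action H \<rho> m) (J (Suc m)) (hierarchy_twist H \<rho> J m)"
proof -
  interpret symplectic_action "\<G> m" "H (Suc m)" "action H \<rho> m" "B (Suc m)"
    by (rule symplectic_action[OF m])
  have fgG: "fin_group (\<G> m \<times>\<times> \<G> m)" and fgS: "fin_group (S \<times>\<times> S)"
    by (intro fin_group_DirProd G.fin_group_axioms S.fin_group_axioms)+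
  interpret G2: fin_group "\<G> m \<times>\<times> \<G> m" by (rule fgG)
  interpret S2: fin_group "S \<times>\<times> S" by (rule fgS)
  let ?e = "\<lambda>k j. map_prod (embed H \<rho> k j) (embed H \<rho> k j)"
  let ?X = "\<lambda>j. carrier (H j) \<times> carrier (H j)"
  have \<iota>: "map_prod \<iota> \<iota> \<in> hom (\<G> m \<times>\<times> \<G> m) (S \<times>\<times> S)" by (intro map_prod_hom \<iota>_hom)
  then have \<iota>': "map_prod \<iota> \<iota> \<in> carrier (\<G> m \<times>\<times> \<G> m) \<rightarrow> carrier (S \<times>\<times> S)" by (auto simp only: hom_def)
  have closed: "?e m j \<in> ?X j \<rightarrow> carrier (\<G> m \<times>\<times> \<G> m)" if "j \<in> {1..m}" for j
    using embed_closed[OF _ that] m by (auto simp: carrier_DirProd)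
  have fin: "finite (?X j)" if "j \<in> {1..m}" for j
    using symplectic_group[of "j - 1"] that m
    by (auto simp: symplectic_group_def fin_group_def fin_group_axioms_def)
  have one: "push (map_prod \<iota> \<iota>) (carrier (\<G> m \<times>\<times> \<G> m)) (bvec \<one>\<^bsub>\<G> m \<times>\<times> \<G> m\<^esub>) = bvec \<one>\<^bsub>S \<times>\<times> S\<^esub>"
    by (rule G2.push_one[OF fgS \<iota>])
  have "push (map_prod \<iota> \<iota>) (carrier (\<G> m \<times>\<times> \<G> m)) (hierarchy_twist H \<rho> J m) =
    desc_prod (tensor2 (group_algebra S))
      (\<lambda>j. push (map_prod \<iota> \<iota>) (carrier (\<G> m \<times>\<times> \<G> m)) (push (?e m j) (?X j) (J j))) m"
    unfolding hierarchy_twist_def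
  proof (rule hom_desc_prod[where f = "push (map_prod \<iota> \<iota>) (carrier (\<G> m \<times>\<times> \<G> m))"])
    show "Group.monoid (tensor2 (group_algebra (\<G> m)))"
      using G2.monoid_group_algebra by (simp add: G.tensor2_group_algebra Group.monoid_def)
    show "push (map_prod \<iota> \<iota>) (carrier (\<G> m \<times>\<times> \<G> m)) \<in>
        hom (tensor2 (group_algebra (\<G> m))) (tensor2 (group_algebra S))"
      using G2.push_hom[OF fgS \<iota>] by (simp add: G.tensor2_group_algebra S.tensor2_group_algebra hom_def)
    show "push (map_prod \<iota> \<iota>) (carrier (\<G> m \<times>\<times> \<G> m)) \<one>\<^bsub>tensor2 (group_algebra (\<G> m))\<^esub> =
        \<one>\<^bsub>tensor2 (group_algebra S)\<^esub>"
      using one by (simp add: G.tensor2_group_algebra S.tensor2_group_algebra del: one_DirProd)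
    show "push (?e m j) (?X j) (J j) \<in> carrier (tensor2 (group_algebra (\<G> m)))" if "j \<in> {1..m}" for j
      using push_in_vecs[OF closed[OF that]] by (simp add: G.tensor2_group_algebra)
  qed
  also have "\<dots> = desc_prod (tensor2 (group_algebra S)) (\<lambda>j. push (?e (Suc m) j) (?X j) (J j)) m"
  proof (rule desc_prod_cong)
    fix j assume j: "j \<in> {1..m}"
    then have "push (map_prod \<iota> \<iota>) (carrier (\<G> m \<times>\<times> \<G> m)) (push (?e m j) (?X j) (J j)) =
      push (\<lambda>p. map_prod \<iota> \<iota> (?e m j p)) (?X j) (J j)"
      by (intro push_push[OF fin _ S2.fin closed \<iota>']) auto
    also have "\<dots> = push (?e (Suc m) j) (?X j) (J j)"
      using j by (intro push_cong) (auto simp: \<iota>_def)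
    finally show "push (map_prod \<iota> \<iota>) (carrier (\<G> m \<times>\<times> \<G> m)) (push (?e m j) (?X j) (J j)) = \<dots>" .
  qed
  moreover have "push (?e (Suc m) (Suc m)) (?X (Suc m)) (J (Suc m)) =
      push (map_prod \<kappa> \<kappa>) (carrier (H (Suc m) \<times>\<times> H (Suc m))) (J (Suc m))"
    unfolding carrier_DirProd by (intro push_cong) (auto simp: \<kappa>_def)
  ultimately show ?thesis
    unfolding hierarchy_twist_def[of H \<rho> J "Suc m"] desc_prod.simps twist_product_def
    by (simp add: S.tensor2_group_algebra)
qed

lemma hsqrt_Suc: "hsqrt H (Suc m) = symplectic_action.sqrt_ext (H (Suc m)) (hsqrt H m)"
  if "m < n"
proof -
  interpret symplectic_action "\<G> m" "H (Suc m)" "action H \<rho> m" "B (Suc m)"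
    by (rule symplectic_action[OF that])
  show ?thesis by (simp add: fun_eq_iff sqrt_ext_def)
qed

lemma hcoeff_Suc: "hcoeff H \<rho> B (Suc m) = symplectic_action.coeff_ext (\<G> m) (H (Suc m)) (action H \<rho> m)
    (B (Suc m)) (hsqrt H m) (hcoeff H \<rho> B m)"
  if "m < n"
proof -
  interpret symplectic_action "\<G> m" "H (Suc m)" "action H \<rho> m" "B (Suc m)"
    by (rule symplectic_action[OF that])
  show ?thesis by (simp add: fun_eq_iff coeff_ext_def H.\<omega>_def)
qed

lemma hsqrt_closed: "m \<le> n \<Longrightarrow> u \<in> carrier (\<G> m) \<Longrightarrow> hsqrt H m u \<in> carrier (\<G> m)"
proof (induction m arbitrary: u)
  case (Suc m)
  then interpret symplectic_action "\<G> m" "H (Suc m)" "action H \<rho> m" "B (Suc m)"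
    by (intro symplectic_action) auto
  have "u \<in> carrier S" using Suc.prems by simp
  then obtain h g where "u = h # g" "h \<in> carrier (H (Suc m))" "g \<in> carrier (\<G> m)"
    by (rule semidirect_carrierE)
  then show ?case using Suc by simp
qed simp

lemma is_twist_one: "fin_group G \<Longrightarrow> is_twist (group_algebra G) (bvec \<one>\<^bsub>G \<times>\<times> G\<^esub>)"
proof -
  assume "fin_group G"
  then interpret fin_group G .
  interpret G2: fin_group "G \<times>\<times> G" by (intro fin_group_DirProd fin_group_axioms)
  show ?thesis
    using G2.alg.Units_one_closed
    by (simp add: is_twist_iff push_bvec carrier_DirProd)
qed

lemma hierarchy_twist_0: "hierarchy_twist H \<rho> J 0 = bvec \<one>\<^bsub>\<G> 0 \<times>\<times> \<G> 0\<^esub>"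
  by (simp add: hierarchy_twist_def tensor_alg_def tens_bvec)

lemma is_twist_hierarchy_twist:
  "m \<le> n \<Longrightarrow> is_twist (group_algebra (\<G> m)) (hierarchy_twist H \<rho> J m)"
proof (induction m)
  case 0
  show ?case unfolding hierarchy_twist_0 by (rule is_twist_one[OF fin_group_0])
next
  case (Suc m)
  then interpret symplectic_action "\<G> m" "H (Suc m)" "action H \<rho> m" "B (Suc m)"
    by (intro symplectic_action) auto
  have m: "m < n" using Suc by simp
  show ?case
    unfolding hierarchy_twist_Suc[OF m] J_eq[OF m] hgroup.simps
    using Suc.IH m by (intro is_twist_twist_product J_twist J_invariant) simp
qed

lemma collapses_hierarchy_twist:
  "m \<le> n \<Longrightarrow> collapses (\<G> m) (hierarchy_twist H \<rho> J m) (hsqrt H m) (hcoeff H \<rho> B m)"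
proof (induction m)
  case 0
  interpret fin_group "\<G> 0" by (rule fin_group_0)
  interpret G2: fin_group "\<G> 0 \<times>\<times> \<G> 0" by (intro fin_group_DirProd fin_group_axioms)
  have "flip (hierarchy_twist H \<rho> J 0) = \<one>\<^bsub>group_algebra (\<G> 0 \<times>\<times> \<G> 0)\<^esub>"
    unfolding hierarchy_twist_0 by (auto simp: flip_def bvec_def fun_eq_iff)
  then have "inv\<^bsub>group_algebra (\<G> 0 \<times>\<times> \<G> 0)\<^esub> (flip (hierarchy_twist H \<rho> J 0)) = bvec ([], [])"
    by (simp only: G2.alg.inv_one) simp
  moreover have "inv\<^bsub>\<G> 0\<^esub> [] = []" using inv_one by simp
  ultimately show ?case
    unfolding collapses_def
    by (simp add: carrier_DirProd hierarchy_twist_0 bvec_def ev_def)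
next
  case (Suc m)
  then interpret symplectic_action "\<G> m" "H (Suc m)" "action H \<rho> m" "B (Suc m)"
    by (intro symplectic_action) auto
  have m: "m < n" using Suc by simp
  have "hierarchy_twist H \<rho> J m \<in> Units (group_algebra (\<G> m \<times>\<times> \<G> m))"
    using is_twist_hierarchy_twist[of m] m by (simp add: G.is_twist_iff)
  then show ?case
    unfolding hierarchy_twist_Suc[OF m] J_eq[OF m] hgroup.simps hsqrt_Suc[OF m] hcoeff_Suc[OF m]
    using Suc.IH m hsqrt_closed[of m] by (intro collapses_twist_product) simp_all
qed

lemma hadamard_hcoeff: "m \<le> n \<Longrightarrow> hadamard (\<G> m) (hcoeff H \<rho> B m)"
proof (induction m)
  case 0
  show ?case by (simp add: hadamard_def order_def)
next
  case (Suc m)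
  then interpret symplectic_action "\<G> m" "H (Suc m)" "action H \<rho> m" "B (Suc m)"
    by (intro symplectic_action) auto
  have m: "m < n" using Suc by simp
  show ?case
    unfolding hgroup.simps hcoeff_Suc[OF m]
    using Suc.IH m hsqrt_closed[of m] by (intro hadamard_coeff_ext) simp_all
qed

text \<open>
  The weight 1 in \<open>collapses\<close> gives the coefficients of the R-matrix.
\<close>

lemma twist_R_eq:
  assumes g: "g \<in> carrier (\<G> n)" and g': "g' \<in> carrier (\<G> n)"
  shows "twist_R (group_algebra (\<G> n)) (hierarchy_twist H \<rho> J n) (g, g') = hcoeff H \<rho> B n g g'"
proof -
  interpret group_twist "\<G> n" "hierarchy_twist H \<rho> J n"
    using fin_group_hgroup[of n] is_twist_hierarchy_twist[of n]
    by (simp add: group_twist_def group_twist_axioms_def)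
  have gg: "(g, g') \<in> carrier GG" using g g' by (simp add: carrier_DirProd)
  have "R (g, g') = ev (carrier GG) (inv\<^bsub>A2\<^esub> (flip (hierarchy_twist H \<rho> J n)))
     (\<lambda>(a, b). hierarchy_twist H \<rho> J n (inv\<^bsub>\<G> n\<^esub> a \<otimes>\<^bsub>\<G> n\<^esub> g, inv\<^bsub>\<G> n\<^esub> b \<otimes>\<^bsub>\<G> n\<^esub> g') * 1)"
    unfolding twist_R_def tensor2_group_algebra alg_truncate_simps G2.mult_apply[OF gg]
    by (auto intro!: ev_cong simp: carrier_DirProd inv_DirProd is_group)
  also have "\<dots> = hcoeff H \<rho> B n g g' * 1"
    using collapses_hierarchy_twist[OF order_refl, unfolded collapses_def, rule_format, of "\<lambda>_ _. 1"] g g'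
    by simp
  finally show ?thesis by simp
qed

lemma hword_closed:
  "m \<le> n \<Longrightarrow> (\<And>i. i \<in> {1..m} \<Longrightarrow> x i \<in> carrier (H i)) \<Longrightarrow> hword H \<rho> m x \<in> carrier (\<G> m)"
  unfolding hword_def using fin_group_hgroup[of m]
  by (intro desc_prod_closed embed_closed) (auto simp: fin_group_def Group.group_def)

lemma hword_Suc:
  assumes m: "m < n" and x: "\<And>i. i \<in> {1..Suc m} \<Longrightarrow> x i \<in> carrier (H i)"
  shows "hword H \<rho> (Suc m) x = x (Suc m) # hword H \<rho> m x"
proof -
  interpret symplectic_action "\<G> m" "H (Suc m)" "action H \<rho> m" "B (Suc m)"
    by (rule symplectic_action[OF m])
  have "\<iota> (hword H \<rho> m x) = desc_prod S (\<lambda>j. \<iota> (embed H \<rho> m j (x j))) m"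
    unfolding hword_def using m x
    by (intro hom_desc_prod[OF G.is_monoid \<iota>_hom] embed_closed) (auto simp: \<iota>_def)
  also have "\<dots> = desc_prod S (\<lambda>j. embed H \<rho> (Suc m) j (x j)) m"
    by (intro desc_prod_cong) (auto simp: \<iota>_def)
  finally have "hword H \<rho> (Suc m) x = \<kappa> (x (Suc m)) \<otimes>\<^bsub>S\<^esub> \<iota> (hword H \<rho> m x)"
    by (simp add: hword_def \<kappa>_def del: semidirect_simps)
  also have "\<dots> = x (Suc m) # hword H \<rho> m x"
    using m x by (intro \<kappa>_\<iota> hword_closed) auto
  finally show ?thesis .
qed

lemma hword_eq_map:
  "m \<le> n \<Longrightarrow> (\<And>i. i \<in> {1..m} \<Longrightarrow> x i \<in> carrier (H i)) \<Longrightarrow> hword H \<rho> m x = map x (rev [1..<Suc m])"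
proof (induction m)
  case 0
  then show ?case by (simp add: hword_def)
next
  case (Suc m)
  then have m: "m < n" and IH: "hword H \<rho> m x = map x (rev [1..<Suc m])" by simp_all
  have "[1..<Suc (Suc m)] = [1..<Suc m] @ [Suc m]" by simp
  then show ?case using hword_Suc[OF m, of x, OF Suc.prems(2)] by (simp add: IH del: upt_Suc)
qed

lemma gsqrt_closed: "i \<in> {1..n} \<Longrightarrow> x \<in> carrier (H i) \<Longrightarrow> gsqrt (H i) x \<in> carrier (H i)"
  using symplectic_group.gsqrt_closed[OF symplectic_group, of "i - 1" x]
  by (cases i) auto

lemma hsqrt_hword:
  "m \<le> n \<Longrightarrow> (\<And>i. i \<in> {1..m} \<Longrightarrow> x i \<in> carrier (H i)) \<Longrightarrow>
    hword H \<rho> m (\<lambda>i. gsqrt (H i) (x i)) = hsqrt H m (hword H \<rho> m x)"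
proof (induction m)
  case 0
  then show ?case by (simp add: hword_def)
next
  case (Suc m)
  then have m: "m < n" and IH: "hword H \<rho> m (\<lambda>i. gsqrt (H i) (x i)) = hsqrt H m (hword H \<rho> m x)"
    by simp_all
  have sqrts: "gsqrt (H i) (x i) \<in> carrier (H i)" if "i \<in> {1..Suc m}" for i
    using gsqrt_closed[of i] Suc.prems that by auto
  show ?case
    using hword_Suc[OF m, of x, OF Suc.prems(2)] hword_Suc[OF m, of "\<lambda>i. gsqrt (H i) (x i)", OF sqrts]
    by (simp add: IH)
qed

text \<open>
  Every element of \<open>G\<^sub>n\<close> is uniquely a product \<open>x\<^sub>n \<cdots> x\<^sub>1\<close>, which is what turns the sum over all \<open>x\<^sub>i\<close> into
  a sum over the group.
\<close>

lemma bij_betw_hword: "bij_betw (hword H \<rho> n) (\<Pi>\<^sub>E i\<in>{1..n}. carrier (H i)) (carrier (\<G> n))"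
proof -
  have surj: "\<exists>x\<in>(\<Pi>\<^sub>E i\<in>{1..m}. carrier (H i)). hword H \<rho> m x = u" if "m \<le> n" "u \<in> carrier (\<G> m)" for m u
    using that
  proof (induction m arbitrary: u)
    case 0
    then show ?case by (auto simp: hword_def)
  next
    case (Suc m)
    then interpret symplectic_action "\<G> m" "H (Suc m)" "action H \<rho> m" "B (Suc m)"
      by (intro symplectic_action) auto
    have "u \<in> carrier S" using Suc.prems by simp
    then obtain h g where u: "u = h # g" "h \<in> carrier (H (Suc m))" "g \<in> carrier (\<G> m)"
      by (rule semidirect_carrierE)
    then obtain x where x: "x \<in> (\<Pi>\<^sub>E i\<in>{1..m}. carrier (H i))" "hword H \<rho> m x = g"
      using Suc by (metis Suc_leD)
    let ?y = "x(Suc m := h)"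
    have y: "?y \<in> (\<Pi>\<^sub>E i\<in>{1..Suc m}. carrier (H i))"
      using x(1) u(2) by (auto simp: PiE_iff extensional_def)
    have "hword H \<rho> m ?y = hword H \<rho> m x"
      unfolding hword_def by (intro desc_prod_cong) auto
    then have "hword H \<rho> (Suc m) ?y = u"
      using hword_Suc[of m ?y] y u x(2) Suc.prems by (auto simp: PiE_iff)
    then show ?case using y by blast
  qed
  have "inj_on (hword H \<rho> n) (\<Pi>\<^sub>E i\<in>{1..n}. carrier (H i))"
  proof (rule inj_onI)
    fix x y assume x: "x \<in> (\<Pi>\<^sub>E i\<in>{1..n}. carrier (H i))" and y: "y \<in> (\<Pi>\<^sub>E i\<in>{1..n}. carrier (H i))"
      and "hword H \<rho> n x = hword H \<rho> n y"
    then have "map x (rev [1..<Suc n]) = map y (rev [1..<Suc n])"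
      using hword_eq_map[of n x] hword_eq_map[of n y] by (simp add: PiE_iff del: upt_Suc)
    then have "x i = y i" if "i \<in> {1..n}" for i
      using that by (auto simp: map_eq_conv simp del: upt_Suc)
    then show "x = y" by (rule PiE_ext[OF x y])
  qed
  moreover have "hword H \<rho> n ` (\<Pi>\<^sub>E i\<in>{1..n}. carrier (H i)) = carrier (\<G> n)"
    using surj[OF order_refl] hword_closed[OF order_refl] by (force simp: PiE_iff)
  ultimately show ?thesis by (simp add: bij_betw_def)
qed

lemma order_hgroup_Suc: "m < n \<Longrightarrow> order (\<G> (Suc m)) = order (H (Suc m)) * order (\<G> m)"
proof -
  assume m: "m < n"
  interpret symplectic_action "\<G> m" "H (Suc m)" "action H \<rho> m" "B (Suc m)"
    by (rule symplectic_action[OF m])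
  show ?thesis using order_semidirect by simp
qed

lemma hcoeff_hword:
  assumes "m \<le> n" "\<And>i. i \<in> {1..m} \<Longrightarrow> x i \<in> carrier (H i)" "\<And>i. i \<in> {1..m} \<Longrightarrow> y i \<in> carrier (H i)"
  shows "hcoeff H \<rho> B m (hword H \<rho> m x) (hword H \<rho> m y) = inverse (of_nat (order (\<G> m))) *
     exp (\<Sum>j=1..m. sform (B j) (untwist H \<rho> j x (x j)) (untwist H \<rho> j y (gsqrt (H j) (y j))))"
  using assms
proof (induction m)
  case 0
  show ?case by (simp add: order_def)
next
  case (Suc m)
  then have m: "m < n" by simp
  interpret symplectic_action "\<G> m" "H (Suc m)" "action H \<rho> m" "B (Suc m)"
    by (rule symplectic_action[OF m])
  have untwist: "untwist H \<rho> (Suc m) z = action H \<rho> m (inv\<^bsub>\<G> m\<^esub> (hsqrt H m (hword H \<rho> m z)))"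
    and closed: "hsqrt H m (hword H \<rho> m z) \<in> carrier (\<G> m)"
    if "\<And>i. i \<in> {1..m} \<Longrightarrow> z i \<in> carrier (H i)" for z
  proof -
    show c: "hsqrt H m (hword H \<rho> m z) \<in> carrier (\<G> m)"
      using m that by (intro hsqrt_closed hword_closed) auto
    have "hword H \<rho> m (\<lambda>i. gsqrt (H i) (z i)) = hsqrt H m (hword H \<rho> m z)"
      using m that by (intro hsqrt_hword) auto
    then show "untwist H \<rho> (Suc m) z = action H \<rho> m (inv\<^bsub>\<G> m\<^esub> (hsqrt H m (hword H \<rho> m z)))"
      using inv_AutoGroup_action[OF c] by (simp add: untwist_def)
  qed
  let ?a = "untwist H \<rho> (Suc m) x (x (Suc m))" and ?b = "untwist H \<rho> (Suc m) y (gsqrt (H (Suc m)) (y (Suc m)))"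
  have ab: "?a \<in> carrier (H (Suc m))" "?b \<in> carrier (H (Suc m))"
    using Suc.prems closed[of x] closed[of y] untwist[of x] untwist[of y] by auto
  have "hcoeff H \<rho> B (Suc m) (hword H \<rho> (Suc m) x) (hword H \<rho> (Suc m) y) =
    hcoeff H \<rho> B m (hword H \<rho> m x) (hword H \<rho> m y) * (B (Suc m) ?b ?a / of_nat (order (H (Suc m))))"
    using Suc.prems(2,3) untwist[of x] untwist[of y] hword_Suc[OF m, of x, OF Suc.prems(2)]
      hword_Suc[OF m, of y, OF Suc.prems(3)] by simp
  also have "B (Suc m) ?b ?a = exp (sform (B (Suc m)) ?a ?b)"
    using H.exp_sform[OF ab] by (simp add: H.\<omega>_def)
  finally have step: "hcoeff H \<rho> B (Suc m) (hword H \<rho> (Suc m) x) (hword H \<rho> (Suc m) y) =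
    hcoeff H \<rho> B m (hword H \<rho> m x) (hword H \<rho> m y) *
      (exp (sform (B (Suc m)) ?a ?b) / of_nat (order (H (Suc m))))" .
  have IH: "hcoeff H \<rho> B m (hword H \<rho> m x) (hword H \<rho> m y) = inverse (of_nat (order (\<G> m))) *
     exp (\<Sum>j=1..m. sform (B j) (untwist H \<rho> j x (x j)) (untwist H \<rho> j y (gsqrt (H j) (y j))))"
    using Suc m by simp
  show ?case
    unfolding step IH order_hgroup_Suc[OF m] by (simp add: exp_add divide_inverse mult_ac)
qed

lemma twist_R_formula:
  "twist_R (group_algebra (\<G> n)) (hierarchy_twist H \<rho> J n) =
    (\<lambda>p. inverse (of_nat (order (\<G> n))) *
      (\<Sum>x\<in>(\<Pi>\<^sub>E i\<in>{1..n}. carrier (H i)). \<Sum>y\<in>(\<Pi>\<^sub>E i\<in>{1..n}. carrier (H i)).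
         exp (\<Sum>j=1..n. sform (B j) (untwist H \<rho> j x (x j)) (untwist H \<rho> j y (gsqrt (H j) (y j)))) *
         tens (bvec (hword H \<rho> n x)) (bvec (hword H \<rho> n y)) p))"
proof
  fix p :: "'a list \<times> 'a list"
  interpret group_twist "\<G> n" "hierarchy_twist H \<rho> J n"
    using fin_group_hgroup[of n] is_twist_hierarchy_twist[of n]
    by (simp add: group_twist_def group_twist_axioms_def)
  let ?X = "\<Pi>\<^sub>E i\<in>{1..n}. carrier (H i)" and ?r = "hcoeff H \<rho> B n"
  have "inverse (of_nat (order (\<G> n))) * (\<Sum>x\<in>?X. \<Sum>y\<in>?X.
       exp (\<Sum>j=1..n. sform (B j) (untwist H \<rho> j x (x j)) (untwist H \<rho> j y (gsqrt (H j) (y j)))) *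
       tens (bvec (hword H \<rho> n x)) (bvec (hword H \<rho> n y)) p) =
    (\<Sum>x\<in>?X. \<Sum>y\<in>?X. ?r (hword H \<rho> n x) (hword H \<rho> n y) *
       bvec (hword H \<rho> n x, hword H \<rho> n y) p)"
    unfolding sum_distrib_left tens_bvec
    by (intro sum.cong refl, subst hcoeff_hword) (auto simp: PiE_iff)
  also have "\<dots> = (\<Sum>x\<in>?X. \<Sum>g'\<in>carrier (\<G> n). ?r (hword H \<rho> n x) g' * bvec (hword H \<rho> n x, g') p)"
    by (intro sum.cong refl sum.reindex_bij_betw[OF bij_betw_hword])
  also have "\<dots> = (\<Sum>g\<in>carrier (\<G> n). \<Sum>g'\<in>carrier (\<G> n). ?r g g' * bvec (g, g') p)"
    by (rule sum.reindex_bij_betw[OF bij_betw_hword])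
  also have "\<dots> = ev (carrier GG) R (\<lambda>q. bvec q p)"
    unfolding carrier_DirProd ev_Times_snd unfolding ev_def by (intro sum.cong refl) (simp add: twist_R_eq)
  also have "\<dots> = R p" by (rule ev_test_bvec[OF G2.fin R_vecs])
  finally show "R p = inverse (of_nat (order (\<G> n))) * (\<Sum>x\<in>?X. \<Sum>y\<in>?X.
       exp (\<Sum>j=1..n. sform (B j) (untwist H \<rho> j x (x j)) (untwist H \<rho> j y (gsqrt (H j) (y j)))) *
       tens (bvec (hword H \<rho> n x)) (bvec (hword H \<rho> n y)) p)" by simp
qed

lemma minimal_hierarchy_twist: "minimal_twist (\<G> n) (hierarchy_twist H \<rho> J n)"
proof -
  interpret group_twist "\<G> n" "hierarchy_twist H \<rho> J n"
    using fin_group_hgroup[of n] is_twist_hierarchy_twist[of n]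
    by (simp add: group_twist_def group_twist_axioms_def)
  have "order (\<G> n) \<noteq> 0" using one_closed by (auto simp: order_def)
  then show ?thesis
    using hadamard_hcoeff[of n]
    by (intro minimal_twistI[where S = "\<lambda>y z. inverse (hcoeff H \<rho> B n z y) / of_nat (order (\<G> n))"])
       (auto simp: hadamard_def twist_R_eq divide_inverse mult.assoc[symmetric] simp flip: sum_distrib_right)
qed

lemma triangular_hierarchy_twist:
  "triangular (twisted (group_algebra (\<G> n)) (hierarchy_twist H \<rho> J n))
     (twist_R (group_algebra (\<G> n)) (hierarchy_twist H \<rho> J n))"
proof -
  interpret group_twist "\<G> n" "hierarchy_twist H \<rho> J n"
    using fin_group_hgroup[of n] is_twist_hierarchy_twist[of n]
    by (simp add: group_twist_def group_twist_axioms_def)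
  show ?thesis by (rule triangular_twisted)
qed

end

theorem theorem3p1:
  fixes n :: nat
    and H :: "nat \<Rightarrow> 'a monoid"
    and \<rho> :: "nat \<Rightarrow> 'a list \<Rightarrow> 'a \<Rightarrow> 'a"
    and J :: "nat \<Rightarrow> 'a \<times> 'a \<Rightarrow> complex"
    and B :: "nat \<Rightarrow> 'a \<Rightarrow> 'a \<Rightarrow> complex"
  assumes "n \<ge> 1"
    and "symplectic_hierarchy n H \<rho> J B"
  shows "let G = hgroup H \<rho> n;
             Jbar = hierarchy_twist H \<rho> J n;
             R = twist_R (group_algebra G) Jbar
         in triangular (twisted (group_algebra G) Jbar) R \<and>
            minimal_twist G Jbar \<and>
            R = (\<lambda>p. inverse (of_nat (order G)) *
                  (\<Sum>x\<in>(\<Pi>\<^sub>E i\<in>{1..n}. carrier (H i)). \<Sum>y\<in>(\<Pi>\<^sub>E i\<in>{1..n}. carrier (H i)).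
                     exp (\<Sum>j=1..n. sform (B j) (untwist H \<rho> j x (x j))
                                                (untwist H \<rho> j y (gsqrt (H j) (y j)))) *
                     tens (bvec (hword H \<rho> n x)) (bvec (hword H \<rho> n y)) p))"
proof -
  interpret hierarchical_twist n H \<rho> J B by unfold_locales (rule assms(2))
  show ?thesis
    unfolding Let_def
    by (intro conjI triangular_hierarchy_twist minimal_hierarchy_twist twist_R_formula)
qed

end
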